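(* Roumieu case. Let $\mathbf{M}\in\mathcal{LC}$ and set $M_\alpha:=M_{|\alpha|}$ for $\alpha\in\mathbb{N}_0^d$. Assume that: (a) $\exists B,C,H>0\ \forall p,q\in\mathbb{N}_0:\ p^{p/2}M_q\le BC^pH^{p+q}M_{p+q}$; (b) $\exists D\ge 1\ \forall p\in\mathbb{N}_0:\ M_{p+1}\le D^{p+1}M_p$; (c) $\exists L\ge 1\ \forall t\ge 0:\ \omega_{\mathbf{M}}(2t)\le L(\omega_{\mathbf{M}}(t)+1)$. Then the following are equivalent: (i) $\exists C\ge 1\ \forall p,q\in\mathbb{N}_0:\ M_{p+q}\le C^{p+q}M_pM_q$; (ii) there exists a weight function $\omega$ satisfying $$\exists H\ge 1\ \forall t\ge 0:\ 2\omega(t)\le\omega(Ht)+H$$ such that for all $d\in\mathbb{N}$ one has $\mathcal{S}_{\{\omega\}}(\mathbb{R}^d)=\mathcal{S}_{\{\mathbf{M}\}}(\mathbb{R}^d)$ as topological vector spaces. Beurling case. Let $\mathbf{M}\in\mathcal{LC}$ satisfy (b), (c) and (a)' $\exists H>0\ \forall C>0\ \exists B>0\ \forall p,q\in\mathbb{N}_0:\ p^{p/2}M_q\le BC^pH^{p+q}M_{p+q}$. Then (i) is equivalent to the existence of a weight function $\omega$ with $\omega(t)=o(t^2)$ as $t\to\infty$, satisfying $\exists H\ge 1\ \forall t\ge 0:\ 2\omega(t)\le\omega(Ht)+H$, such that for all $d\in\mathbb{N}$ one has $\mathcal{S}_{(\omega)}(\mathbb{R}^d)=\mathcal{S}_{(\mathbf{M})}(\mathbb{R}^d)$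 as topological vector spaces. In both cases, when the equivalent conditions hold, one can take $\omega=\omega_{\mathbf{M}}$ in (ii), and the space can be defined by separated or joint growth at infinity.
   Context: $\mathbb{N}_0=\mathbb{N}\cup\{0\}$ and $0^0=1$. $\mathcal{LC}$ is the set of positive sequences $\mathbf{M}=(M_p)_{p\in\mathbb{N}_0}$ with $M_1\ge M_0=1$, $M_p^2\le M_{p-1}M_{p+1}$ for $p\ge 1$, and $\lim_{p\to\infty}(M_p)^{1/p}=\infty$. The associated function is $\omega_{\mathbf{M}}(t)=\sup_{p\in\mathbb{N}_0}\log\frac{|t|^p}{M_p}$ with $\log 0:=-\infty$. A weight function is a continuous increasing (i.e. nondecreasing) function $\omega:[0,+\infty)\to[0,+\infty)$ such that: $(\alpha)$ there is $L\ge 1$ with $\omega(2t)\le L(\omega(t)+1)$ for all $t\ge 0$; $(\beta)$ $\omega(t)=O(t^2)$ as $t\to+\infty$; $(\gamma)$ $\log t=o(\omega(t))$ as $t\to+\infty$; $(\delta)$ $\varphi_\omega(t):=\omega(e^t)$ is convex on $[0,+\infty)$. Put $\varphi^*_\omega(s):=\sup_{t\ge 0}\{ts-\varphi_\omega(t)\}$, $s\ge 0$, and $W^{(\lambda)}_\alpha:=e^{\frac1\lambda\varphi^*_\omega(\lambda|\alpha|)}$ for $\lambda>0$, $\alpha\in\mathbb{N}_0^d$. Spaces ($\|\cdot\|_\infty$ is the supremum norm on $\mathbb{R}^d$). $\mathcal{S}_{\{\omega\}}(\mathbb{R}^d)$, resp. $\mathcal{S}_{(\omega)}(\mathbb{R}^d)$: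 all $f\in C^\infty(\mathbb{R}^d)$ with $\sup_{\alpha,\beta\in\mathbb{N}_0^d}\|x^\alpha\partial^\beta f\|_\infty/W^{(\lambda)}_{\alpha+\beta}<\infty$ for some $\lambda>0$, resp. for all $\lambda>0$. $\mathcal{S}_{\{\mathbf{M}\}}(\mathbb{R}^d)$, resp. $\mathcal{S}_{(\mathbf{M})}(\mathbb{R}^d)$: all $f\in C^\infty(\mathbb{R}^d)$ with $\sup_{\alpha,\beta\in\mathbb{N}_0^d}\frac{\|x^\alpha\partial^\beta f\|_\infty}{h^{|\alpha+\beta|}M_{\alpha+\beta}}<\infty$ for some $h>0$, resp. for all $h>0$. The spaces with braces (Roumieu) carry the inductive limit topology, those with parentheses (Beurling) the projective limit topology. These are the definitions by joint growth at infinity; in the definitions by separated growth at infinity, $W^{(\lambda)}_{\alpha+\beta}$, resp. $M_{\alpha+\beta}$, is replaced by $W^{(\lambda)}_\alpha W^{(\lambda)}_\beta$, resp. $M_\alpha M_\beta$. *)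

theory Defs
  imports "HOL-Analysis.Analysis" "HOL-Library.Landau_Symbols"
begin

definition LC :: "(nat \<Rightarrow> real) \<Rightarrow> bool" where
  "LC M \<longleftrightarrow> (\<forall>p. M p > 0) \<and> M 0 = 1 \<and> M 1 \<ge> 1 \<and>
     (\<forall>p\<ge>1. (M p)\<^sup>2 \<le> M (p - 1) * M (p + 1)) \<and>
     filterlim (\<lambda>p. M p powr (1 / real p)) at_top sequentially"

definition elog :: "real \<Rightarrow> ereal" where
  "elog x = (if x = 0 then -\<infinity> else ereal (ln x))"

text \<open>The supremum is finite for every \<open>M\<close> in \<^const>\<open>LC\<close>, since then
  \<open>\<bar>t\<bar> ^ p / M p\<close> tends to 0; so the cast to \<^typ>\<open>real\<close> is harmless there.\<close>

definition assoc_fun :: "(nat \<Rightarrow> real) \<Rightarrow> real \<Rightarrow> real" where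
  "assoc_fun M t = real_of_ereal (SUP p. elog (\<bar>t\<bar> ^ p / M p))"

text \<open>Functions on \<open>[0, \<infinity>)\<close> are represented by total functions on the reals of which only
  the values at nonnegative arguments matter.\<close>

definition weight_function :: "(real \<Rightarrow> real) \<Rightarrow> bool" where
  "weight_function \<omega> \<longleftrightarrow>
     continuous_on {0..} \<omega> \<and> mono_on {0..} \<omega> \<and> (\<forall>t\<ge>0. \<omega> t \<ge> 0) \<and>
     (\<exists>L\<ge>1. \<forall>t\<ge>0. \<omega> (2 * t) \<le> L * (\<omega> t + 1)) \<and>
     \<omega> \<in> O[at_top](\<lambda>t. t\<^sup>2) \<and>
     ln \<in> o[at_top](\<omega>) \<and>
     convex_on {0..} (\<lambda>t. \<omega> (exp t))"

text \<open>For a weight function the supremum is over a set that is bounded above, because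
  \<open>t\<close> is \<open>o(\<omega> (exp t))\<close>.\<close>

definition young_conj :: "(real \<Rightarrow> real) \<Rightarrow> real \<Rightarrow> real" where
  "young_conj \<omega> s = (SUP t\<in>{0..}. t * s - \<omega> (exp t))"

text \<open>Since \<open>d\<close> has to be quantified inside formulas, \<open>\<real>\<^sup>d\<close> (and likewise the set of multi-indices)
  is the set of sequences supported in \<open>{..<d}\<close>.  The topology of \<^typ>\<open>nat \<Rightarrow> real\<close> is the
  product topology, which induces the Euclidean one on this set.\<close>

definition Rd :: "nat \<Rightarrow> (nat \<Rightarrow> real) set" where
  "Rd d = {x. \<forall>i\<ge>d. x i = 0}"

definition multi_indices :: "nat \<Rightarrow> (nat \<Rightarrow> nat) set" where
  "multi_indices d = {\<alpha>. \<forall>i\<ge>d. \<alpha> i = 0}"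

definition mi_order :: "nat \<Rightarrow> (nat \<Rightarrow> nat) \<Rightarrow> nat" where
  "mi_order d \<alpha> = (\<Sum>i<d. \<alpha> i)"

definition mi_add :: "(nat \<Rightarrow> nat) \<Rightarrow> (nat \<Rightarrow> nat) \<Rightarrow> nat \<Rightarrow> nat" where
  "mi_add \<alpha> \<beta> = (\<lambda>i. \<alpha> i + \<beta> i)"

definition monomial :: "nat \<Rightarrow> (nat \<Rightarrow> nat) \<Rightarrow> (nat \<Rightarrow> real) \<Rightarrow> real" where
  "monomial d \<alpha> x = (\<Prod>i<d. x i ^ \<alpha> i)"

definition partial :: "nat \<Rightarrow> ((nat \<Rightarrow> real) \<Rightarrow> complex) \<Rightarrow> (nat \<Rightarrow> real) \<Rightarrow> complex" where
  "partial i f x = vector_derivative (\<lambda>t. f (x(i := t))) (at (x i))"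

primrec mderiv :: "nat \<Rightarrow> (nat \<Rightarrow> nat) \<Rightarrow> ((nat \<Rightarrow> real) \<Rightarrow> complex) \<Rightarrow> (nat \<Rightarrow> real) \<Rightarrow> complex" where
  "mderiv 0 \<beta> f = f"
| "mderiv (Suc k) \<beta> f = mderiv k \<beta> ((partial k ^^ \<beta> k) f)"

text \<open>All iterated partial derivatives, taken in any order, exist and are continuous.  Outside
  \<^term>\<open>Rd d\<close> a function takes the dummy value 0, so that equality of functions on \<open>\<real>\<^sup>d\<close> is
  equality in the type.\<close>

definition smooth_functions :: "nat \<Rightarrow> ((nat \<Rightarrow> real) \<Rightarrow> complex) set" where
  "smooth_functions d = {f. (\<forall>x. x \<notin> Rd d \<longrightarrow> f x = 0) \<and>
     (\<forall>is. set is \<subseteq> {..<d} \<longrightarrow>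
        continuous_on (Rd d) (foldr partial is f) \<and>
        (\<forall>x\<in>Rd d. \<forall>i<d. (\<lambda>t. foldr partial is f (x(i := t))) differentiable at (x i)))}"

definition seminorm_on :: "('a \<Rightarrow> complex) set \<Rightarrow> (('a \<Rightarrow> complex) \<Rightarrow> real) \<Rightarrow> bool" where
  "seminorm_on E p \<longleftrightarrow>
     (\<forall>f\<in>E. p f \<ge> 0) \<and>
     (\<forall>f\<in>E. \<forall>c. p (\<lambda>x. c * f x) = cmod c * p f) \<and>
     (\<forall>f\<in>E. \<forall>g\<in>E. p (\<lambda>x. f x + g x) \<le> p f + p g)"

definition seminorm_topology ::
    "('a \<Rightarrow> complex) set \<Rightarrow> (('a \<Rightarrow> complex) \<Rightarrow> real) set \<Rightarrow> ('a \<Rightarrow> complex) topology" where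
  "seminorm_topology E P =
     topology_generated_by {{g\<in>E. p (\<lambda>x. g x - f x) < \<epsilon>} | p f \<epsilon>. p \<in> P \<and> f \<in> E \<and> \<epsilon> > 0}"

definition sup_norm :: "nat \<Rightarrow> ((nat \<Rightarrow> real) \<Rightarrow> complex) \<Rightarrow> ennreal" where
  "sup_norm d g = (SUP x\<in>Rd d. ennreal (cmod (g x)))"

type_synonym mi_weight = "(nat \<Rightarrow> nat) \<Rightarrow> (nat \<Rightarrow> nat) \<Rightarrow> real"

definition weighted_norm :: "nat \<Rightarrow> mi_weight \<Rightarrow> ((nat \<Rightarrow> real) \<Rightarrow> complex) \<Rightarrow> ennreal" where
  "weighted_norm d w f =
     (SUP \<alpha>\<in>multi_indices d. SUP \<beta>\<in>multi_indices d.
        sup_norm d (\<lambda>x. of_real (monomial d \<alpha> x) * mderiv d \<beta> f x) / ennreal (w \<alpha> \<beta>))"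

definition step_space :: "nat \<Rightarrow> mi_weight \<Rightarrow> ((nat \<Rightarrow> real) \<Rightarrow> complex) set" where
  "step_space d w = {f \<in> smooth_functions d. weighted_norm d w f < \<infinity>}"

definition step_norm :: "nat \<Rightarrow> mi_weight \<Rightarrow> ((nat \<Rightarrow> real) \<Rightarrow> complex) \<Rightarrow> real" where
  "step_norm d w f = enn2real (weighted_norm d w f)"

text \<open>A space is a pair of its underlying set and its topology.  The vector space operations are
  always the pointwise ones, so equality of such pairs is equality as topological vector spaces.\<close>

type_synonym function_space =
  "((nat \<Rightarrow> real) \<Rightarrow> complex) set \<times> ((nat \<Rightarrow> real) \<Rightarrow> complex) topology"

text \<open>Inductive limit topology: the finest locally convex topology for which the inclusions of all
  steps are continuous, i.e. the one defined by all seminorms whose restriction to each step is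
  continuous.\<close>

definition roumieu :: "nat \<Rightarrow> (real \<Rightarrow> mi_weight) \<Rightarrow> function_space" where
  "roumieu d v =
     (let E = (\<Union>l\<in>{0<..}. step_space d (v l)) in
        (E, seminorm_topology E
              {p. seminorm_on E p \<and>
                  (\<forall>l>0. continuous_map
                           (seminorm_topology (step_space d (v l)) {step_norm d (v l)})
                           euclideanreal p)}))"

definition beurling :: "nat \<Rightarrow> (real \<Rightarrow> mi_weight) \<Rightarrow> function_space" where
  "beurling d v =
     (let E = (\<Inter>l\<in>{0<..}. step_space d (v l)) in
        (E, seminorm_topology E ((\<lambda>l. step_norm d (v l)) ` {0<..})))"

datatype growth = Joint | Separated

definition W :: "(real \<Rightarrow> real) \<Rightarrow> nat \<Rightarrow> real \<Rightarrow> (nat \<Rightarrow> nat) \<Rightarrow> real" where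
  "W \<omega> d l \<alpha> = exp (1 / l * young_conj \<omega> (l * real (mi_order d \<alpha>)))"

fun fun_weight :: "growth \<Rightarrow> (real \<Rightarrow> real) \<Rightarrow> nat \<Rightarrow> real \<Rightarrow> mi_weight" where
  "fun_weight Joint \<omega> d l \<alpha> \<beta> = W \<omega> d l (mi_add \<alpha> \<beta>)"
| "fun_weight Separated \<omega> d l \<alpha> \<beta> = W \<omega> d l \<alpha> * W \<omega> d l \<beta>"

fun seq_weight :: "growth \<Rightarrow> (nat \<Rightarrow> real) \<Rightarrow> nat \<Rightarrow> real \<Rightarrow> mi_weight" where
  "seq_weight Joint M d h \<alpha> \<beta> =
     h ^ mi_order d (mi_add \<alpha> \<beta>) * M (mi_order d (mi_add \<alpha> \<beta>))"
| "seq_weight Separated M d h \<alpha> \<beta> =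
     h ^ mi_order d (mi_add \<alpha> \<beta>) * (M (mi_order d \<alpha>) * M (mi_order d \<beta>))"

definition S_fun_roumieu :: "growth \<Rightarrow> (real \<Rightarrow> real) \<Rightarrow> nat \<Rightarrow> function_space" where
  "S_fun_roumieu g \<omega> d = roumieu d (fun_weight g \<omega> d)"

definition S_fun_beurling :: "growth \<Rightarrow> (real \<Rightarrow> real) \<Rightarrow> nat \<Rightarrow> function_space" where
  "S_fun_beurling g \<omega> d = beurling d (fun_weight g \<omega> d)"

definition S_seq_roumieu :: "growth \<Rightarrow> (nat \<Rightarrow> real) \<Rightarrow> nat \<Rightarrow> function_space" where
  "S_seq_roumieu g M d = roumieu d (seq_weight g M d)"

definition S_seq_beurling :: "growth \<Rightarrow> (nat \<Rightarrow> real) \<Rightarrow> nat \<Rightarrow> function_space" where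
  "S_seq_beurling g M d = beurling d (seq_weight g M d)"

definition weight_doubling :: "(real \<Rightarrow> real) \<Rightarrow> bool" where
  "weight_doubling \<omega> \<longleftrightarrow> (\<exists>H\<ge>1. \<forall>t\<ge>0. 2 * \<omega> t \<le> \<omega> (H * t) + H)"

text \<open>\<open>p\<^sup>p\<^sup>/\<^sup>2\<close> is written \<open>sqrt p ^ p\<close>, which has the value 1 at \<open>p = 0\<close> (unlike \<open>0 powr 0\<close>).\<close>

definition cond_a_roumieu :: "(nat \<Rightarrow> real) \<Rightarrow> bool" where
  "cond_a_roumieu M \<longleftrightarrow>
     (\<exists>B>0. \<exists>C>0. \<exists>H>0. \<forall>p q. sqrt (real p) ^ p * M q \<le> B * C ^ p * H ^ (p + q) * M (p + q))"

definition cond_a_beurling :: "(nat \<Rightarrow> real) \<Rightarrow> bool" where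
  "cond_a_beurling M \<longleftrightarrow>
     (\<exists>H>0. \<forall>C>0. \<exists>B>0. \<forall>p q. sqrt (real p) ^ p * M q \<le> B * C ^ p * H ^ (p + q) * M (p + q))"

definition cond_i :: "(nat \<Rightarrow> real) \<Rightarrow> bool" where
  "cond_i M \<longleftrightarrow> (\<exists>C\<ge>1. \<forall>p q. M (p + q) \<le> C ^ (p + q) * M p * M q)"

definition realizes_roumieu :: "(nat \<Rightarrow> real) \<Rightarrow> (real \<Rightarrow> real) \<Rightarrow> bool" where
  "realizes_roumieu M \<omega> \<longleftrightarrow> weight_function \<omega> \<and> weight_doubling \<omega> \<and>
     (\<forall>d\<ge>1. S_fun_roumieu Joint \<omega> d = S_seq_roumieu Joint M d)"

definition realizes_beurling :: "(nat \<Rightarrow> real) \<Rightarrow> (real \<Rightarrow> real) \<Rightarrow> bool" where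
  "realizes_beurling M \<omega> \<longleftrightarrow> weight_function \<omega> \<and> \<omega> \<in> o[at_top](\<lambda>t. t\<^sup>2) \<and> weight_doubling \<omega> \<and>
     (\<forall>d\<ge>1. S_fun_beurling Joint \<omega> d = S_seq_beurling Joint M d)"

end

theory Submission
  imports Defs
begin

text \<open>Write \<open>\<omega>\<^sub>M\<close> for \<open>assoc_fun M\<close>.  Both kinds of weights are suprema of the same form: for a log-convex
  sequence \<open>M n = sup x ^ n * exp (- \<omega>\<^sub>M x)\<close>, and for a weight function the weight of order \<open>n\<close> with
  parameter \<open>l\<close> is \<open>sup x ^ n * exp (- \<omega> x / l)\<close> over \<open>x \<ge> 1\<close>.  Replacing \<open>M n\<close> by \<open>h ^ n * M n\<close>
  dilates \<open>\<omega>\<^sub>M\<close>, replacing \<open>l\<close> by \<open>l'\<close> multiplies \<open>\<omega>\<close> by a constant.  Hence everything is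
  decided by inequalities between weight functions up to dilations, factors and additive constants.

  Condition (i) is equivalent to \<open>2 * \<omega>\<^sub>M t \<le> \<omega>\<^sub>M (H * t) + K\<close>
  (\<open>cond_i_imp_assoc_fun_doubling\<close>, \<open>assoc_fun_doubling_imp_cond_i\<close>).  Given (i), this doubling trades
  factors for dilations, and \<open>\<omega>\<^sub>M (2 * t) \<le> L * (\<omega>\<^sub>M t + 1)\<close> trades dilations for factors.  So the two
  families of weights dominate each other, and mutually dominated families define the same
  topological vector space (\<open>roumieu_cong\<close>, \<open>beurling_cong\<close>, \<open>assoc_fun_realizes_spaces\<close>).
  Separated and joint growth are compared in the same way.

  For the converse dimension one suffices.  The test functions are the Gaussians \<open>f\<close> centred at
  \<open>s \<ge> 0\<close>.  Their derivatives satisfy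
  \<open>\<bar>x\<bar> ^ a * \<bar>f\<^sup>(\<^sup>b\<^sup>) x\<bar> \<le> 2 ^ (a + b + 1) * (s ^ a * sqrt b ^ b + sqrt (a + b) ^ (a + b))\<close>, and condition (a)
  is exactly what turns this into a bound \<open>const * exp (\<omega>\<^sub>M (c * s / h))\<close> for their norm in the step
  with parameter \<open>h\<close>; with the growth bound on \<open>\<omega>\<close> the norm in the other space is at most
  \<open>const * exp (\<omega> (2 * s) / l)\<close>.  Conversely, since \<open>f s = 1\<close>, evaluation at \<open>s\<close> bounds each norm from
  below by an exponential of the same kind (\<open>eval_seq_bound\<close>, \<open>eval_fun_bound\<close>).  If the spaces agree as
  topological vector spaces, their norms are comparable in the sense appropriate to the limit
  (\<open>beurling_eq_imp_growth_le\<close>, and \<open>roumieu_eq_imp_growth_le\<close> by a gliding hump), and applying this to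
  the Gaussians yields \<open>\<omega>\<^sub>M (s / h) \<le> K + \<omega> (2 * s) / l\<close> and \<open>\<omega> s / l' \<le> K + \<omega>\<^sub>M (r * s)\<close>, up to a
  logarithm.  One of the two parameters \<open>l\<close>, \<open>l'\<close> can be chosen after the other, so that
  \<open>l \<ge> 4 * l'\<close>; combining the inequalities then doubles \<open>\<omega>\<^sub>M\<close>, whence (i).\<close>

section \<open>Log-convex sequences and their associated functions\<close>

lemma LC_pos: "LC M \<Longrightarrow> M p > 0"
  by (simp add: LC_def)

lemma LC_0: "LC M \<Longrightarrow> M 0 = 1"
  by (simp add: LC_def)

lemma LC_ratio_mono:
  assumes "LC M"
  shows "incseq (\<lambda>k. M (Suc k) / M k)"
proof (rule incseq_SucI)
  fix k
  have "(M (Suc k))\<^sup>2 \<le> M k * M (Suc (Suc k))"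
    using assms unfolding LC_def by (metis Suc_eq_plus1 add_diff_cancel_right' le_add2)
  then show "M (Suc k) / M k \<le> M (Suc (Suc k)) / M (Suc k)"
    using LC_pos[OF assms] by (simp add: field_simps power2_eq_square)
qed

lemma LC_ratio_ge_1:
  assumes "LC M"
  shows "M (Suc k) / M k \<ge> 1"
proof -
  have "M (Suc 0) / M 0 \<ge> 1"
    using assms by (simp add: LC_def)
  also have "M (Suc 0) / M 0 \<le> M (Suc k) / M k"
    using incseqD[OF LC_ratio_mono[OF assms], of 0 k] by simp
  finally show ?thesis .
qed

lemma LC_ge_1:
  assumes "LC M"
  shows "M p \<ge> 1"
proof (induction p)
  case 0
  then show ?case using LC_0[OF assms] by simp
next
  case (Suc p)
  then show ?case
    using LC_ratio_ge_1[OF assms, of p] LC_pos[OF assms, of p] by (simp add: field_simps)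
qed

lemma LC_mult_le:
  assumes "LC M"
  shows "M p * M q \<le> M (p + q)"
proof (induction q)
  case 0
  then show ?case using LC_0[OF assms] by simp
next
  case (Suc q)
  have pos: "\<And>k. M k > 0" using LC_pos[OF assms] .
  have "M p * M (Suc q) = (M p * M q) * (M (Suc q) / M q)"
    using pos[of q] by simp
  also have "\<dots> \<le> M (p + q) * (M (Suc (p + q)) / M (p + q))"
    using Suc.IH incseqD[OF LC_ratio_mono[OF assms], of q "p + q"] pos
    by (intro mult_mono) (auto simp: less_imp_le)
  also have "\<dots> = M (p + Suc q)"
    using pos[of "p + q"] by simp
  finally show ?case .
qed

text \<open>With \<open>t = M (n + 1) / M n\<close>, log-convexity makes \<open>k \<mapsto> t ^ k / M k\<close> increase up to \<open>n\<close> and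
  decrease from there on.\<close>

lemma LC_tangent:
  assumes "LC M"
  defines "t \<equiv> \<lambda>n. M (Suc n) / M n"
  shows "t n ^ k * M n \<le> t n ^ n * M k"
proof -
  have pos: "\<And>k. M k > 0" using LC_pos[OF assms(1)] .
  have tpos: "\<And>k. t k > 0" by (simp add: t_def pos)
  have step: "M (Suc k) = t k * M k" for k
    using pos[of k] by (simp add: t_def)
  have mono: "i \<le> j \<Longrightarrow> t i \<le> t j" for i j
    using incseqD[OF LC_ratio_mono[OF assms(1)]] by (simp add: t_def)
  have up: "t n ^ i * M n \<le> M (n + i)" for i
  proof (induction i)
    case (Suc i)
    have "t n ^ Suc i * M n = t n * (t n ^ i * M n)" by simp
    also have "\<dots> \<le> t (n + i) * M (n + i)"
      using Suc mono[of n "n + i"] tpos[of n] pos[of n] tpos[of "n + i"]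
      by (intro mult_mono) (auto simp: less_imp_le)
    finally show ?case by (simp add: step)
  qed simp
  have down: "M (j + i) \<le> t n ^ i * M j" if "j + i = n" for i j
    using that
  proof (induction i arbitrary: j)
    case (Suc i)
    have "M (j + Suc i) \<le> t n ^ i * M (Suc j)"
      using Suc.IH[of "Suc j"] Suc.prems by simp
    also have "\<dots> \<le> t n ^ i * (t n * M j)"
      using mono[of j n] Suc.prems tpos[of n] pos[of j] by (simp add: step)
    finally show ?case by (simp add: mult_ac)
  qed simp
  show ?thesis
  proof (cases "k \<le> n")
    case True
    then have "M n \<le> t n ^ (n - k) * M k"
      using down[of k "n - k"] by simp
    then have "t n ^ k * M n \<le> t n ^ k * (t n ^ (n - k) * M k)"
      using tpos[of n] by simp
    also have "\<dots> = t n ^ n * M k"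
      using True by (simp add: power_add[symmetric] mult.assoc[symmetric])
    finally show ?thesis .
  next
    case False
    then have "t n ^ n * (t n ^ (k - n) * M n) \<le> t n ^ n * M k"
      using up[of "k - n"] tpos[of n] by simp
    moreover have "t n ^ n * (t n ^ (k - n) * M n) = t n ^ k * M n"
      using False by (simp add: power_add[symmetric] mult.assoc[symmetric])
    ultimately show ?thesis by simp
  qed
qed

text \<open>Eventually \<open>t ^ p \<le> M p\<close>, because the roots of \<open>M p\<close> tend to infinity.  So the supremum in the
  definition of the associated function is finite.\<close>

lemma LC_dominates_powers:
  assumes "LC M" "t \<ge> 0"
  shows "\<exists>K\<ge>1. \<forall>p. t ^ p \<le> M p * K"
proof -
  have pos: "\<And>k. M k > 0" using LC_pos[OF assms(1)] .
  have "eventually (\<lambda>p. M p powr (1 / real p) \<ge> t) sequentially"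
    using assms by (simp add: LC_def filterlim_at_top)
  then obtain N where N: "\<And>p. p \<ge> N \<Longrightarrow> M p powr (1 / real p) \<ge> t"
    by (auto simp: eventually_sequentially)
  define K where "K = 1 + (\<Sum>p\<le>N. t ^ p / M p)"
  have S: "(\<Sum>p\<le>N. t ^ p / M p) \<ge> 0"
    by (intro sum_nonneg) (use pos assms(2) in \<open>auto simp: less_imp_le\<close>)
  have "t ^ p \<le> M p * K" for p
  proof (cases "p \<le> N")
    case True
    have "t ^ p / M p \<le> (\<Sum>p\<le>N. t ^ p / M p)"
      by (rule member_le_sum) (use True pos assms(2) in \<open>auto simp: less_imp_le\<close>)
    then have "t ^ p / M p \<le> K" by (simp add: K_def)
    then show ?thesis using pos[of p] by (simp add: field_simps)
  next
    case False
    then have "t ^ p \<le> (M p powr (1 / real p)) ^ p"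
      using N[of p] assms(2) by (intro power_mono) auto
    also have "\<dots> = M p"
      using False pos[of p] by (simp add: powr_realpow[symmetric] powr_powr)
    also have "\<dots> \<le> M p * K"
      using pos[of p] S by (simp add: K_def)
    finally show ?thesis .
  qed
  moreover have "K \<ge> 1" using S by (simp add: K_def)
  ultimately show ?thesis by blast
qed

text \<open>The universal property of the supremum, with the extended reals and the logarithm of \<open>0\<close>
  eliminated.\<close>

lemma assoc_fun_le_iff:
  assumes "LC M" "t \<ge> 0"
  shows "assoc_fun M t \<le> c \<longleftrightarrow> (\<forall>p. t ^ p \<le> M p * exp c)"
proof -
  have pos: "\<And>k. M k > 0" using LC_pos[OF assms(1)] .
  define S where "S = (SUP p. elog (\<bar>t\<bar> ^ p / M p))"
  have le: "elog (\<bar>t\<bar> ^ p / M p) \<le> ereal c \<longleftrightarrow> t ^ p \<le> M p * exp c" for p c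
  proof (cases "t ^ p = 0")
    case True
    then show ?thesis using assms(2) pos[of p] by (simp only: elog_def) (simp add: less_imp_le)
  next
    case False
    then have "t ^ p > 0" using assms(2) by (metis less_eq_real_def zero_le_power)
    moreover from this have "ln (t ^ p / M p) \<le> c \<longleftrightarrow> t ^ p / M p \<le> exp c"
      using pos[of p] by (metis divide_pos_pos exp_le_cancel_iff exp_ln)
    moreover have "\<dots> \<longleftrightarrow> t ^ p \<le> M p * exp c"
      using pos[of p] by (simp add: field_simps)
    moreover have "elog (\<bar>t\<bar> ^ p / M p) = ereal (ln (t ^ p / M p))"
      using False assms(2) pos[of p] by (simp only: elog_def) simp
    ultimately show ?thesis by simp
  qed
  have Sle: "S \<le> ereal c \<longleftrightarrow> (\<forall>p. t ^ p \<le> M p * exp c)" for c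
    unfolding S_def by (simp add: SUP_le_iff le)
  obtain K where K: "K \<ge> 1" "\<And>p. t ^ p \<le> M p * K"
    using LC_dominates_powers[OF assms] by blast
  have "S \<le> ereal (ln K)"
    unfolding Sle using K by simp
  moreover have "S \<ge> 0"
  proof -
    have "elog (\<bar>t\<bar> ^ 0 / M 0) \<le> S"
      unfolding S_def by (rule SUP_upper) simp
    then show ?thesis using LC_0[OF assms(1)] by (simp add: elog_def zero_ereal_def)
  qed
  ultimately obtain r where "S = ereal r"
    by (cases S) auto
  then have "assoc_fun M t = r" by (simp add: assoc_fun_def S_def[symmetric])
  then show ?thesis using Sle[of c] \<open>S = ereal r\<close> by simp
qed

lemma assoc_fun_upper:
  assumes "LC M" "t \<ge> 0"
  shows "t ^ p \<le> M p * exp (assoc_fun M t)"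
  using assoc_fun_le_iff[OF assms, of "assoc_fun M t"] by simp

lemma assoc_fun_nonneg:
  assumes "LC M" "t \<ge> 0"
  shows "assoc_fun M t \<ge> 0"
  using assoc_fun_upper[OF assms, of 0] LC_0[OF assms(1)] by simp

lemma assoc_fun_mono:
  assumes "LC M" "0 \<le> s" "s \<le> t"
  shows "assoc_fun M s \<le> assoc_fun M t"
proof -
  have "s ^ p \<le> M p * exp (assoc_fun M t)" for p
    using power_mono[OF assms(3,2), of p] assoc_fun_upper[OF assms(1), of t p] assms by simp
  then show ?thesis using assms by (simp add: assoc_fun_le_iff)
qed

lemma assoc_fun_eq_0:
  assumes "LC M" "0 \<le> t" "t \<le> 1"
  shows "assoc_fun M t = 0"
proof -
  have "t ^ p \<le> M p" for p
    using power_le_one[of t p] assms LC_ge_1[OF assms(1), of p] by simp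
  then have "assoc_fun M t \<le> 0" using assms by (simp add: assoc_fun_le_iff)
  then show ?thesis using assoc_fun_nonneg[OF assms(1,2)] by simp
qed

text \<open>The sequence is recovered from its associated function: at the ratio \<open>M (n + 1) / M n\<close> the
  supremum that defines the associated function is attained by the term of index \<open>n\<close>.\<close>

lemma LC_attained:
  assumes "LC M"
  shows "\<exists>x\<ge>1. M n * exp (assoc_fun M x) \<le> x ^ n"
proof -
  define x where "x = M (Suc n) / M n"
  have pos: "\<And>k. M k > 0" using LC_pos[OF assms] .
  have x1: "x \<ge> 1" unfolding x_def by (rule LC_ratio_ge_1[OF assms])
  have "x ^ k \<le> M k * exp (ln (x ^ n / M n))" for k
    using LC_tangent[OF assms, of n k] x1 pos[of n] by (simp add: x_def[symmetric] field_simps)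
  then have "assoc_fun M x \<le> ln (x ^ n / M n)"
    using x1 by (simp add: assoc_fun_le_iff[OF assms])
  then have "exp (assoc_fun M x) \<le> x ^ n / M n"
    using x1 pos[of n] by (metis divide_pos_pos exp_le_cancel_iff exp_ln less_le_trans zero_less_one zero_less_power)
  then show ?thesis using x1 pos[of n] by (auto simp: field_simps)
qed

text \<open>The product of the terms of index \<open>p\<close> and \<open>q\<close> at \<open>t\<close> is at most the term of index \<open>p + q\<close> at
  \<open>C * t\<close>; the supremum is then taken over \<open>q\<close> first and over \<open>p\<close> afterwards.\<close>

lemma cond_i_imp_assoc_fun_doubling:
  assumes "LC M" "cond_i M"
  shows "\<exists>C\<ge>1. \<forall>t\<ge>0. 2 * assoc_fun M t \<le> assoc_fun M (C * t)"
proof -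
  have pos: "\<And>k. M k > 0" using LC_pos[OF assms(1)] .
  obtain C where C: "C \<ge> 1" "\<And>p q. M (p + q) \<le> C ^ (p + q) * M p * M q"
    using assms(2) unfolding cond_i_def by blast
  have "2 * assoc_fun M t \<le> assoc_fun M (C * t)" if t: "t \<ge> 0" for t
  proof -
    let ?E = "assoc_fun M (C * t)"
    have pq: "t ^ p * t ^ q \<le> M p * M q * exp ?E" for p q
    proof -
      have "C ^ (p + q) * (t ^ p * t ^ q) = (C * t) ^ (p + q)"
        by (simp add: power_mult_distrib power_add)
      also have "\<dots> \<le> M (p + q) * exp ?E"
        using t C by (intro assoc_fun_upper[OF assms(1)]) simp
      also have "\<dots> \<le> C ^ (p + q) * M p * M q * exp ?E"
        using C(2)[of p q] by simp
      finally have "C ^ (p + q) * (t ^ p * t ^ q) \<le> C ^ (p + q) * (M p * M q * exp ?E)"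
        by (simp add: mult_ac)
      then show ?thesis using C(1) by (simp add: mult_le_cancel_left)
    qed
    have a: "assoc_fun M t \<le> ?E - ln (t ^ p / M p)" if "t ^ p > 0" for p
      unfolding assoc_fun_le_iff[OF assms(1) t]
    proof
      fix q
      have "M q * exp (?E - ln (t ^ p / M p)) = (M p * M q * exp ?E) / t ^ p"
        using that pos[of p] by (simp add: exp_diff)
      then show "t ^ q \<le> M q * exp (?E - ln (t ^ p / M p))"
        using pq[of p q] pos_le_divide_eq[OF that] by (metis mult.commute)
    qed
    have "assoc_fun M t \<le> ?E - assoc_fun M t"
    proof -
      have "t ^ p \<le> M p * exp (?E - assoc_fun M t)" for p
      proof (cases "t ^ p > 0")
        case True
        then have "ln (t ^ p / M p) \<le> ?E - assoc_fun M t"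
          using a[OF True] by simp
        then have "t ^ p / M p \<le> exp (?E - assoc_fun M t)"
          using True pos[of p] by (metis divide_pos_pos exp_le_cancel_iff exp_ln)
        then show ?thesis using pos[of p] by (simp add: field_simps)
      next
        case False
        then have "t ^ p \<le> 0" by simp
        also have "0 \<le> M p * exp (?E - assoc_fun M t)"
          using pos[of p] by (simp add: less_imp_le)
        finally show ?thesis .
      qed
      then show ?thesis using t by (simp add: assoc_fun_le_iff[OF assms(1)])
    qed
    then show ?thesis by simp
  qed
  then show ?thesis using C(1) by blast
qed

text \<open>Conversely \<open>M (p + q)\<close> is the value of \<open>x ^ (p + q) * exp (- assoc_fun M x)\<close> at some \<open>x\<close>, and
  doubling splits this into a factor bounded by \<open>M p\<close> and a factor bounded by \<open>M q\<close>.\<close>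

lemma assoc_fun_doubling_imp_cond_i:
  assumes "LC M" "H > 0" "\<And>t. t \<ge> 0 \<Longrightarrow> 2 * assoc_fun M t \<le> assoc_fun M (H * t) + K"
  shows "cond_i M"
proof -
  have pos: "\<And>k. M k > 0" using LC_pos[OF assms(1)] .
  \<comment> \<open>The factor \<open>exp K\<close> is absorbed by the power, except for \<open>p + q = 0\<close>, where both sides are \<open>1\<close>.\<close>
  define C where "C = (1 + H) * exp \<bar>K\<bar>"
  have "1 * 1 \<le> (1 + H) * exp \<bar>K\<bar>"
    using assms(2) by (intro mult_mono) auto
  then have C1: "C \<ge> 1" by (simp add: C_def)
  have "M (p + q) \<le> C ^ (p + q) * M p * M q" for p q
  proof (cases "p + q = 0")
    case True
    then show ?thesis using LC_0[OF assms(1)] by simp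
  next
    case False
    obtain x where x: "x \<ge> 1" "M (p + q) * exp (assoc_fun M x) \<le> x ^ (p + q)"
      using LC_attained[OF assms(1)] by blast
    define y where "y = x / H"
    have y: "y \<ge> 0" "x = H * y" using x(1) assms(2) by (auto simp: y_def)
    let ?w = "exp (assoc_fun M y)"
    have w: "?w * ?w \<le> exp (assoc_fun M x) * exp K"
      using assms(3)[OF y(1)] y(2) by (simp add: exp_add[symmetric])
    have "M (p + q) * (?w * ?w) \<le> M (p + q) * (exp (assoc_fun M x) * exp K)"
      using w pos[of "p + q"] by simp
    also have "\<dots> \<le> x ^ (p + q) * exp K"
      using x(2) by (simp add: mult.assoc[symmetric])
    also have "\<dots> = H ^ (p + q) * exp K * (y ^ p * y ^ q)"
      by (simp add: y(2) power_mult_distrib power_add)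
    also have "\<dots> \<le> H ^ (p + q) * exp K * ((M p * ?w) * (M q * ?w))"
      using assoc_fun_upper[OF assms(1) y(1)] y(1) pos assms(2)
      by (intro mult_left_mono mult_mono) (auto simp: less_imp_le)
    finally have "M (p + q) * (?w * ?w) \<le> (H ^ (p + q) * exp K * M p * M q) * (?w * ?w)"
      by (simp add: mult_ac)
    then have "M (p + q) \<le> H ^ (p + q) * exp K * M p * M q"
      by (simp add: mult_le_cancel_right)
    also have "H ^ (p + q) * exp K \<le> C ^ (p + q)"
    proof -
      have "exp K \<le> exp \<bar>K\<bar> ^ 1" by simp
      also have "\<dots> \<le> exp \<bar>K\<bar> ^ (p + q)"
        using False by (intro power_increasing) auto
      finally show ?thesis
        unfolding C_def power_mult_distrib using assms(2)
        by (intro mult_mono power_mono) auto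
    qed
    then have "H ^ (p + q) * exp K * M p * M q \<le> C ^ (p + q) * M p * M q"
      using pos by (intro mult_right_mono) (auto simp: less_imp_le)
    finally show ?thesis .
  qed
  then show ?thesis using C1 unfolding cond_i_def by blast
qed

lemma assoc_fun_exp_le_iff:
  assumes "LC M"
  shows "assoc_fun M (exp t) \<le> c \<longleftrightarrow> (\<forall>p. real p * t \<le> ln (M p) + c)"
proof -
  have "exp t ^ p \<le> M p * exp c \<longleftrightarrow> real p * t \<le> ln (M p) + c" for p
  proof -
    have "exp t ^ p = exp (real p * t)" by (simp add: exp_of_nat_mult)
    moreover have "M p * exp c = exp (ln (M p) + c)"
      using LC_pos[OF assms, of p] by (simp add: exp_add)
    ultimately show ?thesis by simp
  qed
  then show ?thesis using assoc_fun_le_iff[OF assms, of "exp t" c] by simp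
qed

text \<open>A supremum of the affine functions \<open>t \<mapsto> p * t - ln (M p)\<close> is convex.\<close>

lemma assoc_fun_exp_convex:
  assumes "LC M"
  shows "convex_on UNIV (\<lambda>t. assoc_fun M (exp t))"
proof (rule convex_onI)
  fix u x y :: real
  assume u: "0 < u" "u < 1"
  have up: "real p * t \<le> ln (M p) + assoc_fun M (exp t)" for p t
    using assoc_fun_exp_le_iff[OF assms, of t "assoc_fun M (exp t)"] by simp
  have "real p * ((1 - u) * x + u * y) \<le>
      ln (M p) + ((1 - u) * assoc_fun M (exp x) + u * assoc_fun M (exp y))" for p
  proof -
    have "(1 - u) * (real p * x) + u * (real p * y) \<le>
      (1 - u) * (ln (M p) + assoc_fun M (exp x)) + u * (ln (M p) + assoc_fun M (exp y))"
      using u by (intro add_mono mult_left_mono up) auto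
    then show ?thesis by (simp add: algebra_simps)
  qed
  then show "assoc_fun M (exp ((1 - u) *\<^sub>R x + u *\<^sub>R y)) \<le>
      (1 - u) * assoc_fun M (exp x) + u * assoc_fun M (exp y)"
    by (simp add: assoc_fun_exp_le_iff[OF assms])
qed simp

text \<open>Convexity gives continuity on the positive half-line, where \<open>exp\<close> is a change of variables; near
  \<open>0\<close> the function vanishes, because all \<open>M p\<close> are at least \<open>1\<close>.\<close>

lemma assoc_fun_continuous:
  assumes "LC M"
  shows "continuous_on {0..} (assoc_fun M)"
proof -
  have "continuous_on UNIV (\<lambda>t. assoc_fun M (exp t))"
    by (rule convex_on_continuous) (auto intro: assoc_fun_exp_convex[OF assms])
  then have "continuous_on {1..} (\<lambda>x. assoc_fun M (exp (ln x)))"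
    by (rule continuous_on_compose2) (auto intro!: continuous_intros)
  then have 1: "continuous_on {1..} (assoc_fun M)"
    by (rule continuous_on_eq) auto
  have 0: "continuous_on {0..1} (assoc_fun M)"
    by (rule continuous_on_eq[where f = "\<lambda>_. 0"]) (auto simp: assoc_fun_eq_0[OF assms])
  have "continuous_on ({0..1} \<union> {1..}) (assoc_fun M)"
    by (rule continuous_on_closed_Un) (use 0 1 in auto)
  moreover have "{0..1} \<union> {1..} = {0::real..}" by auto
  ultimately show ?thesis by simp
qed

text \<open>The function \<open>u ^ k * exp (- u\<^sup>2 / 2)\<close> is largest at \<open>u = sqrt k\<close>; the elementary inequality
  \<open>x \<le> exp x\<close> gives this up to a harmless factor.\<close>

lemma power_le_sqrt_power_exp:
  fixes u :: real
  assumes "u \<ge> 0"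
  shows "u ^ k \<le> sqrt (real k) ^ k * exp (u\<^sup>2 / 2)"
proof (cases "k = 0")
  case False
  have "u\<^sup>2 / real k \<le> exp (u\<^sup>2 / real k)"
    using exp_ge_add_one_self[of "u\<^sup>2 / real k"] by linarith
  then have "(u\<^sup>2 / real k) ^ k \<le> exp (u\<^sup>2 / real k) ^ k"
    by (intro power_mono) auto
  also have "\<dots> = exp (u\<^sup>2)"
    using False by (simp add: exp_of_nat_mult[symmetric])
  finally have "(u\<^sup>2) ^ k \<le> real k ^ k * exp (u\<^sup>2)"
    using False by (simp add: power_divide field_simps)
  moreover have "(u ^ k)\<^sup>2 = (u\<^sup>2) ^ k"
    by (simp add: power_mult[symmetric] mult.commute)
  moreover have "(sqrt (real k) ^ k * exp (u\<^sup>2 / 2))\<^sup>2 = real k ^ k * exp (u\<^sup>2)"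
    by (simp add: power_mult_distrib power_even_eq[symmetric] power_mult[symmetric] mult.commute[of k 2]
        power_mult exp_double[symmetric])
  ultimately have "(u ^ k)\<^sup>2 \<le> (sqrt (real k) ^ k * exp (u\<^sup>2 / 2))\<^sup>2"
    by simp
  then show ?thesis by (rule power2_le_imp_le) simp
qed simp

text \<open>Under condition (a) with \<open>q = 0\<close> the sequence grows at least like that of a Gaussian weight.\<close>

lemma assoc_fun_le_square:
  assumes "LC M" "B > 0" "C > 0" "\<And>p. sqrt (real p) ^ p \<le> B * C ^ p * M p" "t \<ge> 0"
  shows "assoc_fun M t \<le> ln B + (C * t)\<^sup>2 / 2"
  unfolding assoc_fun_le_iff[OF assms(1,5)]
proof
  fix p
  have "C ^ p * t ^ p \<le> sqrt (real p) ^ p * exp ((C * t)\<^sup>2 / 2)"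
    using power_le_sqrt_power_exp[of "C * t" p] assms(3,5) by (simp add: power_mult_distrib)
  also have "\<dots> \<le> B * C ^ p * M p * exp ((C * t)\<^sup>2 / 2)"
    using assms(4)[of p] by simp
  also have "\<dots> = C ^ p * (M p * exp (ln B + (C * t)\<^sup>2 / 2))"
    using assms(2) by (simp add: exp_add)
  finally show "t ^ p \<le> M p * exp (ln B + (C * t)\<^sup>2 / 2)"
    using assms(3) by (simp add: mult_le_cancel_left)
qed

text \<open>The term of index \<open>p\<close> alone gives \<open>p * ln t - ln (M p)\<close>, and \<open>p\<close> is arbitrary.\<close>

lemma ln_smallo_assoc_fun:
  assumes "LC M"
  shows "ln \<in> o[at_top](assoc_fun M)"
proof (rule landau_o.smallI)
  fix c :: real
  assume c: "c > 0"
  obtain p :: nat where p: "real p > 2 / c" using reals_Archimedean2 by blast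
  have "eventually (\<lambda>t::real. t \<ge> max 1 (exp (c * ln (M p)))) at_top"
    by (rule eventually_ge_at_top)
  then show "eventually (\<lambda>t. norm (ln t) \<le> c * norm (assoc_fun M t)) at_top"
  proof eventually_elim
    case (elim t)
    then have t: "t \<ge> 1" "ln t \<ge> c * ln (M p)"
      by (auto simp: ln_ge_iff)
    have "real p * ln t \<le> ln (M p) + assoc_fun M t"
      using assoc_fun_exp_le_iff[OF assms, of "ln t" "assoc_fun M t"] t by simp
    then have "c * (real p * ln t) \<le> c * ln (M p) + c * assoc_fun M t"
      using c by (metis distrib_left less_imp_le mult_left_mono)
    moreover have "c * (real p * ln t) \<ge> 2 * ln t"
    proof -
      have "2 * ln t \<le> (c * real p) * ln t"
        using p c t by (intro mult_right_mono) (auto simp: field_simps)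
      then show ?thesis by (simp add: mult.assoc)
    qed
    ultimately have "ln t \<le> c * assoc_fun M t" using t(2) by linarith
    then show ?case using t assoc_fun_nonneg[OF assms, of t] by simp
  qed
qed

lemma cond_a_beurling_imp_roumieu: "cond_a_beurling M \<Longrightarrow> cond_a_roumieu M"
  unfolding cond_a_beurling_def cond_a_roumieu_def by (meson zero_less_one)

lemma weight_function_assoc_fun:
  assumes "LC M" "cond_a_roumieu M"
    and c: "\<exists>L\<ge>1. \<forall>t\<ge>0. assoc_fun M (2 * t) \<le> L * (assoc_fun M t + 1)"
  shows "weight_function (assoc_fun M)"
proof -
  obtain B C H where BCH: "B > 0" "C > 0" "H > 0"
    and a: "\<And>p q. sqrt (real p) ^ p * M q \<le> B * C ^ p * H ^ (p + q) * M (p + q)"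
    using assms(2) unfolding cond_a_roumieu_def by blast
  have sq: "assoc_fun M t \<le> ln B + (C * H * t)\<^sup>2 / 2" if "t \<ge> 0" for t
    by (rule assoc_fun_le_square[OF assms(1)])
      (use BCH that a[of _ 0] LC_0[OF assms(1)] in \<open>auto simp: power_mult_distrib mult_ac\<close>)
  have "assoc_fun M \<in> O[at_top](\<lambda>t. t\<^sup>2)"
  proof (rule landau_o.bigI[where c = "\<bar>ln B\<bar> + 1 + (C * H)\<^sup>2 / 2"])
    have "eventually (\<lambda>t::real. t \<ge> 1) at_top" by (rule eventually_ge_at_top)
    then show "eventually (\<lambda>t. norm (assoc_fun M t) \<le> (\<bar>ln B\<bar> + 1 + (C * H)\<^sup>2 / 2) * norm (t\<^sup>2)) at_top"
    proof eventually_elim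
      case (elim t)
      have "\<bar>ln B\<bar> + 1 \<le> (\<bar>ln B\<bar> + 1) * t\<^sup>2"
        using elim mult_left_mono[of 1 "t\<^sup>2" "\<bar>ln B\<bar> + 1"] by simp
      then show ?case
        using sq[of t] elim assoc_fun_nonneg[OF assms(1), of t]
        by (simp add: algebra_simps power_mult_distrib)
    qed
  qed (simp add: add_pos_nonneg)
  moreover have "convex_on {0..} (\<lambda>t. assoc_fun M (exp t))"
    using assoc_fun_exp_convex[OF assms(1)] by (rule convex_on_subset) auto
  ultimately show ?thesis
    unfolding weight_function_def
    using assoc_fun_continuous[OF assms(1)] assoc_fun_nonneg[OF assms(1)] c
      ln_smallo_assoc_fun[OF assms(1)] assoc_fun_mono[OF assms(1)]
    by (auto simp: mono_on_def)
qed

lemma assoc_fun_smallo_square: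
  assumes "LC M" "cond_a_beurling M"
  shows "assoc_fun M \<in> o[at_top](\<lambda>t. t\<^sup>2)"
proof (rule landau_o.smallI)
  fix c :: real
  assume c: "c > 0"
  obtain H where H: "H > 0"
    and a: "\<And>C. C > 0 \<Longrightarrow> \<exists>B>0. \<forall>p q. sqrt (real p) ^ p * M q \<le> B * C ^ p * H ^ (p + q) * M (p + q)"
    using assms(2) unfolding cond_a_beurling_def by blast
  define C where "C = sqrt c / H"
  have C: "C > 0" "(C * H)\<^sup>2 = c" using c H by (auto simp: C_def)
  obtain B where B: "B > 0"
    and aB: "\<And>p q. sqrt (real p) ^ p * M q \<le> B * C ^ p * H ^ (p + q) * M (p + q)"
    using a[OF C(1)] by blast
  have sq: "assoc_fun M t \<le> ln B + (C * H * t)\<^sup>2 / 2" if "t \<ge> 0" for t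
    by (rule assoc_fun_le_square[OF assms(1)])
      (use B C H that aB[of _ 0] LC_0[OF assms(1)] in \<open>auto simp: power_mult_distrib mult_ac\<close>)
  have "eventually (\<lambda>t::real. t \<ge> max 1 (2 * \<bar>ln B\<bar> / c)) at_top" by (rule eventually_ge_at_top)
  then show "eventually (\<lambda>t. norm (assoc_fun M t) \<le> c * norm (t\<^sup>2)) at_top"
  proof eventually_elim
    case (elim t)
    then have t: "t \<ge> 1" "\<bar>ln B\<bar> \<le> c * t / 2" using c by (auto simp: field_simps)
    have "t \<le> t\<^sup>2" using t(1) by (simp add: power2_eq_square)
    then have "c * t \<le> c * t\<^sup>2" using c by simp
    moreover have "assoc_fun M t \<le> ln B + c * t\<^sup>2 / 2"
      using sq[of t] t(1) C(2) by (simp add: power_mult_distrib)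
    ultimately show ?case using t assoc_fun_nonneg[OF assms(1), of t] by simp
  qed
qed


section \<open>Young conjugates of weight functions\<close>

lemma weight_function_nonneg: "weight_function \<omega> \<Longrightarrow> t \<ge> 0 \<Longrightarrow> \<omega> t \<ge> 0"
  by (simp add: weight_function_def)

lemma weight_function_mono: "weight_function \<omega> \<Longrightarrow> 0 \<le> s \<Longrightarrow> s \<le> t \<Longrightarrow> \<omega> s \<le> \<omega> t"
  by (auto simp: weight_function_def mono_on_def)

lemma ln_le_weight_function:
  assumes "weight_function \<omega>" "c > 0"
  shows "\<exists>K\<ge>0. \<forall>x\<ge>1. ln x \<le> c * \<omega> x + K"
proof -
  have "ln \<in> o[at_top](\<omega>)" using assms(1) by (simp add: weight_function_def)
  then have "eventually (\<lambda>x. norm (ln x) \<le> c * norm (\<omega> x)) at_top"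
    using assms(2) by (rule landau_o.smallD)
  then obtain X where X: "\<And>x. x \<ge> X \<Longrightarrow> norm (ln x) \<le> c * norm (\<omega> x)"
    by (auto simp: eventually_at_top_linorder)
  have "ln x \<le> c * \<omega> x + ln (max X 1)" if x: "x \<ge> 1" for x
  proof (cases "x \<ge> X")
    case True
    then show ?thesis
      using X[of x] x weight_function_nonneg[OF assms(1), of x] by (simp add: add_increasing2)
  next
    case False
    then have "ln x \<le> ln (max X 1)" using x by simp
    then show ?thesis
      using x weight_function_nonneg[OF assms(1), of x] assms(2) by (simp add: add_increasing)
  qed
  then show ?thesis by (intro exI[of _ "ln (max X 1)"]) auto
qed

lemma young_conj_bdd:
  assumes "weight_function \<omega>"
  shows "bdd_above ((\<lambda>t. t * s - \<omega> (exp t)) ` {0..})"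
proof -
  obtain K where K: "K \<ge> 0" "\<And>x. x \<ge> 1 \<Longrightarrow> ln x \<le> (1 / (\<bar>s\<bar> + 1)) * \<omega> x + K"
    using ln_le_weight_function[OF assms, of "1 / (\<bar>s\<bar> + 1)"] zero_less_divide_1_iff
    by (metis abs_add_one_gt_zero add.commute)
  have "t * s - \<omega> (exp t) \<le> K * (\<bar>s\<bar> + 1)" if "t \<ge> 0" for t
  proof -
    have "(\<bar>s\<bar> + 1) * t \<le> (\<bar>s\<bar> + 1) * ((1 / (\<bar>s\<bar> + 1)) * \<omega> (exp t) + K)"
      using K(2)[of "exp t"] that by (intro mult_left_mono) auto
    also have "\<dots> = \<omega> (exp t) + K * (\<bar>s\<bar> + 1)"
      by (simp add: field_simps add_pos_nonneg)
    finally have "(\<bar>s\<bar> + 1) * t \<le> \<omega> (exp t) + K * (\<bar>s\<bar> + 1)" .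
    moreover have "s * t \<le> (\<bar>s\<bar> + 1) * t"
      using that by (intro mult_right_mono) auto
    ultimately show ?thesis by (simp add: mult.commute)
  qed
  then show ?thesis by (intro bdd_aboveI2) auto
qed

definition conj_weight :: "(real \<Rightarrow> real) \<Rightarrow> real \<Rightarrow> nat \<Rightarrow> real" where
  "conj_weight \<omega> l n = exp (1 / l * young_conj \<omega> (l * real n))"

lemma W_eq_conj_weight: "W \<omega> d l \<alpha> = conj_weight \<omega> l (mi_order d \<alpha>)"
  by (simp add: W_def conj_weight_def)

lemma conj_weight_pos [simp]: "conj_weight \<omega> l n > 0"
  by (simp add: conj_weight_def)

text \<open>With \<open>x = exp t\<close> the supremum in the Young conjugate makes \<open>conj_weight \<omega> l n\<close> the supremum of
  \<open>x ^ n * exp (- \<omega> x / l)\<close> over \<open>x \<ge> 1\<close>.  In this form it is parallel to a log-convex sequence,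
  which is the supremum of \<open>x ^ n * exp (- assoc_fun M x)\<close>.\<close>

lemma conj_weight_upper:
  assumes "weight_function \<omega>" "l > 0" "x \<ge> 1"
  shows "x ^ n \<le> conj_weight \<omega> l n * exp (\<omega> x / l)"
proof -
  have "ln x * (l * real n) - \<omega> (exp (ln x)) \<le> young_conj \<omega> (l * real n)"
    unfolding young_conj_def
    by (rule cSUP_upper[OF _ young_conj_bdd[OF assms(1)]]) (use assms(3) in auto)
  then have "(ln x * (l * real n) - \<omega> x) / l \<le> young_conj \<omega> (l * real n) / l"
    using assms by (intro divide_right_mono) auto
  then have "real n * ln x \<le> 1 / l * young_conj \<omega> (l * real n) + \<omega> x / l"
    using assms(2) by (simp add: diff_divide_distrib mult_ac)
  then have "exp (real n * ln x) \<le> conj_weight \<omega> l n * exp (\<omega> x / l)"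
    by (simp add: conj_weight_def exp_add[symmetric])
  moreover have "exp (real n * ln x) = x ^ n"
    using assms(3) by (simp add: exp_of_nat_mult)
  ultimately show ?thesis by simp
qed

lemma conj_weight_least:
  assumes "l > 0" "C > 0" "\<And>x. x \<ge> 1 \<Longrightarrow> x ^ n \<le> C * exp (\<omega> x / l)"
  shows "conj_weight \<omega> l n \<le> C"
proof -
  have "young_conj \<omega> (l * real n) \<le> l * ln C"
    unfolding young_conj_def
  proof (rule cSUP_least)
    fix t :: real
    assume "t \<in> {0..}"
    then have "exp t ^ n \<le> C * exp (\<omega> (exp t) / l)"
      using assms(3)[of "exp t"] by simp
    moreover have "C * exp (\<omega> (exp t) / l) = exp (ln C + \<omega> (exp t) / l)"
      using assms(2) by (simp add: exp_add)
    ultimately have "real n * t \<le> ln C + \<omega> (exp t) / l"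
      by (simp add: exp_of_nat_mult[symmetric])
    then have "l * (real n * t) \<le> l * (ln C + \<omega> (exp t) / l)"
      using assms(1) by simp
    also have "\<dots> = l * ln C + \<omega> (exp t)"
      using assms(1) by (simp add: field_simps)
    finally show "t * (l * real n) - \<omega> (exp t) \<le> l * ln C"
      by (simp add: mult_ac)
  qed simp
  then have "1 / l * young_conj \<omega> (l * real n) \<le> ln C"
    using assms(1) by (simp add: field_simps)
  then show ?thesis
    unfolding conj_weight_def using assms(2) by (metis exp_le_cancel_iff exp_ln)
qed

lemma conj_weight_mono:
  assumes "weight_function \<omega>" "0 < l" "l \<le> l'"
  shows "conj_weight \<omega> l n \<le> conj_weight \<omega> l' n"
proof (rule conj_weight_least)
  fix x :: real
  assume x: "x \<ge> 1"
  have "x ^ n \<le> conj_weight \<omega> l' n * exp (\<omega> x / l')"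
    using assms x by (intro conj_weight_upper) auto
  also have "\<dots> \<le> conj_weight \<omega> l' n * exp (\<omega> x / l)"
    using assms x weight_function_nonneg[OF assms(1), of x]
    by (simp add: frac_le less_imp_le)
  finally show "x ^ n \<le> conj_weight \<omega> l' n * exp (\<omega> x / l)" .
qed (use assms in auto)

text \<open>This is superadditivity of the Young conjugate.  In multiplicative form one takes the power
  \<open>a / (a + b)\<close> of the estimate for \<open>x ^ (a + b)\<close>.\<close>

lemma conj_weight_mult_le:
  assumes "weight_function \<omega>" "l > 0"
  shows "conj_weight \<omega> l a * conj_weight \<omega> l b \<le> conj_weight \<omega> l (a + b)"
proof (cases "a + b = 0")
  case True
  have "conj_weight \<omega> l 0 \<le> 1"
    using assms by (intro conj_weight_least) (auto simp: weight_function_nonneg)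
  then show ?thesis
    using True conj_weight_pos[of \<omega> l 0] by (simp add: mult_left_le_one_le)
next
  case False
  let ?W = "conj_weight \<omega> l (a + b)"
  have key: "conj_weight \<omega> l k \<le> ?W powr (real k / real (a + b))" if "k \<le> a + b" for k
  proof (rule conj_weight_least)
    fix x :: real
    assume x: "x \<ge> 1"
    let ?t = "real k / real (a + b)"
    have t: "0 \<le> ?t" "?t \<le> 1" using that False by auto
    have "x ^ k = (x ^ (a + b)) powr ?t"
      using x False by (simp add: powr_realpow[symmetric] powr_powr add_eq_0_iff_both_eq_0 del: of_nat_add)
    also have "\<dots> \<le> (?W * exp (\<omega> x / l)) powr ?t"
      using x t conj_weight_upper[OF assms x] by (intro powr_mono2) auto
    also have "\<dots> = ?W powr ?t * exp (?t * (\<omega> x / l))"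
      by (simp add: powr_mult less_imp_le exp_powr_real mult.commute)
    also have "\<dots> \<le> ?W powr ?t * exp (\<omega> x / l)"
      using t weight_function_nonneg[OF assms(1), of x] x assms(2)
        mult_right_mono[OF t(2), of "\<omega> x / l"]
      by (intro mult_left_mono) auto
    finally show "x ^ k \<le> ?W powr ?t * exp (\<omega> x / l)" .
  qed (use assms conj_weight_pos[of \<omega> l "a + b"] in \<open>auto simp: less_le\<close>)
  have "conj_weight \<omega> l a * conj_weight \<omega> l b \<le>
      ?W powr (real a / real (a + b)) * ?W powr (real b / real (a + b))"
    by (intro mult_mono key) (auto simp: less_imp_le)
  also have "\<dots> = ?W"
  proof -
    have "real a / real (a + b) + real b / real (a + b) = 1"
      using False by (simp add: add_divide_distrib[symmetric] flip: of_nat_add)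
    then show ?thesis by (simp add: powr_add[symmetric] less_imp_le)
  qed
  finally show ?thesis .
qed

text \<open>Half of \<open>\<omega> x / l\<close> goes to each of the two factors \<open>x ^ a\<close> and \<open>x ^ b\<close>.\<close>

lemma conj_weight_split:
  assumes "weight_function \<omega>" "l > 0"
  shows "conj_weight \<omega> l (a + b) \<le> conj_weight \<omega> (2 * l) a * conj_weight \<omega> (2 * l) b"
proof (rule conj_weight_least)
  fix x :: real
  assume x: "x \<ge> 1"
  have "x ^ (a + b) \<le> (conj_weight \<omega> (2 * l) a * exp (\<omega> x / (2 * l))) *
      (conj_weight \<omega> (2 * l) b * exp (\<omega> x / (2 * l)))"
    unfolding power_add
    using assms x by (intro mult_mono conj_weight_upper) (auto simp: less_imp_le)
  also have "\<dots> = (conj_weight \<omega> (2 * l) a * conj_weight \<omega> (2 * l) b) *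
      (exp (\<omega> x / (2 * l)) * exp (\<omega> x / (2 * l)))"
    by (simp only: mult_ac)
  also have "exp (\<omega> x / (2 * l)) * exp (\<omega> x / (2 * l)) = exp (\<omega> x / l)"
    by (simp add: exp_add[symmetric])
  finally show "x ^ (a + b) \<le> conj_weight \<omega> (2 * l) a * conj_weight \<omega> (2 * l) b * exp (\<omega> x / l)" .
qed (use assms in auto)

text \<open>Biconjugation recovers \<open>\<omega>\<close> from its conjugate: a supporting line of slope \<open>m\<close> to \<open>\<omega> \<circ> exp\<close>
  at \<open>ln x\<close> shows that the conjugate at \<open>m\<close> is attained there.  Rounding \<open>m / l\<close> down to an integer
  costs one factor \<open>x\<close>.\<close>

lemma conj_weight_touch:
  assumes "weight_function \<omega>" "l > 0" "x \<ge> 1"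
  shows "\<exists>a. conj_weight \<omega> l a * exp (\<omega> x / l) \<le> x ^ Suc a"
proof -
  let ?phi = "\<lambda>t. \<omega> (exp t)"
  define t where "t = ln x"
  have t: "t \<ge> 0" "exp t = x" using assms(3) by (auto simp: t_def)
  have mono: "?phi s \<le> ?phi s'" if "0 \<le> s" "s \<le> s'" for s s'
    using weight_function_mono[OF assms(1), of "exp s" "exp s'"] that by simp
  have "\<exists>m\<ge>0. \<forall>s\<ge>0. ?phi s \<ge> ?phi t + m * (s - t)"
  proof (cases "t = 0")
    case True
    then show ?thesis using mono[of 0] by (intro exI[of _ 0]) auto
  next
    case False
    define m where "m = Inf ((\<lambda>s. (?phi t - ?phi s) / (t - s)) ` ({t<..} \<inter> {0..}))"
    have "convex_on {0..} ?phi" using assms(1) by (simp add: weight_function_def)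
    then have sub: "?phi s \<ge> ?phi t + m * (s - t)" if "s \<ge> 0" for s
      unfolding m_def
      by (rule convex_le_Inf_differential) (use False t that in \<open>auto simp: interior_real_atLeast\<close>)
    have "m \<ge> 0"
      unfolding m_def
    proof (rule cINF_greatest)
      show "{t<..} \<inter> {0..} \<noteq> {}" using t(1)
        by (metis IntI atLeast_iff empty_iff greaterThan_iff gt_ex less_imp_le order_trans)
      fix s assume s: "s \<in> {t<..} \<inter> {0..}"
      then show "0 \<le> (?phi t - ?phi s) / (t - s)"
        using mono[of t s] t(1) by (intro divide_nonpos_neg) auto
    qed
    then show ?thesis using sub by blast
  qed
  then obtain m where m: "m \<ge> 0" "\<And>s. s \<ge> 0 \<Longrightarrow> ?phi s \<ge> ?phi t + m * (s - t)"
    by blast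
  define a where "a = nat \<lfloor>m / l\<rfloor>"
  have a: "real a \<le> m / l" "m / l \<le> real a + 1"
    using m(1) assms(2) by (auto simp: a_def)
  have "conj_weight \<omega> l a \<le> x ^ Suc a * exp (- \<omega> x / l)"
  proof (rule conj_weight_least)
    fix y :: real
    assume y: "y \<ge> 1"
    define s where "s = ln y"
    have s: "s \<ge> 0" "exp s = y" using y by (auto simp: s_def)
    have "(\<omega> x + m * (s - t)) / l \<le> \<omega> y / l"
      using m(2)[OF s(1)] s(2) t(2) assms(2) by (intro divide_right_mono) auto
    then have 1: "(m / l) * s - (m / l) * t \<le> \<omega> y / l - \<omega> x / l"
      using assms(2) by (simp add: field_simps)
    have 2: "real a * s \<le> (m / l) * s" "(m / l) * t \<le> (real a + 1) * t"
      using mult_right_mono[OF a(1) s(1)] mult_right_mono[OF a(2) t(1)] by simp_all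
    have "real a * s \<le> real (Suc a) * t + (- \<omega> x / l) + \<omega> y / l"
      using 1 2 by (simp add: algebra_simps)
    then have "exp (real a * s) \<le> exp (real (Suc a) * t + (- \<omega> x / l) + \<omega> y / l)"
      by simp
    also have "\<dots> = x ^ Suc a * exp (- \<omega> x / l) * exp (\<omega> y / l)"
      using t(2) by (simp only: exp_add exp_of_nat_mult)
    finally show "y ^ a \<le> x ^ Suc a * exp (- \<omega> x / l) * exp (\<omega> y / l)"
      using s(2) by (simp only: exp_of_nat_mult)
  qed (use assms in auto)
  then have "conj_weight \<omega> l a * exp (\<omega> x / l) \<le> x ^ Suc a * exp (- \<omega> x / l) * exp (\<omega> x / l)"
    by (intro mult_right_mono) auto
  then have "conj_weight \<omega> l a * exp (\<omega> x / l) \<le> x ^ Suc a"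
    by (simp add: mult.assoc exp_add[symmetric])
  then show ?thesis by blast
qed

text \<open>The point \<open>x = 2 * e * sqrt b\<close> makes \<open>x ^ b * exp (- \<omega> x / l)\<close> at least \<open>2 ^ b * sqrt b ^ b\<close>
  up to a constant: the quadratic bound on \<open>\<omega>\<close> loses only \<open>exp b\<close>, which the factor \<open>e\<close> pays for.\<close>

lemma sqrt_power_le_conj_weight:
  assumes "weight_function \<omega>" "l > 0"
    and sq: "\<And>x. x \<ge> 1 \<Longrightarrow> \<omega> x \<le> \<epsilon> * x\<^sup>2 + K" and l: "4 * (exp 1)\<^sup>2 * \<epsilon> \<le> l"
  shows "\<exists>A\<ge>1. \<forall>b. 2 ^ b * sqrt (real b) ^ b \<le> A * conj_weight \<omega> l b"
proof -
  define A where "A = exp (\<omega> 1 / l) + exp (K / l)"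
  have "\<omega> 1 / l \<ge> 0" using weight_function_nonneg[OF assms(1), of 1] assms(2) by simp
  then have A1: "A \<ge> 1"
    unfolding A_def using one_le_exp_iff[of "\<omega> 1 / l"] exp_ge_zero[of "K / l"] by linarith
  have "2 ^ b * sqrt (real b) ^ b \<le> A * conj_weight \<omega> l b" for b
  proof (cases "b = 0")
    case True
    have "1 \<le> conj_weight \<omega> l 0 * exp (\<omega> 1 / l)"
      using conj_weight_upper[OF assms(1,2), of 1 0] by simp
    also have "\<dots> \<le> conj_weight \<omega> l 0 * A"
      by (intro mult_left_mono) (auto simp: A_def less_imp_le)
    finally show ?thesis using True by (simp add: mult.commute)
  next
    case False
    define x where "x = 2 * exp 1 * sqrt (real b)"
    have e1: "exp (1::real) \<ge> 1" by simp
    have "1 * 1 \<le> (2 * exp 1) * sqrt (real b)"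
      using False e1 by (intro mult_mono) (auto simp del: one_le_exp_iff)
    then have x1: "x \<ge> 1" by (simp add: x_def)
    have "\<omega> x / l \<le> (\<epsilon> * x\<^sup>2 + K) / l"
      using sq[OF x1] assms(2) by (intro divide_right_mono) auto
    also have "\<epsilon> * x\<^sup>2 = (4 * (exp 1)\<^sup>2 * \<epsilon>) * real b"
      by (simp add: x_def power_mult_distrib)
    also have "((4 * (exp 1)\<^sup>2 * \<epsilon>) * real b + K) / l \<le> (l * real b + K) / l"
      using l assms(2) by (intro divide_right_mono add_right_mono mult_right_mono) auto
    also have "\<dots> = real b + K / l"
      using assms(2) by (simp add: add_divide_distrib)
    finally have wx: "exp (\<omega> x / l) \<le> exp 1 ^ b * exp (K / l)"
      by (simp add: exp_add[symmetric] exp_of_nat_mult[symmetric])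
    have "exp 1 ^ b * (2 ^ b * sqrt (real b) ^ b) = x ^ b"
      by (simp add: x_def power_mult_distrib)
    also have "\<dots> \<le> conj_weight \<omega> l b * exp (\<omega> x / l)"
      by (rule conj_weight_upper[OF assms(1,2) x1])
    also have "\<dots> \<le> conj_weight \<omega> l b * (exp 1 ^ b * exp (K / l))"
      using wx by simp
    also have "\<dots> = exp 1 ^ b * (exp (K / l) * conj_weight \<omega> l b)"
      by simp
    finally have "2 ^ b * sqrt (real b) ^ b \<le> exp (K / l) * conj_weight \<omega> l b"
      by (simp only: mult_le_cancel_left) simp
    also have "\<dots> \<le> A * conj_weight \<omega> l b"
      by (intro mult_right_mono) (auto simp: A_def less_imp_le)
    finally show ?thesis .
  qed
  then show ?thesis using A1 by blast
qed

lemma eventually_le_square_imp: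
  assumes "weight_function \<omega>" "\<epsilon> > 0" "eventually (\<lambda>x. norm (\<omega> x) \<le> \<epsilon> * norm (x\<^sup>2)) at_top"
  shows "\<exists>K. \<forall>x\<ge>1. \<omega> x \<le> \<epsilon> * x\<^sup>2 + K"
proof -
  obtain X where X: "\<And>x. x \<ge> X \<Longrightarrow> norm (\<omega> x) \<le> \<epsilon> * norm (x\<^sup>2)"
    using assms(3) by (auto simp: eventually_at_top_linorder)
  have "\<omega> x \<le> \<epsilon> * x\<^sup>2 + \<omega> (max X 1)" if "x \<ge> 1" for x
  proof (cases "x \<ge> X")
    case True
    have "0 \<le> \<omega> (max X 1)" by (rule weight_function_nonneg[OF assms(1)]) simp
    then show ?thesis using X[OF True] by simp
  next
    case False
    then show ?thesis
      using weight_function_mono[OF assms(1), of x "max X 1"] that assms(2) by (simp add: add_increasing)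
  qed
  then show ?thesis by blast
qed

lemma weight_function_le_square:
  assumes "weight_function \<omega>"
  shows "\<exists>\<epsilon>>0. \<exists>K. \<forall>x\<ge>1. \<omega> x \<le> \<epsilon> * x\<^sup>2 + K"
proof -
  have "\<omega> \<in> O[at_top](\<lambda>t. t\<^sup>2)" using assms by (simp add: weight_function_def)
  then show ?thesis by (rule landau_o.bigE) (blast intro: eventually_le_square_imp[OF assms])
qed

lemma smallo_square_le:
  assumes "weight_function \<omega>" "\<omega> \<in> o[at_top](\<lambda>t. t\<^sup>2)" "\<epsilon> > 0"
  shows "\<exists>K. \<forall>x\<ge>1. \<omega> x \<le> \<epsilon> * x\<^sup>2 + K"
  by (rule eventually_le_square_imp[OF assms(1,3) landau_o.smallD[OF assms(2,3)]])

text \<open>The next two lemmas iterate the basic inequalities, so that arbitrary factors and dilations can be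
  exchanged for each other.\<close>

lemma doubling_iterate:
  fixes \<omega> :: "real \<Rightarrow> real"
  assumes "C \<ge> 1" "\<And>t. t \<ge> 0 \<Longrightarrow> 2 * \<omega> t \<le> \<omega> (C * t)" "\<And>t. t \<ge> 0 \<Longrightarrow> \<omega> t \<ge> 0"
  shows "\<exists>D\<ge>1. \<forall>t\<ge>0. A * \<omega> t \<le> \<omega> (D * t)"
proof -
  have it: "2 ^ k * \<omega> t \<le> \<omega> (C ^ k * t)" if "t \<ge> 0" for k t
  proof (induction k)
    case (Suc k)
    have "2 ^ Suc k * \<omega> t \<le> 2 * \<omega> (C ^ k * t)" using Suc by simp
    also have "\<dots> \<le> \<omega> (C * (C ^ k * t))"
      using assms(1) that by (intro assms(2)) simp
    finally show ?case by (simp add: mult_ac)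
  qed simp
  obtain k :: nat where k: "A \<le> 2 ^ k"
    using real_arch_pow[of 2 A] by (auto intro: less_imp_le)
  have "A * \<omega> t \<le> \<omega> (C ^ k * t)" if "t \<ge> 0" for t
    using mult_right_mono[OF k assms(3)[OF that]] it[OF that, of k] by simp
  then show ?thesis using assms(1) by (intro exI[of _ "C ^ k"]) auto
qed

lemma dilation_iterate:
  fixes \<omega> :: "real \<Rightarrow> real"
  assumes L: "L \<ge> 1" "\<And>t. t \<ge> 0 \<Longrightarrow> \<omega> (2 * t) \<le> L * (\<omega> t + 1)"
    and mono: "\<And>s t. 0 \<le> s \<Longrightarrow> s \<le> t \<Longrightarrow> \<omega> s \<le> \<omega> t"
    and nonneg: "\<And>t. t \<ge> 0 \<Longrightarrow> \<omega> t \<ge> 0" and D: "D \<ge> 0"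
  shows "\<exists>L\<ge>1. \<forall>t\<ge>0. \<omega> (D * t) \<le> L * (\<omega> t + 1)"
proof -
  have it: "\<omega> (2 ^ k * t) + 1 \<le> (L + 1) ^ k * (\<omega> t + 1)" if "t \<ge> 0" for k t
  proof (induction k)
    case (Suc k)
    have "\<omega> (2 ^ Suc k * t) + 1 \<le> L * (\<omega> (2 ^ k * t) + 1) + 1"
      using L(2)[of "2 ^ k * t"] that by (simp add: mult.assoc)
    also have "\<dots> \<le> (L + 1) * (\<omega> (2 ^ k * t) + 1)"
      using nonneg[of "2 ^ k * t"] that by (simp add: algebra_simps)
    also have "\<dots> \<le> (L + 1) * ((L + 1) ^ k * (\<omega> t + 1))"
      using Suc L(1) by (intro mult_left_mono) auto
    finally show ?case by (simp add: mult_ac)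
  qed simp
  obtain k :: nat where k: "D \<le> 2 ^ k"
    using real_arch_pow[of 2 D] by (auto intro: less_imp_le)
  have "\<omega> (D * t) \<le> (L + 1) ^ k * (\<omega> t + 1)" if "t \<ge> 0" for t
  proof -
    have "\<omega> (D * t) \<le> \<omega> (2 ^ k * t)"
      using k that D by (intro mono mult_right_mono) auto
    then show ?thesis using it[OF that, of k] by simp
  qed
  moreover have "(L + 1) ^ k \<ge> 1" using L(1) by simp
  ultimately show ?thesis by blast
qed


section \<open>Topologies defined by seminorms\<close>

definition fun_subspace :: "('a \<Rightarrow> complex) set \<Rightarrow> bool" where
  "fun_subspace E \<longleftrightarrow> (\<lambda>x. 0) \<in> E \<and> (\<forall>f\<in>E. \<forall>g\<in>E. (\<lambda>x. f x + g x) \<in> E) \<and>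
     (\<forall>f\<in>E. \<forall>c. (\<lambda>x. c * f x) \<in> E)"

lemma fun_subspace_diff:
  assumes "fun_subspace E" "f \<in> E" "g \<in> E"
  shows "(\<lambda>x. f x - g x) \<in> E"
proof -
  have g: "(\<lambda>x. (-1) * g x) \<in> E" using assms unfolding fun_subspace_def by blast
  have "\<forall>g\<in>E. (\<lambda>x. f x + g x) \<in> E" using assms by (simp add: fun_subspace_def)
  from bspec[OF this g] have "(\<lambda>x. f x + (-1) * g x) \<in> E" .
  then show ?thesis by simp
qed

lemma seminorm_on_scale: "seminorm_on E p \<Longrightarrow> f \<in> E \<Longrightarrow> p (\<lambda>x. c * f x) = cmod c * p f"
  by (simp add: seminorm_on_def)

lemma seminorm_on_zero:
  assumes "seminorm_on E p" "(\<lambda>x. 0) \<in> E"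
  shows "p (\<lambda>x. 0) = 0"
  using seminorm_on_scale[OF assms, of 0] by simp

lemma seminorm_on_triangle:
  "seminorm_on E p \<Longrightarrow> f \<in> E \<Longrightarrow> g \<in> E \<Longrightarrow> p (\<lambda>x. f x + g x) \<le> p f + p g"
  by (simp add: seminorm_on_def)

lemma seminorm_on_nonneg: "seminorm_on E p \<Longrightarrow> f \<in> E \<Longrightarrow> p f \<ge> 0"
  by (simp add: seminorm_on_def)

lemma seminorm_on_subset: "seminorm_on E p \<Longrightarrow> F \<subseteq> E \<Longrightarrow> seminorm_on F p"
  unfolding seminorm_on_def by (meson subsetD)

lemma seminorm_onI:
  assumes E: "\<And>f c. f \<in> E \<Longrightarrow> (\<lambda>x. c * f x) \<in> E"
    and nonneg: "\<And>f. f \<in> E \<Longrightarrow> p f \<ge> 0"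
    and scale: "\<And>f c. f \<in> E \<Longrightarrow> p (\<lambda>x. c * f x) \<le> cmod c * p f"
    and add: "\<And>f g. f \<in> E \<Longrightarrow> g \<in> E \<Longrightarrow> p (\<lambda>x. f x + g x) \<le> p f + p g"
  shows "seminorm_on E p"
proof -
  have "p (\<lambda>x. c * f x) = cmod c * p f" if f: "f \<in> E" for f c
  proof (cases "c = 0")
    case True
    then show ?thesis using scale[OF f, of c] nonneg[OF E[OF f, of c]] by simp
  next
    case False
    have "p (\<lambda>x. inverse c * (c * f x)) \<le> cmod (inverse c) * p (\<lambda>x. c * f x)"
      by (rule scale[OF E[OF f]])
    moreover have "(\<lambda>x. inverse c * (c * f x)) = f" using False by (simp add: mult.assoc[symmetric])
    ultimately have "p f \<le> p (\<lambda>x. c * f x) / cmod c"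
      by (simp add: norm_inverse divide_inverse mult.commute)
    then have "cmod c * p f \<le> p (\<lambda>x. c * f x)"
      using False by (simp add: field_simps)
    then show ?thesis using scale[OF f, of c] by simp
  qed
  then show ?thesis
    unfolding seminorm_on_def using nonneg add by auto
qed

lemma seminorm_on_diff_commute:
  assumes "seminorm_on E p" "fun_subspace E" "f \<in> E" "g \<in> E"
  shows "p (\<lambda>x. f x - g x) = p (\<lambda>x. g x - f x)"
  using seminorm_on_scale[OF assms(1) fun_subspace_diff[OF assms(2,3,4)], of "-1"] by simp

lemma openin_seminorm_ball:
  "p \<in> P \<Longrightarrow> f \<in> E \<Longrightarrow> \<epsilon> > 0 \<Longrightarrow>
    openin (seminorm_topology E P) {g \<in> E. p (\<lambda>x. g x - f x) < \<epsilon>}"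
  unfolding seminorm_topology_def by (rule topology_generated_by_Basis) blast

lemma topspace_seminorm_topology:
  assumes "fun_subspace E" "p \<in> P" "seminorm_on E p"
  shows "topspace (seminorm_topology E P) = E"
proof
  show "topspace (seminorm_topology E P) \<subseteq> E"
    unfolding seminorm_topology_def by auto
  show "E \<subseteq> topspace (seminorm_topology E P)"
  proof
    fix f assume f: "f \<in> E"
    have "(\<lambda>x. 0) \<in> E" using assms(1) by (simp add: fun_subspace_def)
    then have "f \<in> {g \<in> E. p (\<lambda>x. g x - f x) < 1}"
      using f seminorm_on_zero[OF assms(3)] by simp
    then show "f \<in> topspace (seminorm_topology E P)"
      using openin_subset[OF openin_seminorm_ball[OF assms(2) f, of 1]] by auto
  qed
qed

text \<open>A subbasic ball around \<open>f\<close> that contains \<open>0\<close> contains a ball around \<open>0\<close> of the same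
  seminorm.\<close>

lemma seminorm_topology_nbhd_zero:
  assumes E: "\<And>f c. f \<in> E \<Longrightarrow> (\<lambda>x. c * f x) \<in> E"
    and P: "\<And>p. p \<in> P \<Longrightarrow> seminorm_on E p"
    and U: "openin (seminorm_topology E P) U" "(\<lambda>x. 0) \<in> U"
  shows "\<exists>Q \<delta>. finite Q \<and> Q \<subseteq> P \<and> \<delta> > 0 \<and> {g \<in> E. \<forall>q\<in>Q. q g < \<delta>} \<subseteq> U"
proof -
  have "generate_topology_on {{g\<in>E. p (\<lambda>x. g x - f x) < \<epsilon>} | p f \<epsilon>. p \<in> P \<and> f \<in> E \<and> \<epsilon> > 0} U"
    using U(1) by (simp add: seminorm_topology_def openin_topology_generated_by_iff)
  then show ?thesis using U(2)
  proof induction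
    case Empty
    then show ?case by simp
  next
    case (Int a b)
    then obtain Qa da Qb db where
      "finite Qa" "Qa \<subseteq> P" "da > 0" "{g \<in> E. \<forall>q\<in>Qa. q g < da} \<subseteq> a"
      "finite Qb" "Qb \<subseteq> P" "db > 0" "{g \<in> E. \<forall>q\<in>Qb. q g < db} \<subseteq> b"
      by blast
    then show ?case
      by (intro exI[of _ "Qa \<union> Qb"] exI[of _ "min da db"]) auto
  next
    case (UN K)
    then obtain k where k: "k \<in> K" "(\<lambda>x. 0) \<in> k" by blast
    then show ?case using UN.IH[OF k] by blast
  next
    case (Basis s)
    then obtain p f \<epsilon> where s: "s = {g\<in>E. p (\<lambda>x. g x - f x) < \<epsilon>}" "p \<in> P" "f \<in> E" "\<epsilon> > 0"
      by blast
    have f': "(\<lambda>x. - f x) \<in> E" using E[OF s(3), of "-1"] by simp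
    have d: "p (\<lambda>x. - f x) < \<epsilon>" using Basis(2) by (simp add: s(1))
    have "p (\<lambda>x. g x - f x) < \<epsilon>" if "g \<in> E" "p g < \<epsilon> - p (\<lambda>x. - f x)" for g
      using seminorm_on_triangle[OF P[OF s(2)] that(1) f'] that(2) by simp
    then show ?case
      using d s(2) by (intro exI[of _ "{p}"] exI[of _ "\<epsilon> - p (\<lambda>x. - f x)"]) (auto simp: s(1))
  qed
qed

text \<open>By homogeneity a seminorm that is less than \<open>1\<close> on a ball is bounded by a multiple of the sum of
  the finitely many seminorms that define this ball.\<close>

lemma open_seminorm_ball_imp_bounded:
  assumes E: "\<And>f c. f \<in> E \<Longrightarrow> (\<lambda>x. c * f x) \<in> E" "(\<lambda>x. 0) \<in> E"
    and P: "\<And>p. p \<in> P \<Longrightarrow> seminorm_on E p"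
    and p: "seminorm_on E p"
    and U: "openin (seminorm_topology E P) {g \<in> E. p g < 1}"
  shows "\<exists>Q K. finite Q \<and> Q \<subseteq> P \<and> K > 0 \<and> (\<forall>f\<in>E. p f \<le> K * (\<Sum>q\<in>Q. q f))"
proof -
  have "(\<lambda>x. 0) \<in> {g \<in> E. p g < 1}" using E(2) seminorm_on_zero[OF p] by simp
  then obtain Q \<delta> where Q: "finite Q" "Q \<subseteq> P" "\<delta> > 0" "{g \<in> E. \<forall>q\<in>Q. q g < \<delta>} \<subseteq> {g \<in> E. p g < 1}"
    using seminorm_topology_nbhd_zero[OF E(1) P U] by blast
  have "p f \<le> 2 / \<delta> * (\<Sum>q\<in>Q. q f)" if f: "f \<in> E" for f
  proof -
    let ?r = "\<Sum>q\<in>Q. q f"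
    have q0: "0 \<le> q f" if "q \<in> Q" for q
      using that Q(2) P f seminorm_on_nonneg by blast
    have r0: "?r \<ge> 0" by (intro sum_nonneg q0)
    have key: "c * p f < 1" if c: "c > 0" "c * ?r < \<delta>" for c
    proof -
      have "q (\<lambda>x. of_real c * f x) < \<delta>" if "q \<in> Q" for q
      proof -
        have "q f \<le> ?r" using that Q(1) q0 by (intro member_le_sum) auto
        then have "c * q f \<le> c * ?r" using c by simp
        moreover have "q (\<lambda>x. of_real c * f x) = c * q f"
          using that Q(2) seminorm_on_scale[OF P f, of q "of_real c"] c(1) by auto
        ultimately show ?thesis using c(2) by simp
      qed
      then have "p (\<lambda>x. of_real c * f x) < 1"
        using Q(4) E(1)[OF f] by blast
      then show ?thesis using seminorm_on_scale[OF p f, of "of_real c"] c(1) by simp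
    qed
    show ?thesis
    proof (cases "?r = 0")
      case True
      have "p f \<le> 0"
      proof (rule ccontr)
        assume "\<not> p f \<le> 0"
        then show False using key[of "1 / p f"] True Q(3) by simp
      qed
      then show ?thesis using True by simp
    next
      case False
      then have "?r > 0" using r0 by simp
      moreover from this have "\<delta> / (2 * ?r) * p f < 1"
        using Q(3) by (intro key) (auto simp: field_simps)
      ultimately show ?thesis using Q(3) by (simp add: field_simps)
    qed
  qed
  then show ?thesis using Q by (intro exI[of _ Q] exI[of _ "2 / \<delta>"]) auto
qed

lemma bounded_imp_open_seminorm_ball:
  assumes E: "fun_subspace E" and p: "seminorm_on E p" and q: "seminorm_on E q" "q \<in> P"
    and K: "\<And>f. f \<in> E \<Longrightarrow> p f \<le> K * q f" and f: "f \<in> E"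
  shows "openin (seminorm_topology E P) {g \<in> E. p (\<lambda>x. g x - f x) < \<epsilon>}"
proof (subst openin_subopen, intro ballI)
  fix g
  assume g: "g \<in> {g \<in> E. p (\<lambda>x. g x - f x) < \<epsilon>}"
  define \<delta> where "\<delta> = (\<epsilon> - p (\<lambda>x. g x - f x)) / (\<bar>K\<bar> + 1)"
  have \<delta>: "\<delta> > 0" using g by (simp add: \<delta>_def)
  let ?T = "{h \<in> E. q (\<lambda>x. h x - g x) < \<delta>}"
  have "openin (seminorm_topology E P) ?T"
    using g q(2) \<delta> by (intro openin_seminorm_ball) auto
  moreover have "g \<in> ?T"
    using g \<delta> seminorm_on_zero[OF q(1)] E by (simp add: fun_subspace_def)
  moreover have "?T \<subseteq> {g \<in> E. p (\<lambda>x. g x - f x) < \<epsilon>}"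
  proof clarify
    fix h assume h: "h \<in> E" "q (\<lambda>x. h x - g x) < \<delta>"
    have hg: "(\<lambda>x. h x - g x) \<in> E" "(\<lambda>x. g x - f x) \<in> E"
      using fun_subspace_diff[OF E] h g f by auto
    have "p (\<lambda>x. h x - g x) \<le> K * q (\<lambda>x. h x - g x)" by (rule K[OF hg(1)])
    also have "\<dots> \<le> (\<bar>K\<bar> + 1) * q (\<lambda>x. h x - g x)"
      using seminorm_on_nonneg[OF q(1) hg(1)] by (intro mult_right_mono) auto
    also have "\<dots> < (\<bar>K\<bar> + 1) * \<delta>"
      using h(2) by (intro mult_strict_left_mono) auto
    also have "\<dots> = \<epsilon> - p (\<lambda>x. g x - f x)"
      by (simp add: \<delta>_def)
    finally show "p (\<lambda>x. h x - f x) < \<epsilon>"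
      using seminorm_on_triangle[OF p hg] by simp
  qed
  ultimately show "\<exists>T. openin (seminorm_topology E P) T \<and> g \<in> T \<and> T \<subseteq> {g \<in> E. p (\<lambda>x. g x - f x) < \<epsilon>}"
    by blast
qed

text \<open>In the definition of the Roumieu topology, continuity on a step thus becomes an inequality.\<close>

lemma continuous_seminorm_iff:
  assumes E: "fun_subspace E" and p: "seminorm_on E p" and q: "seminorm_on E q"
  shows "continuous_map (seminorm_topology E {q}) euclideanreal p \<longleftrightarrow> (\<exists>K>0. \<forall>f\<in>E. p f \<le> K * q f)"
proof
  assume L: "continuous_map (seminorm_topology E {q}) euclideanreal p"
  have "openin (seminorm_topology E {q}) {g \<in> topspace (seminorm_topology E {q}). p g \<in> {..<1}}"
    using L by (rule openin_continuous_map_preimage) simp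
  then have "openin (seminorm_topology E {q}) {g \<in> E. p g < 1}"
    using topspace_seminorm_topology[OF E _ q, of "{q}"] by simp
  then obtain Q K where Q: "finite Q" "Q \<subseteq> {q}" "K > 0" "\<And>f. f \<in> E \<Longrightarrow> p f \<le> K * (\<Sum>q\<in>Q. q f)"
    using open_seminorm_ball_imp_bounded[of E "{q}" p] E p q by (auto simp: fun_subspace_def)
  have "p f \<le> K * q f" if f: "f \<in> E" for f
  proof -
    have "(\<Sum>q\<in>Q. q f) \<le> q f"
      using Q(2) seminorm_on_nonneg[OF q f] by (cases "Q = {}") (auto simp: subset_singleton_iff)
    then have "K * (\<Sum>q\<in>Q. q f) \<le> K * q f" using Q(3) by simp
    then show ?thesis using Q(4)[OF f] by simp
  qed
  then show "\<exists>K>0. \<forall>f\<in>E. p f \<le> K * q f" using Q(3) by blast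
next
  assume "\<exists>K>0. \<forall>f\<in>E. p f \<le> K * q f"
  then obtain K where K: "\<And>f. f \<in> E \<Longrightarrow> p f \<le> K * q f" by blast
  have top: "topspace (seminorm_topology E {q}) = E"
    by (rule topspace_seminorm_topology[OF E _ q]) simp
  show "continuous_map (seminorm_topology E {q}) euclideanreal p"
    unfolding continuous_map_def
  proof (intro conjI allI impI)
    fix U :: "real set"
    assume U: "openin euclideanreal U"
    show "openin (seminorm_topology E {q}) {x \<in> topspace (seminorm_topology E {q}). p x \<in> U}"
      unfolding top
    proof (subst openin_subopen, intro ballI)
      fix f assume f: "f \<in> {x \<in> E. p x \<in> U}"
      then obtain e where e: "e > 0" "\<And>y. \<bar>y - p f\<bar> < e \<Longrightarrow> y \<in> U"
        using U by (auto simp: open_dist dist_real_def)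
      let ?T = "{g \<in> E. p (\<lambda>x. g x - f x) < e}"
      have "openin (seminorm_topology E {q}) ?T"
        using f by (intro bounded_imp_open_seminorm_ball[OF E p q _ K]) auto
      moreover have "f \<in> ?T"
        using f e(1) seminorm_on_zero[OF p] E by (simp add: fun_subspace_def)
      moreover have "?T \<subseteq> {x \<in> E. p x \<in> U}"
      proof clarify
        fix g assume g: "g \<in> E" "p (\<lambda>x. g x - f x) < e"
        have d: "(\<lambda>x. g x - f x) \<in> E" "(\<lambda>x. f x - g x) \<in> E"
          using fun_subspace_diff[OF E] f g by auto
        have "p g \<le> p f + p (\<lambda>x. g x - f x)" "p f \<le> p g + p (\<lambda>x. f x - g x)"
          using seminorm_on_triangle[OF p _ d(1), of f] seminorm_on_triangle[OF p g(1) d(2)] f by auto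
        then have "\<bar>p g - p f\<bar> < e"
          using g seminorm_on_diff_commute[OF p E, of g f] f by simp
        then show "p g \<in> U" by (rule e(2))
      qed
      ultimately show "\<exists>T. openin (seminorm_topology E {q}) T \<and> f \<in> T \<and> T \<subseteq> {x \<in> E. p x \<in> U}"
        by blast
    qed
  qed simp
qed

lemma seminorm_topology_refines:
  assumes E: "fun_subspace E"
    and P: "\<And>p. p \<in> P \<Longrightarrow> seminorm_on E p" and Q: "\<And>q. q \<in> Q \<Longrightarrow> seminorm_on E q"
    and le: "\<And>p. p \<in> P \<Longrightarrow> \<exists>q\<in>Q. \<exists>K. \<forall>f\<in>E. p f \<le> K * q f"
    and U: "openin (seminorm_topology E P) U"
  shows "openin (seminorm_topology E Q) U"
proof -
  have "generate_topology_on {{g\<in>E. p (\<lambda>x. g x - f x) < \<epsilon>} | p f \<epsilon>. p \<in> P \<and> f \<in> E \<and> \<epsilon> > 0} U"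
    using U by (simp add: seminorm_topology_def openin_topology_generated_by_iff)
  then show ?thesis
  proof induction
    case (Basis s)
    then obtain p f \<epsilon> where s: "s = {g\<in>E. p (\<lambda>x. g x - f x) < \<epsilon>}" "p \<in> P" "f \<in> E"
      by blast
    obtain q K where "q \<in> Q" "\<And>f. f \<in> E \<Longrightarrow> p f \<le> K * q f" using le[OF s(2)] by blast
    then show ?case
      unfolding s(1) by (intro bounded_imp_open_seminorm_ball[OF E P[OF s(2)] Q _ _ s(3)])
  qed (auto intro: openin_Union)
qed

section \<open>Step spaces and their limits\<close>

lemma mem_Rd_upd: "x \<in> Rd d \<Longrightarrow> i < d \<Longrightarrow> x(i := t) \<in> Rd d"
  by (auto simp: Rd_def)

lemma notin_Rd_upd: "x \<notin> Rd d \<Longrightarrow> i < d \<Longrightarrow> x(i := t) \<notin> Rd d"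
  by (auto simp: Rd_def)

lemma iterated_partial_zero_outside:
  assumes "f \<in> smooth_functions d" "set is \<subseteq> {..<d}" "x \<notin> Rd d"
  shows "foldr partial is f x = 0"
  using assms(2,3)
proof (induction "is" arbitrary: x)
  case Nil
  then show ?case using assms(1) by (simp add: smooth_functions_def)
next
  case (Cons i "is")
  have "foldr partial is f (x(i := t)) = 0" for t
    using Cons notin_Rd_upd[of x d i t] by auto
  then show ?case by (simp add: partial_def[of i])
qed

lemma iterated_partial_has_derivative:
  assumes "f \<in> smooth_functions d" "set is \<subseteq> {..<d}" "i < d"
  shows "((\<lambda>t. foldr partial is f (x(i := t))) has_vector_derivative
    partial i (foldr partial is f) x) (at (x i))"
proof (cases "x \<in> Rd d")
  case True
  then have "(\<lambda>t. foldr partial is f (x(i := t))) differentiable at (x i)"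
    using assms by (simp add: smooth_functions_def)
  then show ?thesis unfolding partial_def by (simp add: vector_derivative_works)
next
  case False
  then have "(\<lambda>t. foldr partial is f (x(i := t))) = (\<lambda>t. 0)"
    using iterated_partial_zero_outside[OF assms(1,2)] notin_Rd_upd[OF False assms(3)] by auto
  then show ?thesis by (simp add: partial_def)
qed

lemma iterated_partial_add:
  assumes "f \<in> smooth_functions d" "g \<in> smooth_functions d" "set is \<subseteq> {..<d}"
  shows "foldr partial is (\<lambda>x. f x + g x) = (\<lambda>x. foldr partial is f x + foldr partial is g x)"
  using assms(3)
proof (induction "is")
  case (Cons i "is")
  then have i: "i < d" "set is \<subseteq> {..<d}" by auto
  have "partial i (\<lambda>x. foldr partial is f x + foldr partial is g x) x =
      partial i (foldr partial is f) x + partial i (foldr partial is g) x" for x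
    unfolding partial_def[of i "\<lambda>x. foldr partial is f x + foldr partial is g x"]
    by (intro vector_derivative_at has_vector_derivative_add
        iterated_partial_has_derivative[OF assms(1) i(2,1)]
        iterated_partial_has_derivative[OF assms(2) i(2,1)])
  then show ?case using Cons i(2) by auto
qed simp

lemma iterated_partial_scale:
  assumes "f \<in> smooth_functions d" "set is \<subseteq> {..<d}"
  shows "foldr partial is (\<lambda>x. c * f x) = (\<lambda>x. c * foldr partial is f x)"
  using assms(2)
proof (induction "is")
  case (Cons i "is")
  then have i: "i < d" "set is \<subseteq> {..<d}" by auto
  have "partial i (\<lambda>x. c * foldr partial is f x) x = c * partial i (foldr partial is f) x" for x
    unfolding partial_def[of i "\<lambda>x. c * foldr partial is f x"]
    by (intro vector_derivative_at has_vector_derivative_mult_right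
        iterated_partial_has_derivative[OF assms(1) i(2,1)])
  then show ?case using Cons i(2) by auto
qed simp

lemma iterated_partial_zero: "foldr partial is (\<lambda>x. 0) = (\<lambda>x. 0)"
  by (induction "is") (auto simp: partial_def)

lemma fun_subspace_smooth_functions: "fun_subspace (smooth_functions d)"
  unfolding fun_subspace_def
proof (intro conjI ballI allI)
  show "(\<lambda>x. 0) \<in> smooth_functions d"
    by (simp add: smooth_functions_def iterated_partial_zero)
  fix f assume f: "f \<in> smooth_functions d"
  show "(\<lambda>x. c * f x) \<in> smooth_functions d" for c
    using f iterated_partial_scale[OF f, of _ c]
    by (auto simp: smooth_functions_def intro!: continuous_intros derivative_intros)
  fix g assume g: "g \<in> smooth_functions d"
  show "(\<lambda>x. f x + g x) \<in> smooth_functions d"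
    using f g iterated_partial_add[OF f g]
    by (auto simp: smooth_functions_def intro!: continuous_intros derivative_intros)
qed

text \<open>The derivative of a multi-index is one of the iterated partial derivatives over which smoothness
  quantifies; linearity is inherited from these.\<close>

lemma mderiv_eq_iterated_partial:
  "k \<le> d \<Longrightarrow> \<exists>is. set is \<subseteq> {..<d} \<and> mderiv k \<beta> = foldr partial is"
proof (induction k)
  case 0
  then show ?case by (intro exI[of _ "[]"]) auto
next
  case (Suc k)
  then obtain "is" where is1: "set is \<subseteq> {..<d}" and is2: "mderiv k \<beta> = foldr partial is"
    by auto
  have "foldr partial (replicate (\<beta> k) k) = partial k ^^ \<beta> k"
    by (induction "\<beta> k") (auto simp: fun_eq_iff foldr_replicate)
  then show ?case
    using Suc.prems is1 is2
    by (intro exI[of _ "is @ replicate (\<beta> k) k"]) (auto simp: fun_eq_iff)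
qed

lemma mderiv_add:
  assumes "f \<in> smooth_functions d" "g \<in> smooth_functions d"
  shows "mderiv d \<beta> (\<lambda>x. f x + g x) x = mderiv d \<beta> f x + mderiv d \<beta> g x"
  using mderiv_eq_iterated_partial[of d d \<beta>] iterated_partial_add[OF assms] by fastforce

lemma mderiv_scale:
  assumes "f \<in> smooth_functions d"
  shows "mderiv d \<beta> (\<lambda>x. c * f x) x = c * mderiv d \<beta> f x"
  using mderiv_eq_iterated_partial[of d d \<beta>] iterated_partial_scale[OF assms] by fastforce

lemma mderiv_zero: "mderiv d \<beta> (\<lambda>x. 0) x = 0"
  using mderiv_eq_iterated_partial[of d d \<beta>] iterated_partial_zero by fastforce

definition pos_weight :: "mi_weight \<Rightarrow> bool" where
  "pos_weight w \<longleftrightarrow> (\<forall>\<alpha> \<beta>. w \<alpha> \<beta> > 0)"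

lemma divide_ennreal_le_iff:
  assumes "w > 0" "C \<ge> 0"
  shows "x / ennreal w \<le> ennreal C \<longleftrightarrow> x \<le> ennreal (C * w)"
  using assms
  by (cases x) (auto simp: divide_ennreal ennreal_le_iff pos_divide_le_eq ennreal_top_divide top_unique)

text \<open>This removes the extended nonnegative reals: all further estimates of norms are pointwise.\<close>

lemma weighted_norm_le_iff:
  assumes w: "pos_weight w" and C: "C \<ge> 0"
  shows "weighted_norm d w f \<le> ennreal C \<longleftrightarrow>
    (\<forall>\<alpha>\<in>multi_indices d. \<forall>\<beta>\<in>multi_indices d. \<forall>x\<in>Rd d.
       \<bar>monomial d \<alpha> x\<bar> * cmod (mderiv d \<beta> f x) \<le> C * w \<alpha> \<beta>)"
proof -
  have "sup_norm d (\<lambda>x. of_real (monomial d \<alpha> x) * mderiv d \<beta> f x) / ennreal (w \<alpha> \<beta>) \<le> ennreal C \<longleftrightarrow>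
    (\<forall>x\<in>Rd d. \<bar>monomial d \<alpha> x\<bar> * cmod (mderiv d \<beta> f x) \<le> C * w \<alpha> \<beta>)" for \<alpha> \<beta>
  proof -
    have pos: "w \<alpha> \<beta> > 0" using w by (simp add: pos_weight_def)
    have "sup_norm d (\<lambda>x. of_real (monomial d \<alpha> x) * mderiv d \<beta> f x) / ennreal (w \<alpha> \<beta>) \<le> ennreal C \<longleftrightarrow>
      sup_norm d (\<lambda>x. of_real (monomial d \<alpha> x) * mderiv d \<beta> f x) \<le> ennreal (C * w \<alpha> \<beta>)"
      by (rule divide_ennreal_le_iff[OF pos C])
    also have "\<dots> \<longleftrightarrow> (\<forall>x\<in>Rd d. \<bar>monomial d \<alpha> x\<bar> * cmod (mderiv d \<beta> f x) \<le> C * w \<alpha> \<beta>)"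
      unfolding sup_norm_def SUP_le_iff
      using pos C by (simp add: ennreal_le_iff norm_mult)
    finally show ?thesis .
  qed
  then show ?thesis unfolding weighted_norm_def SUP_le_iff by simp
qed

lemma step_norm_nonneg: "step_norm d w f \<ge> 0"
  by (simp add: step_norm_def)

lemma step_spaceI:
  assumes "pos_weight w" "C \<ge> 0" "f \<in> smooth_functions d"
    and "\<And>\<alpha> \<beta> x. \<alpha> \<in> multi_indices d \<Longrightarrow> \<beta> \<in> multi_indices d \<Longrightarrow> x \<in> Rd d \<Longrightarrow>
       \<bar>monomial d \<alpha> x\<bar> * cmod (mderiv d \<beta> f x) \<le> C * w \<alpha> \<beta>"
  shows "f \<in> step_space d w" "step_norm d w f \<le> C"
proof -
  have le: "weighted_norm d w f \<le> ennreal C"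
    using assms by (simp add: weighted_norm_le_iff)
  then show "f \<in> step_space d w"
    using assms(3) by (auto simp: step_space_def intro: le_less_trans)
  show "step_norm d w f \<le> C"
    using enn2real_mono[OF le] assms(2) by (simp add: step_norm_def)
qed

lemma step_norm_bound:
  assumes "pos_weight w" "f \<in> step_space d w"
    and "\<alpha> \<in> multi_indices d" "\<beta> \<in> multi_indices d" "x \<in> Rd d"
  shows "\<bar>monomial d \<alpha> x\<bar> * cmod (mderiv d \<beta> f x) \<le> step_norm d w f * w \<alpha> \<beta>"
proof -
  have "weighted_norm d w f = ennreal (step_norm d w f)"
    using assms(2) by (simp add: step_norm_def step_space_def less_top)
  then show ?thesis
    using weighted_norm_le_iff[OF assms(1) step_norm_nonneg, of d f d w f] assms(3-5) by auto
qed

lemma step_space_smooth: "f \<in> step_space d w \<Longrightarrow> f \<in> smooth_functions d"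
  by (simp add: step_space_def)

lemma step_add:
  assumes w: "pos_weight w" and f: "f \<in> step_space d w" and g: "g \<in> step_space d w"
  shows "(\<lambda>x. f x + g x) \<in> step_space d w"
    and "step_norm d w (\<lambda>x. f x + g x) \<le> step_norm d w f + step_norm d w g"
proof -
  have s: "(\<lambda>x. f x + g x) \<in> smooth_functions d"
    using fun_subspace_smooth_functions step_space_smooth[OF f] step_space_smooth[OF g]
    unfolding fun_subspace_def by blast
  have b: "\<bar>monomial d \<alpha> x\<bar> * cmod (mderiv d \<beta> (\<lambda>x. f x + g x) x) \<le>
      (step_norm d w f + step_norm d w g) * w \<alpha> \<beta>"
    if "\<alpha> \<in> multi_indices d" "\<beta> \<in> multi_indices d" "x \<in> Rd d" for \<alpha> \<beta> x
  proof -
    have "\<bar>monomial d \<alpha> x\<bar> * cmod (mderiv d \<beta> (\<lambda>x. f x + g x) x) \<le>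
        \<bar>monomial d \<alpha> x\<bar> * (cmod (mderiv d \<beta> f x) + cmod (mderiv d \<beta> g x))"
      unfolding mderiv_add[OF step_space_smooth[OF f] step_space_smooth[OF g]]
      by (intro mult_left_mono norm_triangle_ineq) auto
    also have "\<dots> \<le> step_norm d w f * w \<alpha> \<beta> + step_norm d w g * w \<alpha> \<beta>"
      unfolding distrib_left using that by (intro add_mono step_norm_bound w f g)
    finally show ?thesis by (simp add: distrib_right)
  qed
  show "(\<lambda>x. f x + g x) \<in> step_space d w"
    and "step_norm d w (\<lambda>x. f x + g x) \<le> step_norm d w f + step_norm d w g"
    by (rule step_spaceI[OF w _ s b]; simp add: step_norm_nonneg)+
qed

lemma step_scale:
  assumes w: "pos_weight w" and f: "f \<in> step_space d w"
  shows "(\<lambda>x. c * f x) \<in> step_space d w"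
    and "step_norm d w (\<lambda>x. c * f x) \<le> cmod c * step_norm d w f"
proof -
  have s: "(\<lambda>x. c * f x) \<in> smooth_functions d"
    using fun_subspace_smooth_functions step_space_smooth[OF f]
    unfolding fun_subspace_def by blast
  have b: "\<bar>monomial d \<alpha> x\<bar> * cmod (mderiv d \<beta> (\<lambda>x. c * f x) x) \<le> cmod c * step_norm d w f * w \<alpha> \<beta>"
    if "\<alpha> \<in> multi_indices d" "\<beta> \<in> multi_indices d" "x \<in> Rd d" for \<alpha> \<beta> x
    using mult_left_mono[OF step_norm_bound[OF w f that], of "cmod c"]
    by (simp add: mderiv_scale[OF step_space_smooth[OF f]] norm_mult mult_ac)
  show "(\<lambda>x. c * f x) \<in> step_space d w"
    and "step_norm d w (\<lambda>x. c * f x) \<le> cmod c * step_norm d w f"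
    by (rule step_spaceI[OF w _ s b]; simp add: step_norm_nonneg)+
qed

lemma fun_subspace_step_space:
  assumes w: "pos_weight w"
  shows "fun_subspace (step_space d w)"
proof -
  have "(\<lambda>x. 0) \<in> smooth_functions d"
    using fun_subspace_smooth_functions by (simp add: fun_subspace_def)
  then have "(\<lambda>x. 0) \<in> step_space d w"
    by (rule step_spaceI(1)[OF w order_refl]) (simp add: mderiv_zero)
  then show ?thesis
    unfolding fun_subspace_def using step_add(1)[OF w] step_scale(1)[OF w] by blast
qed

lemma seminorm_on_step_norm:
  assumes w: "pos_weight w"
  shows "seminorm_on (step_space d w) (step_norm d w)"
  by (intro seminorm_onI step_scale[OF w] step_add(2)[OF w] step_norm_nonneg)

lemma step_space_le:
  assumes v: "pos_weight v" and w: "pos_weight w" and C: "C > 0"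
    and le: "\<And>\<alpha> \<beta>. v \<alpha> \<beta> \<le> C * w \<alpha> \<beta>" and f: "f \<in> step_space d v"
  shows "f \<in> step_space d w" "step_norm d w f \<le> C * step_norm d v f"
proof -
  have b: "\<bar>monomial d \<alpha> x\<bar> * cmod (mderiv d \<beta> f x) \<le> C * step_norm d v f * w \<alpha> \<beta>"
    if "\<alpha> \<in> multi_indices d" "\<beta> \<in> multi_indices d" "x \<in> Rd d" for \<alpha> \<beta> x
    using step_norm_bound[OF v f that] mult_left_mono[OF le[of \<alpha> \<beta>] step_norm_nonneg[of d v f]]
    by (simp add: mult_ac)
  show "f \<in> step_space d w" "step_norm d w f \<le> C * step_norm d v f"
    using C by (intro step_spaceI[OF w _ step_space_smooth[OF f] b]; simp add: step_norm_nonneg)+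
qed

text \<open>Families of weights that dominate each other define the same spaces: the inclusions of steps
  are bounded in both directions, and these are all that the two limit topologies depend on.\<close>

definition weights_dominated :: "(real \<Rightarrow> mi_weight) \<Rightarrow> (real \<Rightarrow> mi_weight) \<Rightarrow> bool" where
  "weights_dominated v w \<longleftrightarrow> (\<forall>l>0. \<exists>l'>0. \<exists>C>0. \<forall>\<alpha> \<beta>. v l \<alpha> \<beta> \<le> C * w l' \<alpha> \<beta>)"

text \<open>A projective limit is contained in every step, so that here the second parameter is given and
  the first one is chosen.\<close>

definition weights_refined :: "(real \<Rightarrow> mi_weight) \<Rightarrow> (real \<Rightarrow> mi_weight) \<Rightarrow> bool" where
  "weights_refined v w \<longleftrightarrow> (\<forall>l>0. \<exists>l'>0. \<exists>C>0. \<forall>\<alpha> \<beta>. v l' \<alpha> \<beta> \<le> C * w l \<alpha> \<beta>)"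

text \<open>The second part restricts a seminorm along the bounded inclusion of a step of the first family into
  a step of the second.\<close>

lemma roumieu_subset:
  assumes v: "\<And>l. l > 0 \<Longrightarrow> pos_weight (v l)" and w: "\<And>l. l > 0 \<Longrightarrow> pos_weight (w l)"
    and vw: "weights_dominated v w"
  shows "(\<Union>l\<in>{0<..}. step_space d (v l)) \<subseteq> (\<Union>l\<in>{0<..}. step_space d (w l))"
    and "\<lbrakk>seminorm_on (\<Union>l\<in>{0<..}. step_space d (w l)) p; l > 0;
      \<forall>l>0. continuous_map (seminorm_topology (step_space d (w l)) {step_norm d (w l)}) euclideanreal p\<rbrakk> \<Longrightarrow>
      continuous_map (seminorm_topology (step_space d (v l)) {step_norm d (v l)}) euclideanreal p"
proof -
  have le: "\<exists>l'>0. \<exists>C>0. \<forall>f\<in>step_space d (v l). f \<in> step_space d (w l') \<and>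
      step_norm d (w l') f \<le> C * step_norm d (v l) f" if l: "l > 0" for l
  proof -
    obtain l' C where l': "l' > 0" "C > 0" "\<And>\<alpha> \<beta>. v l \<alpha> \<beta> \<le> C * w l' \<alpha> \<beta>"
      using vw l unfolding weights_dominated_def by blast
    show ?thesis
      using l'(1,2) step_space_le[OF v[OF l] w[OF l'(1)] l'(2,3)]
      by (intro exI[of _ l'] exI[of _ C] conjI ballI)
  qed
  then show sub: "(\<Union>l\<in>{0<..}. step_space d (v l)) \<subseteq> (\<Union>l\<in>{0<..}. step_space d (w l))"
    by fastforce
  assume p: "seminorm_on (\<Union>l\<in>{0<..}. step_space d (w l)) p" and l: "l > 0"
    and cont: "\<forall>l>0. continuous_map (seminorm_topology (step_space d (w l)) {step_norm d (w l)}) euclideanreal p"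
  obtain l' C where l': "l' > 0" "C > 0"
    "\<And>f. f \<in> step_space d (v l) \<Longrightarrow> f \<in> step_space d (w l')"
    "\<And>f. f \<in> step_space d (v l) \<Longrightarrow> step_norm d (w l') f \<le> C * step_norm d (v l) f"
    using le[OF l] by blast
  have pw: "seminorm_on (step_space d (w l')) p"
    using p l'(1) by (auto intro: seminorm_on_subset)
  have pv: "seminorm_on (step_space d (v l)) p"
    using pw l'(3) by (auto intro: seminorm_on_subset)
  obtain K where K: "K > 0" "\<And>f. f \<in> step_space d (w l') \<Longrightarrow> p f \<le> K * step_norm d (w l') f"
    using continuous_seminorm_iff[OF fun_subspace_step_space[OF w[OF l'(1)]] pw
        seminorm_on_step_norm[OF w[OF l'(1)]]] cont l'(1) by blast
  have "p f \<le> (K * C) * step_norm d (v l) f" if f: "f \<in> step_space d (v l)" for f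
  proof -
    have "p f \<le> K * step_norm d (w l') f" by (rule K(2)[OF l'(3)[OF f]])
    also have "\<dots> \<le> K * (C * step_norm d (v l) f)"
      using K(1) l'(4)[OF f] by simp
    finally show ?thesis by (simp add: mult.assoc)
  qed
  moreover have "K * C > 0" using K(1) l'(2) by simp
  ultimately show "continuous_map (seminorm_topology (step_space d (v l)) {step_norm d (v l)}) euclideanreal p"
    using continuous_seminorm_iff[OF fun_subspace_step_space[OF v[OF l]] pv
        seminorm_on_step_norm[OF v[OF l]]] by blast
qed

lemma roumieu_cong:
  assumes v: "\<And>l. l > 0 \<Longrightarrow> pos_weight (v l)" and w: "\<And>l. l > 0 \<Longrightarrow> pos_weight (w l)"
    and vw: "weights_dominated v w" and wv: "weights_dominated w v"
  shows "roumieu d v = roumieu d w"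
proof -
  have E: "(\<Union>l\<in>{0<..}. step_space d (v l)) = (\<Union>l\<in>{0<..}. step_space d (w l))"
    by (rule equalityI[OF roumieu_subset(1)[OF v w vw] roumieu_subset(1)[OF w v wv]])
  have "{p. seminorm_on (\<Union>l\<in>{0<..}. step_space d (w l)) p \<and> (\<forall>l>0. continuous_map
          (seminorm_topology (step_space d (v l)) {step_norm d (v l)}) euclideanreal p)} =
        {p. seminorm_on (\<Union>l\<in>{0<..}. step_space d (w l)) p \<and> (\<forall>l>0. continuous_map
          (seminorm_topology (step_space d (w l)) {step_norm d (w l)}) euclideanreal p)}"
    using roumieu_subset(2)[OF v w vw, of d] roumieu_subset(2)[OF w v wv, of d] unfolding E
    by (intro Collect_cong conj_cong refl iffI allI impI) blast+
  then show ?thesis unfolding roumieu_def Let_def E by simp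
qed

lemma fun_subspace_Inter_steps:
  assumes "\<And>l. l > 0 \<Longrightarrow> pos_weight (v l)"
  shows "fun_subspace (\<Inter>l\<in>{0<..}. step_space d (v l))"
  using fun_subspace_step_space[OF assms] unfolding fun_subspace_def by fastforce

lemma seminorm_on_Inter_steps:
  assumes "\<And>l. l > 0 \<Longrightarrow> pos_weight (v l)" "p \<in> (\<lambda>l. step_norm d (v l)) ` {0<..}"
  shows "seminorm_on (\<Inter>l\<in>{0<..}. step_space d (v l)) p"
  using assms seminorm_on_step_norm[OF assms(1)] by (auto intro: seminorm_on_subset)

lemma beurling_subset:
  assumes v: "\<And>l. l > 0 \<Longrightarrow> pos_weight (v l)" and w: "\<And>l. l > 0 \<Longrightarrow> pos_weight (w l)"
    and vw: "weights_refined v w"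
  shows "(\<Inter>l\<in>{0<..}. step_space d (v l)) \<subseteq> (\<Inter>l\<in>{0<..}. step_space d (w l))"
    and "l > 0 \<Longrightarrow> \<exists>l'>0. \<exists>K>0. \<forall>f\<in>(\<Inter>l\<in>{0<..}. step_space d (v l)).
      step_norm d (w l) f \<le> K * step_norm d (v l') f"
proof -
  have le: "\<exists>l'>0. \<exists>C>0. \<forall>f\<in>step_space d (v l'). f \<in> step_space d (w l) \<and>
      step_norm d (w l) f \<le> C * step_norm d (v l') f" if l: "l > 0" for l
  proof -
    obtain l' C where l': "l' > 0" "C > 0" "\<And>\<alpha> \<beta>. v l' \<alpha> \<beta> \<le> C * w l \<alpha> \<beta>"
      using vw l unfolding weights_refined_def by blast
    show ?thesis
      using l'(1,2) step_space_le[OF v[OF l'(1)] w[OF l] l'(2,3)]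
      by (intro exI[of _ l'] exI[of _ C] conjI ballI)
  qed
  show "(\<Inter>l\<in>{0<..}. step_space d (v l)) \<subseteq> (\<Inter>l\<in>{0<..}. step_space d (w l))"
    using le by fastforce
  show "\<exists>l'>0. \<exists>K>0. \<forall>f\<in>(\<Inter>l\<in>{0<..}. step_space d (v l)).
      step_norm d (w l) f \<le> K * step_norm d (v l') f" if l: "l > 0"
  proof -
    obtain l' C where "l' > 0" "C > 0" "\<And>f. f \<in> step_space d (v l') \<Longrightarrow> step_norm d (w l) f \<le> C * step_norm d (v l') f"
      using le[OF l] by blast
    then show ?thesis by (intro exI[of _ l'] conjI exI[of _ C]) auto
  qed
qed

lemma beurling_cong:
  assumes v: "\<And>l. l > 0 \<Longrightarrow> pos_weight (v l)" and w: "\<And>l. l > 0 \<Longrightarrow> pos_weight (w l)"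
    and vw: "weights_refined v w" and wv: "weights_refined w v"
  shows "beurling d v = beurling d w"
proof -
  define E where "E = (\<Inter>l\<in>{0<..}. step_space d (v l))"
  have Ew: "E = (\<Inter>l\<in>{0<..}. step_space d (w l))"
    unfolding E_def by (rule equalityI[OF beurling_subset(1)[OF v w vw] beurling_subset(1)[OF w v wv]])
  let ?P = "(\<lambda>l. step_norm d (v l)) ` {0<..}" and ?Q = "(\<lambda>l. step_norm d (w l)) ` {0<..}"
  have E: "fun_subspace E" unfolding E_def by (rule fun_subspace_Inter_steps[OF v])
  have P: "seminorm_on E p" if "p \<in> ?P" for p
    unfolding E_def by (rule seminorm_on_Inter_steps[OF v that])
  have Q: "seminorm_on E p" if "p \<in> ?Q" for p
    unfolding Ew by (rule seminorm_on_Inter_steps[OF w that])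
  have PQ: "\<exists>q\<in>?Q. \<exists>K. \<forall>f\<in>E. p f \<le> K * q f" if "p \<in> ?P" for p
    using that beurling_subset(2)[OF w v wv, of _ d] unfolding Ew by fastforce
  have QP: "\<exists>q\<in>?P. \<exists>K. \<forall>f\<in>E. p f \<le> K * q f" if "p \<in> ?Q" for p
    using that beurling_subset(2)[OF v w vw, of _ d] unfolding E_def by fastforce
  have "seminorm_topology E ?P = seminorm_topology E ?Q"
    unfolding topology_eq
    using seminorm_topology_refines[OF E P Q PQ] seminorm_topology_refines[OF E Q P QP] by blast
  then show ?thesis
    unfolding beurling_def Let_def E_def[symmetric] Ew[symmetric] by simp
qed


section \<open>The spaces of the associated function\<close>

lemma mi_order_add: "mi_order d (mi_add \<alpha> \<beta>) = mi_order d \<alpha> + mi_order d \<beta>"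
  by (simp add: mi_order_def mi_add_def sum.distrib)

lemma pos_fun_weight: "pos_weight (fun_weight g \<omega> d l)"
  unfolding pos_weight_def by (cases g) (auto simp: W_eq_conj_weight)

lemma pos_seq_weight: "LC M \<Longrightarrow> h > 0 \<Longrightarrow> pos_weight (seq_weight g M d h)"
  unfolding pos_weight_def by (cases g) (auto simp: LC_pos)

text \<open>Superadditivity of the Young conjugate and the splitting of \<open>\<omega> x / l\<close> into two halves hold for every
  weight function; only the parameter changes, by a factor \<open>2\<close>.\<close>

lemma fun_weight_separated_eq_joint:
  assumes "weight_function \<omega>"
  shows "S_fun_roumieu Separated \<omega> d = S_fun_roumieu Joint \<omega> d"
    and "S_fun_beurling Separated \<omega> d = S_fun_beurling Joint \<omega> d"
proof -
  have SJ: "fun_weight Separated \<omega> d l \<alpha> \<beta> \<le> 1 * fun_weight Joint \<omega> d l \<alpha> \<beta>" if "l > 0" for l \<alpha> \<beta>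
    using conj_weight_mult_le[OF assms that] by (simp add: W_eq_conj_weight mi_order_add)
  have JS: "fun_weight Joint \<omega> d l \<alpha> \<beta> \<le> 1 * fun_weight Separated \<omega> d (2 * l) \<alpha> \<beta>" if "l > 0" for l \<alpha> \<beta>
    using conj_weight_split[OF assms that] by (simp add: W_eq_conj_weight mi_order_add)
  have JS': "fun_weight Joint \<omega> d (l / 2) \<alpha> \<beta> \<le> 1 * fun_weight Separated \<omega> d l \<alpha> \<beta>" if "l > 0" for l \<alpha> \<beta>
    using JS[of "l / 2"] that by simp
  have p: "(2::real) * l > 0" "l / 2 > 0" if "l > 0" for l using that by auto
  show "S_fun_roumieu Separated \<omega> d = S_fun_roumieu Joint \<omega> d"
    unfolding S_fun_roumieu_def
  proof (rule roumieu_cong[OF pos_fun_weight pos_fun_weight])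
    show "weights_dominated (fun_weight Separated \<omega> d) (fun_weight Joint \<omega> d)"
      unfolding weights_dominated_def using SJ zero_less_one by blast
    show "weights_dominated (fun_weight Joint \<omega> d) (fun_weight Separated \<omega> d)"
      unfolding weights_dominated_def using JS p(1) zero_less_one by blast
  qed
  show "S_fun_beurling Separated \<omega> d = S_fun_beurling Joint \<omega> d"
    unfolding S_fun_beurling_def
  proof (rule beurling_cong[OF pos_fun_weight pos_fun_weight])
    show "weights_refined (fun_weight Separated \<omega> d) (fun_weight Joint \<omega> d)"
      unfolding weights_refined_def using SJ zero_less_one by blast
    show "weights_refined (fun_weight Joint \<omega> d) (fun_weight Separated \<omega> d)"
      unfolding weights_refined_def using JS' p(2) zero_less_one by blast
  qed
qed

text \<open>Log-convexity gives \<open>M p * M q \<le> M (p + q)\<close>, and condition (i) is the reverse inequality up to a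
  change of \<open>h\<close>.\<close>

lemma seq_weight_separated_eq_joint:
  assumes M: "LC M" and i: "cond_i M"
  shows "S_seq_roumieu Separated M d = S_seq_roumieu Joint M d"
    and "S_seq_beurling Separated M d = S_seq_beurling Joint M d"
proof -
  obtain C where C: "C \<ge> 1" "\<And>p q. M (p + q) \<le> C ^ (p + q) * M p * M q"
    using i unfolding cond_i_def by blast
  have SJ: "seq_weight Separated M d h \<alpha> \<beta> \<le> 1 * seq_weight Joint M d h \<alpha> \<beta>" if "h > 0" for h \<alpha> \<beta>
    using LC_mult_le[OF M] that by (simp add: mi_order_add)
  have JS: "seq_weight Joint M d h \<alpha> \<beta> \<le> 1 * seq_weight Separated M d (h * C) \<alpha> \<beta>" if "h > 0" for h \<alpha> \<beta>
    using C(2)[of "mi_order d \<alpha>" "mi_order d \<beta>"] that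
    by (simp add: mi_order_add power_mult_distrib mult.assoc)
  have JS': "seq_weight Joint M d (h / C) \<alpha> \<beta> \<le> 1 * seq_weight Separated M d h \<alpha> \<beta>" if "h > 0" for h \<alpha> \<beta>
    using JS[of "h / C" \<alpha> \<beta>] that C(1) by simp
  have p: "h * C > 0" "h / C > 0" if "h > 0" for h using that C(1) by auto
  show "S_seq_roumieu Separated M d = S_seq_roumieu Joint M d"
    unfolding S_seq_roumieu_def
  proof (rule roumieu_cong[OF pos_seq_weight[OF M] pos_seq_weight[OF M]])
    show "weights_dominated (seq_weight Separated M d) (seq_weight Joint M d)"
      unfolding weights_dominated_def using SJ zero_less_one by blast
    show "weights_dominated (seq_weight Joint M d) (seq_weight Separated M d)"
      unfolding weights_dominated_def using JS p(1) zero_less_one by blast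
  qed
  show "S_seq_beurling Separated M d = S_seq_beurling Joint M d"
    unfolding S_seq_beurling_def
  proof (rule beurling_cong[OF pos_seq_weight[OF M] pos_seq_weight[OF M]])
    show "weights_refined (seq_weight Separated M d) (seq_weight Joint M d)"
      unfolding weights_refined_def using SJ zero_less_one by blast
    show "weights_refined (seq_weight Joint M d) (seq_weight Separated M d)"
      unfolding weights_refined_def using JS' p(2) zero_less_one by blast
  qed
qed

text \<open>Both \<open>M n\<close> and \<open>conj_weight (assoc_fun M) l n\<close> are suprema of \<open>x ^ n * exp (- u x)\<close>, with
  \<open>u = assoc_fun M\<close> and \<open>u = assoc_fun M / l\<close>.  A factor \<open>h ^ n\<close> amounts to a dilation of \<open>x\<close>.  So
  doubling, which trades a factor in front of \<open>assoc_fun M\<close> for a dilation, and its converse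
  \<open>(\<alpha>)\<close> give two estimates each.\<close>

lemma conj_weight_assoc_fun_le:
  assumes M: "LC M" and D: "D > 0" "l > 0"
    and le: "\<And>x. x \<ge> 1 \<Longrightarrow> assoc_fun M (x / D) \<le> assoc_fun M x / l + K"
  shows "conj_weight (assoc_fun M) l n \<le> exp K * (D ^ n * M n)"
proof (rule conj_weight_least)
  fix x :: real
  assume x: "x \<ge> 1"
  have "x ^ n = D ^ n * (x / D) ^ n"
    using D(1) by (simp add: power_divide)
  also have "\<dots> \<le> D ^ n * (M n * exp (assoc_fun M (x / D)))"
    using D(1) x by (intro mult_left_mono assoc_fun_upper[OF M]) auto
  also have "\<dots> \<le> D ^ n * (M n * exp (assoc_fun M x / l + K))"
    using D(1) le[OF x] LC_pos[OF M, of n] by simp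
  finally show "x ^ n \<le> exp K * (D ^ n * M n) * exp (assoc_fun M x / l)"
    by (simp add: exp_add mult_ac)
qed (use D LC_pos[OF M] in auto)

lemma le_conj_weight_assoc_fun:
  assumes M: "LC M" and \<omega>: "weight_function (assoc_fun M)" and D: "D > 0" "l > 0" and K: "K \<ge> 0"
    and le: "\<And>x. x \<ge> 1 \<Longrightarrow> assoc_fun M (D * x) / l \<le> assoc_fun M x + K"
  shows "D ^ n * M n \<le> exp K * conj_weight (assoc_fun M) l n"
proof -
  obtain x where x: "x \<ge> 1" "M n * exp (assoc_fun M x) \<le> x ^ n"
    using LC_attained[OF M] by blast
  have "(D * x) ^ n \<le> conj_weight (assoc_fun M) l n * exp (assoc_fun M (D * x) / l)"
  proof (cases "D * x \<ge> 1")
    case True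
    then show ?thesis by (rule conj_weight_upper[OF \<omega> D(2)])
  next
    case False
    then have "(D * x) ^ n \<le> 1" using D(1) x(1) by (intro power_le_one) auto
    also have "1 \<le> conj_weight (assoc_fun M) l n"
      using conj_weight_upper[OF \<omega> D(2), of 1 n] assoc_fun_eq_0[OF M, of 1] by simp
    also have "\<dots> = conj_weight (assoc_fun M) l n * exp (assoc_fun M (D * x) / l)"
      using False D(1) x(1) assoc_fun_eq_0[OF M, of "D * x"] by simp
    finally show ?thesis .
  qed
  also have "\<dots> \<le> conj_weight (assoc_fun M) l n * exp (assoc_fun M x + K)"
    using le[OF x(1)] by simp
  finally have "D ^ n * x ^ n \<le> (exp K * conj_weight (assoc_fun M) l n) * exp (assoc_fun M x)"
    by (simp add: exp_add mult_ac power_mult_distrib)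
  moreover have "D ^ n * M n * exp (assoc_fun M x) \<le> D ^ n * x ^ n"
    unfolding mult.assoc using x(2) D(1) by (intro mult_left_mono) auto
  ultimately have "(D ^ n * M n) * exp (assoc_fun M x) \<le> (exp K * conj_weight (assoc_fun M) l n) * exp (assoc_fun M x)"
    by linarith
  then show ?thesis by (rule mult_right_le_imp_le) simp
qed

lemma assoc_fun_realizes_spaces:
  assumes M: "LC M" and \<omega>: "weight_function (assoc_fun M)" and i: "cond_i M"
  shows "S_fun_roumieu Joint (assoc_fun M) d = S_seq_roumieu Joint M d"
    and "S_fun_beurling Joint (assoc_fun M) d = S_seq_beurling Joint M d"
proof -
  let ?w = "assoc_fun M"
  obtain C where C: "C \<ge> 1" "\<And>t. t \<ge> 0 \<Longrightarrow> 2 * ?w t \<le> ?w (C * t)"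
    using cond_i_imp_assoc_fun_doubling[OF M i] by blast
  have dbl: "\<exists>D>0. \<forall>t\<ge>0. A * ?w t \<le> ?w (D * t)" for A
    using doubling_iterate[where \<omega> = ?w and A = A, OF C assoc_fun_nonneg[OF M]] by (meson less_le_trans zero_less_one)
  obtain L where L: "L \<ge> 1" "\<And>t. t \<ge> 0 \<Longrightarrow> ?w (2 * t) \<le> L * (?w t + 1)"
    using \<omega> unfolding weight_function_def by blast
  have dil: "\<exists>L\<ge>1. \<forall>t\<ge>0. ?w (D * t) \<le> L * (?w t + 1)" if "D > 0" for D
    using that by (intro dilation_iterate[where \<omega> = ?w, OF L assoc_fun_mono[OF M] assoc_fun_nonneg[OF M]]) auto
  \<comment> \<open>The first two estimates serve the Roumieu case, the last two the Beurling case.\<close>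
  have 1: "\<exists>h>0. \<exists>C>0. \<forall>n. conj_weight ?w l n \<le> C * (h ^ n * M n)" if l: "l > 0" for l
  proof -
    obtain D where D: "D > 0" "\<And>t. t \<ge> 0 \<Longrightarrow> l * ?w t \<le> ?w (D * t)" using dbl by blast
    have "?w (x / D) \<le> ?w x / l + 0" if "x \<ge> 1" for x
      using D(2)[of "x / D"] D(1) that l by (simp add: field_simps)
    then show ?thesis using conj_weight_assoc_fun_le[OF M D(1) l] D(1) by (meson exp_gt_zero)
  qed
  have 2: "\<exists>l>0. \<exists>C>0. \<forall>n. h ^ n * M n \<le> C * conj_weight ?w l n" if h: "h > 0" for h
  proof -
    obtain L where L: "L \<ge> 1" "\<And>t. t \<ge> 0 \<Longrightarrow> ?w (h * t) \<le> L * (?w t + 1)" using dil[OF h] by blast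
    have "?w (h * x) / L \<le> ?w x + 1" if "x \<ge> 1" for x
      using L(2)[of x] L(1) that by (simp add: field_simps)
    then show ?thesis
      using le_conj_weight_assoc_fun[OF M \<omega> h, of L 1] L(1) by (intro exI[of _ L] conjI exI[of _ "exp 1"]) auto
  qed
  have 3: "\<exists>h>0. \<exists>C>0. \<forall>n. h ^ n * M n \<le> C * conj_weight ?w l n" if l: "l > 0" for l
  proof -
    obtain D where D: "D > 0" "\<And>t. t \<ge> 0 \<Longrightarrow> 1 / l * ?w t \<le> ?w (D * t)" using dbl by blast
    have "?w (1 / D * x) / l \<le> ?w x + 0" if "x \<ge> 1" for x
      using D(2)[of "1 / D * x"] D(1) that by simp
    then show ?thesis
      using le_conj_weight_assoc_fun[OF M \<omega> _ l, of "1 / D" 0] D(1)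
      by (intro exI[of _ "1 / D"] conjI exI[of _ "exp 0"]) auto
  qed
  have 4: "\<exists>l>0. \<exists>C>0. \<forall>n. conj_weight ?w l n \<le> C * (h ^ n * M n)" if h: "h > 0" for h
  proof -
    obtain L where L: "L \<ge> 1" "\<And>t. t \<ge> 0 \<Longrightarrow> ?w (1 / h * t) \<le> L * (?w t + 1)" using dil[of "1 / h"] h by auto
    have "?w (x / h) \<le> ?w x / (1 / L) + L" if "x \<ge> 1" for x
      using L(2)[of x] that by (simp add: algebra_simps)
    then show ?thesis
      using conj_weight_assoc_fun_le[OF M h, of "1 / L" L] L(1)
      by (intro exI[of _ "1 / L"] conjI exI[of _ "exp L"]) auto
  qed
  have eq: "fun_weight Joint ?w d l \<alpha> \<beta> = conj_weight ?w l (mi_order d (mi_add \<alpha> \<beta>))"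
    "seq_weight Joint M d h \<alpha> \<beta> = h ^ mi_order d (mi_add \<alpha> \<beta>) * M (mi_order d (mi_add \<alpha> \<beta>))" for l h \<alpha> \<beta>
    by (auto simp: W_eq_conj_weight)
  show "S_fun_roumieu Joint ?w d = S_seq_roumieu Joint M d"
    unfolding S_fun_roumieu_def S_seq_roumieu_def
  proof (rule roumieu_cong[OF pos_fun_weight pos_seq_weight[OF M]])
    show "weights_dominated (fun_weight Joint ?w d) (seq_weight Joint M d)"
      unfolding weights_dominated_def eq using 1 by meson
    show "weights_dominated (seq_weight Joint M d) (fun_weight Joint ?w d)"
      unfolding weights_dominated_def eq using 2 by meson
  qed
  show "S_fun_beurling Joint ?w d = S_seq_beurling Joint M d"
    unfolding S_fun_beurling_def S_seq_beurling_def
  proof (rule beurling_cong[OF pos_fun_weight pos_seq_weight[OF M]])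
    show "weights_refined (fun_weight Joint ?w d) (seq_weight Joint M d)"
      unfolding weights_refined_def eq using 4 by meson
    show "weights_refined (seq_weight Joint M d) (fun_weight Joint ?w d)"
      unfolding weights_refined_def eq using 3 by meson
  qed
qed

lemma weight_doubling_assoc_fun:
  assumes "LC M" "cond_i M"
  shows "weight_doubling (assoc_fun M)"
proof -
  obtain C where "C \<ge> 1" "\<And>t. t \<ge> 0 \<Longrightarrow> 2 * assoc_fun M t \<le> assoc_fun M (C * t)"
    using cond_i_imp_assoc_fun_doubling[OF assms] by blast
  then show ?thesis
    unfolding weight_doubling_def by (intro exI[of _ C]) (auto intro: add_increasing2)
qed


section \<open>Translated Gaussians\<close>

text \<open>The derivatives of \<open>exp (- y\<^sup>2 / 2)\<close>, by the recurrence of the Hermite polynomials.\<close>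

fun gauss_deriv :: "nat \<Rightarrow> real \<Rightarrow> real" where
  "gauss_deriv 0 y = exp (- y\<^sup>2 / 2)"
| "gauss_deriv (Suc 0) y = - y * exp (- y\<^sup>2 / 2)"
| "gauss_deriv (Suc (Suc n)) y = - y * gauss_deriv (Suc n) y - real (Suc n) * gauss_deriv n y"

lemma gauss_deriv_has_derivative:
  "(gauss_deriv n has_real_derivative gauss_deriv (Suc n) y) (at y)"
proof (induction n y rule: gauss_deriv.induct)
  case (1 y)
  have "gauss_deriv 0 = (\<lambda>y. exp (- y\<^sup>2 / 2))" by auto
  then show ?case by (auto intro!: derivative_eq_intros)
next
  case (2 y)
  have "gauss_deriv (Suc 0) = (\<lambda>y. - y * exp (- y\<^sup>2 / 2))" by auto
  then show ?case by (auto intro!: derivative_eq_intros simp: algebra_simps power2_eq_square)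
next
  case (3 n y)
  have "gauss_deriv (Suc (Suc n)) = (\<lambda>y. - y * gauss_deriv (Suc n) y - real (Suc n) * gauss_deriv n y)"
    by auto
  moreover have "((\<lambda>y. - y * gauss_deriv (Suc n) y - real (Suc n) * gauss_deriv n y) has_real_derivative
      gauss_deriv (Suc (Suc (Suc n))) y) (at y)"
    by (rule derivative_eq_intros 3 refl)+ (simp add: algebra_simps)
  ultimately show ?case by simp
qed

lemma gauss_deriv_continuous: "continuous_on S (gauss_deriv n)"
  by (meson DERIV_continuous continuous_at_imp_continuous_on gauss_deriv_has_derivative)

text \<open>The bound is shaped so that the recurrence reproduces it: with \<open>v = \<bar>y\<bar> + sqrt (n + 2)\<close> one has
  \<open>\<bar>y\<bar> * v + (n + 1) \<le> v\<^sup>2\<close>.\<close>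

lemma abs_gauss_deriv_le:
  "\<bar>gauss_deriv n y\<bar> \<le> (\<bar>y\<bar> + sqrt (real n)) ^ n * exp (- y\<^sup>2 / 2)"
proof (induction n y rule: gauss_deriv.induct)
  case (3 n y)
  let ?u = "\<bar>y\<bar>" and ?e = "exp (- y\<^sup>2 / 2)"
  define v where "v = ?u + sqrt (real (Suc (Suc n)))"
  have v: "?u + sqrt (real n) \<le> v" "?u + sqrt (real (Suc n)) \<le> v" "0 \<le> v"
    by (auto simp: v_def)
  have "\<bar>gauss_deriv (Suc (Suc n)) y\<bar> \<le> ?u * \<bar>gauss_deriv (Suc n) y\<bar> + real (Suc n) * \<bar>gauss_deriv n y\<bar>"
    unfolding gauss_deriv.simps
    by (rule order_trans[OF abs_triangle_ineq4]) (simp add: abs_mult)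
  also have "\<dots> \<le> ?u * ((?u + sqrt (real (Suc n))) ^ Suc n * ?e) +
      real (Suc n) * ((?u + sqrt (real n)) ^ n * ?e)"
    using 3 by (intro add_mono mult_left_mono) auto
  also have "\<dots> \<le> ?u * ((v * v ^ n) * ?e) + real (Suc n) * (v ^ n * ?e)"
    using v power_mono[OF v(2), of "Suc n"] power_mono[OF v(1), of n]
    by (intro add_mono mult_left_mono mult_right_mono) auto
  also have "\<dots> = (?u * v + real (Suc n)) * (v ^ n * ?e)"
    by (simp add: algebra_simps)
  also have "\<dots> \<le> (v * v) * (v ^ n * ?e)"
  proof (rule mult_right_mono)
    have "v * v = ?u * v + sqrt (real (Suc (Suc n))) * v"
      by (simp add: v_def algebra_simps)
    moreover have "sqrt (real (Suc (Suc n))) * v \<ge> sqrt (real (Suc (Suc n))) * sqrt (real (Suc (Suc n)))"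
      by (intro mult_left_mono) (auto simp: v_def)
    ultimately show "?u * v + real (Suc n) \<le> v * v" by simp
  qed (use v in auto)
  finally show ?case by (simp add: v_def mult.assoc)
qed (auto simp: abs_mult)

lemma power_add_le_two_power:
  fixes u v :: real
  assumes "u \<ge> 0" "v \<ge> 0"
  shows "(u + v) ^ n \<le> 2 ^ n * (u ^ n + v ^ n)"
proof -
  have "(u + v) ^ n \<le> (2 * max u v) ^ n"
    using assms by (intro power_mono) auto
  also have "\<dots> = 2 ^ n * max u v ^ n" by (simp add: power_mult_distrib)
  also have "\<dots> \<le> 2 ^ n * (u ^ n + v ^ n)"
    using assms by (intro mult_left_mono) (auto simp: max_def)
  finally show ?thesis .
qed

lemma power_mult_gauss_deriv_le:
  "\<bar>y\<bar> ^ a * \<bar>gauss_deriv b y\<bar> \<le> 2 ^ Suc b * sqrt (real (a + b)) ^ (a + b)"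
proof -
  let ?u = "\<bar>y\<bar>" and ?r = "sqrt (real (a + b))"
  have pe: "?u ^ k * exp (- y\<^sup>2 / 2) \<le> ?r ^ k" if "k \<le> a + b" for k
  proof -
    have "?u ^ k * exp (- y\<^sup>2 / 2) \<le> (sqrt (real k) ^ k * exp (y\<^sup>2 / 2)) * exp (- y\<^sup>2 / 2)"
      using power_le_sqrt_power_exp[of ?u k] by (intro mult_right_mono) auto
    also have "\<dots> = sqrt (real k) ^ k" by (simp add: mult.assoc exp_add[symmetric])
    also have "\<dots> \<le> ?r ^ k" using that by (intro power_mono) auto
    finally show ?thesis .
  qed
  have "?u ^ a * \<bar>gauss_deriv b y\<bar> \<le> ?u ^ a * ((?u + sqrt (real b)) ^ b * exp (- y\<^sup>2 / 2))"
    by (intro mult_left_mono abs_gauss_deriv_le) auto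
  also have "\<dots> \<le> ?u ^ a * ((2 ^ b * (?u ^ b + ?r ^ b)) * exp (- y\<^sup>2 / 2))"
  proof (intro mult_left_mono mult_right_mono)
    have "(?u + sqrt (real b)) ^ b \<le> (?u + ?r) ^ b" by (intro power_mono) auto
    also have "\<dots> \<le> 2 ^ b * (?u ^ b + ?r ^ b)" by (rule power_add_le_two_power) auto
    finally show "(?u + sqrt (real b)) ^ b \<le> 2 ^ b * (?u ^ b + ?r ^ b)" .
  qed auto
  also have "\<dots> = 2 ^ b * (?u ^ (a + b) * exp (- y\<^sup>2 / 2) + (?u ^ a * exp (- y\<^sup>2 / 2)) * ?r ^ b)"
    by (simp add: power_add algebra_simps)
  also have "\<dots> \<le> 2 ^ b * (?r ^ (a + b) + ?r ^ a * ?r ^ b)"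
    by (intro mult_left_mono add_mono mult_right_mono pe) auto
  also have "\<dots> = 2 ^ Suc b * ?r ^ (a + b)" by (simp add: power_add)
  finally show ?thesis .
qed

text \<open>Here \<open>x = (x - s) + s\<close>, so that up to powers of \<open>2\<close> the factor \<open>\<bar>x\<bar> ^ a\<close> is either \<open>\<bar>x - s\<bar> ^ a\<close>, which the
  Gaussian absorbs, or \<open>s ^ a\<close>.\<close>

lemma power_mult_shifted_gauss_deriv_le:
  assumes "s \<ge> 0"
  shows "\<bar>x\<bar> ^ a * \<bar>gauss_deriv b (x - s)\<bar> \<le>
    2 ^ Suc (a + b) * (s ^ a * sqrt (real b) ^ b + sqrt (real (a + b)) ^ (a + b))"
proof -
  let ?y = "x - s"
  have "\<bar>x\<bar> ^ a \<le> (\<bar>?y\<bar> + s) ^ a"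
    using assms by (intro power_mono) auto
  also have "\<dots> \<le> 2 ^ a * (\<bar>?y\<bar> ^ a + s ^ a)"
    using assms by (intro power_add_le_two_power) auto
  finally have "\<bar>x\<bar> ^ a * \<bar>gauss_deriv b ?y\<bar> \<le> 2 ^ a * (\<bar>?y\<bar> ^ a + s ^ a) * \<bar>gauss_deriv b ?y\<bar>"
    by (intro mult_right_mono) auto
  also have "\<dots> = 2 ^ a * (\<bar>?y\<bar> ^ a * \<bar>gauss_deriv b ?y\<bar> + s ^ a * (\<bar>?y\<bar> ^ 0 * \<bar>gauss_deriv b ?y\<bar>))"
    by (simp add: algebra_simps)
  also have "\<dots> \<le> 2 ^ a * (2 ^ Suc b * sqrt (real (a + b)) ^ (a + b) +
      s ^ a * (2 ^ Suc b * sqrt (real (0 + b)) ^ (0 + b)))"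
    using assms by (intro mult_left_mono add_mono power_mult_gauss_deriv_le) auto
  also have "\<dots> = 2 ^ Suc (a + b) * (s ^ a * sqrt (real b) ^ b + sqrt (real (a + b)) ^ (a + b))"
    by (simp add: power_add algebra_simps)
  finally show ?thesis .
qed

definition shifted_gauss :: "nat \<Rightarrow> real \<Rightarrow> (nat \<Rightarrow> real) \<Rightarrow> complex" where
  "shifted_gauss n s x = (if x \<in> Rd 1 then of_real (gauss_deriv n (x 0 - s)) else 0)"

lemma shifted_gauss_slice:
  assumes "x \<in> Rd 1"
  shows "((\<lambda>t. shifted_gauss n s (x(0 := t))) has_vector_derivative
    of_real (gauss_deriv (Suc n) (x 0 - s))) (at (x 0))"
proof -
  have "(gauss_deriv n has_real_derivative gauss_deriv (Suc n) (x 0 - s)) (at (x 0 - s))"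
    by (rule gauss_deriv_has_derivative)
  then have "((\<lambda>t. gauss_deriv n (t - s)) has_real_derivative gauss_deriv (Suc n) (x 0 - s)) (at (x 0))"
    using DERIV_shift[of "gauss_deriv n" _ "x 0" "- s"] by simp
  then have "((\<lambda>t. complex_of_real (gauss_deriv n (t - s))) has_vector_derivative
      of_real (gauss_deriv (Suc n) (x 0 - s))) (at (x 0))"
    by (intro has_vector_derivative_of_real) (simp add: has_real_derivative_iff_has_vector_derivative)
  moreover have "(\<lambda>t. shifted_gauss n s (x(0 := t))) = (\<lambda>t. of_real (gauss_deriv n (t - s)))"
    using mem_Rd_upd[OF assms, of 0] by (auto simp: shifted_gauss_def)
  ultimately show ?thesis by simp
qed

lemma partial_shifted_gauss: "partial 0 (shifted_gauss n s) = shifted_gauss (Suc n) s"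
proof
  fix x
  show "partial 0 (shifted_gauss n s) x = shifted_gauss (Suc n) s x"
  proof (cases "x \<in> Rd 1")
    case True
    then show ?thesis
      using vector_derivative_at[OF shifted_gauss_slice[OF True, of n s]]
      by (simp add: partial_def shifted_gauss_def)
  next
    case False
    then have "(\<lambda>t. shifted_gauss n s (x(0 := t))) = (\<lambda>t. 0)"
      using notin_Rd_upd[of x 1 0] by (auto simp: shifted_gauss_def)
    then show ?thesis using False by (simp add: partial_def shifted_gauss_def)
  qed
qed

lemma iterated_partial_shifted_gauss:
  "set is \<subseteq> {..<1} \<Longrightarrow> foldr partial is (shifted_gauss 0 s) = shifted_gauss (length is) s"
  by (induction "is") (auto simp: partial_shifted_gauss)

lemma shifted_gauss_smooth: "shifted_gauss 0 s \<in> smooth_functions 1"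
  unfolding smooth_functions_def
proof (intro CollectI conjI allI impI ballI)
  fix x assume "x \<notin> Rd 1"
  then show "shifted_gauss 0 s x = 0" by (simp add: shifted_gauss_def)
next
  fix "is" :: "nat list" assume is1: "set is \<subseteq> {..<1}"
  have "continuous_on (Rd 1) (\<lambda>x. complex_of_real (gauss_deriv (length is) (x 0 - s)))"
    by (intro continuous_on_of_real continuous_on_compose2[OF gauss_deriv_continuous[of UNIV]]
        continuous_on_diff continuous_on_const
        continuous_on_subset[OF continuous_on_product_coordinates]) auto
  then show "continuous_on (Rd 1) (foldr partial is (shifted_gauss 0 s))"
    unfolding iterated_partial_shifted_gauss[OF is1]
    by (rule continuous_on_eq) (simp add: shifted_gauss_def)
  fix x i assume "x \<in> Rd 1" "i < (1::nat)"
  then show "(\<lambda>t. foldr partial is (shifted_gauss 0 s) (x(i := t))) differentiable at (x i)"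
    unfolding iterated_partial_shifted_gauss[OF is1]
    using differentiableI_vector[OF shifted_gauss_slice] by auto
qed

lemma mderiv_1: "mderiv 1 \<beta> f = (partial 0 ^^ \<beta> 0) f"
  by simp

lemma monomial_1: "monomial 1 \<alpha> x = x 0 ^ \<alpha> 0"
  by (simp add: monomial_def)

lemma mi_order_1: "mi_order (Suc 0) \<alpha> = \<alpha> 0"
  by (simp add: mi_order_def)

lemma mderiv_shifted_gauss: "mderiv 1 \<beta> (shifted_gauss 0 s) = shifted_gauss (\<beta> 0) s"
proof -
  have "(partial 0 ^^ n) (shifted_gauss 0 s) = shifted_gauss n s" for n
    by (induction n) (auto simp: partial_shifted_gauss)
  then show ?thesis by simp
qed

lemma shifted_gauss_in_step:
  assumes w: "pos_weight w" and C: "C \<ge> 0" and s: "s \<ge> 0"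
    and le: "\<And>\<alpha> \<beta>. 2 ^ (\<alpha> 0 + \<beta> 0) * (s ^ \<alpha> 0 * sqrt (real (\<beta> 0)) ^ \<beta> 0) \<le> C * w \<alpha> \<beta>"
      "\<And>\<alpha> \<beta>. 2 ^ (\<alpha> 0 + \<beta> 0) * sqrt (real (\<alpha> 0 + \<beta> 0)) ^ (\<alpha> 0 + \<beta> 0) \<le> C * w \<alpha> \<beta>"
  shows "shifted_gauss 0 s \<in> step_space 1 w" "step_norm 1 w (shifted_gauss 0 s) \<le> 4 * C"
proof -
  have b: "\<bar>monomial 1 \<alpha> x\<bar> * cmod (mderiv 1 \<beta> (shifted_gauss 0 s) x) \<le> 4 * C * w \<alpha> \<beta>"
    if x: "x \<in> Rd 1" for \<alpha> \<beta> x
  proof -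
    have "\<bar>monomial 1 \<alpha> x\<bar> * cmod (mderiv 1 \<beta> (shifted_gauss 0 s) x) =
        \<bar>x 0\<bar> ^ \<alpha> 0 * \<bar>gauss_deriv (\<beta> 0) (x 0 - s)\<bar>"
      unfolding mderiv_shifted_gauss monomial_1 using x by (simp add: shifted_gauss_def power_abs)
    also have "\<dots> \<le> 2 ^ Suc (\<alpha> 0 + \<beta> 0) * (s ^ \<alpha> 0 * sqrt (real (\<beta> 0)) ^ \<beta> 0 +
        sqrt (real (\<alpha> 0 + \<beta> 0)) ^ (\<alpha> 0 + \<beta> 0))"
      by (rule power_mult_shifted_gauss_deriv_le[OF s])
    also have "\<dots> \<le> 4 * C * w \<alpha> \<beta>"
      using le(1)[of \<alpha> \<beta>] le(2)[of \<alpha> \<beta>] by (simp add: distrib_left)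
    finally show ?thesis .
  qed
  show "shifted_gauss 0 s \<in> step_space 1 w" "step_norm 1 w (shifted_gauss 0 s) \<le> 4 * C"
    using C by (intro step_spaceI[OF w _ shifted_gauss_smooth b]; simp)+
qed

text \<open>Condition (a) with \<open>p = b\<close> and \<open>q = a\<close> absorbs \<open>sqrt b ^ b\<close> in passing from \<open>M a\<close> to \<open>M (a + b)\<close>, and
  \<open>s ^ a\<close> is bounded by \<open>M a\<close> through the associated function.  The lower bound on \<open>h\<close> can be met for
  large \<open>h\<close> in the Roumieu case, and for all \<open>h\<close> in the Beurling case, where \<open>C\<close> is at choice.\<close>

lemma shifted_gauss_seq_norm:
  assumes M: "LC M" and BCH: "B > 0" "C > 0" "H > 0"
    and a: "\<And>p q. sqrt (real p) ^ p * M q \<le> B * C ^ p * H ^ (p + q) * M (p + q)"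
    and h: "h \<ge> 2 * H * C" and s: "s \<ge> 0"
  shows "shifted_gauss 0 s \<in> step_space 1 (seq_weight Joint M 1 h)"
    "step_norm 1 (seq_weight Joint M 1 h) (shifted_gauss 0 s) \<le> 4 * (B * exp (assoc_fun M (2 * H / h * s)))"
proof -
  have pos: "\<And>k. M k > 0" using LC_pos[OF M] .
  have "0 < 2 * H * C" using BCH by simp
  then have h0: "h > 0" using h by linarith
  define E where "E = exp (assoc_fun M (2 * H / h * s))"
  have E1: "E \<ge> 1" using assoc_fun_nonneg[OF M, of "2 * H / h * s"] BCH h0 s by (simp add: E_def)
  have 1: "2 ^ (p + q) * (s ^ p * sqrt (real q) ^ q) \<le> (B * E) * (h ^ (p + q) * M (p + q))" for p q
  proof -
    have up: "(2 * s) ^ p * H ^ p \<le> h ^ p * (M p * E)"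
      using assoc_fun_upper[OF M, of "2 * H / h * s" p] BCH(3) h0 s
      by (simp add: E_def power_mult_distrib power_divide field_simps)
    have "H ^ p * (2 ^ (p + q) * (s ^ p * sqrt (real q) ^ q)) = ((2 * s) ^ p * H ^ p) * (2 * sqrt (real q)) ^ q"
      by (simp add: power_mult_distrib power_add)
    also have "\<dots> \<le> (h ^ p * (M p * E)) * (2 * sqrt (real q)) ^ q"
      using up by (intro mult_right_mono) auto
    also have "\<dots> = h ^ p * E * 2 ^ q * (sqrt (real q) ^ q * M p)"
      by (simp add: power_mult_distrib)
    also have "\<dots> \<le> h ^ p * E * 2 ^ q * (B * C ^ q * H ^ (q + p) * M (q + p))"
      using h0 E1 by (intro mult_left_mono a) auto
    also have "\<dots> = H ^ p * ((2 * H * C) ^ q * (B * E * h ^ p * M (p + q)))"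
      by (simp add: power_mult_distrib power_add add.commute)
    also have "\<dots> \<le> H ^ p * (h ^ q * (B * E * h ^ p * M (p + q)))"
      using h h0 BCH E1 pos[of "p + q"] by (intro mult_left_mono mult_right_mono power_mono) auto
    also have "\<dots> = H ^ p * ((B * E) * (h ^ (p + q) * M (p + q)))"
      by (simp add: power_add)
    finally show ?thesis using BCH(3) by (simp only: mult_le_cancel_left) simp
  qed
  have 2: "2 ^ n * sqrt (real n) ^ n \<le> (B * E) * (h ^ n * M n)" for n
  proof -
    have "2 ^ n * sqrt (real n) ^ n \<le> 2 ^ n * (B * C ^ n * H ^ n * M n)"
      using a[of n 0] LC_0[OF M] by simp
    also have "\<dots> = (2 * H * C) ^ n * (B * 1 * M n)"
      by (simp add: power_mult_distrib)
    also have "\<dots> \<le> h ^ n * (B * E * M n)"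
      using h h0 BCH E1 pos[of n] by (intro mult_mono power_mono) auto
    finally show ?thesis by (simp add: mult_ac)
  qed
  have le: "2 ^ (\<alpha> 0 + \<beta> 0) * (s ^ \<alpha> 0 * sqrt (real (\<beta> 0)) ^ \<beta> 0) \<le> (B * E) * seq_weight Joint M 1 h \<alpha> \<beta>"
      "2 ^ (\<alpha> 0 + \<beta> 0) * sqrt (real (\<alpha> 0 + \<beta> 0)) ^ (\<alpha> 0 + \<beta> 0) \<le> (B * E) * seq_weight Joint M 1 h \<alpha> \<beta>"
    for \<alpha> \<beta>
    using 1 2 by (simp_all add: mi_order_add mi_order_1 del: of_nat_add)
  have BE: "B * E \<ge> 0" using BCH E1 by simp
  note res = shifted_gauss_in_step[OF pos_seq_weight[OF M h0] BE s le]
  show "shifted_gauss 0 s \<in> step_space 1 (seq_weight Joint M 1 h)" by (rule res(1))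
  show "step_norm 1 (seq_weight Joint M 1 h) (shifted_gauss 0 s) \<le> 4 * (B * exp (assoc_fun M (2 * H / h * s)))"
    using res(2) by (simp only: E_def)
qed

text \<open>Superadditivity of the Young conjugate plays the part that condition (a) has for sequences.  The
  factor \<open>exp (\<omega> 1 / l)\<close> covers \<open>2 * s < 1\<close>, since the weights are suprema over \<open>x \<ge> 1\<close> only.\<close>

lemma shifted_gauss_fun_norm:
  assumes \<omega>: "weight_function \<omega>" and l: "l > 0"
    and A: "A \<ge> 1" "\<And>b. 2 ^ b * sqrt (real b) ^ b \<le> A * conj_weight \<omega> l b" and s: "s \<ge> 0"
  shows "shifted_gauss 0 s \<in> step_space 1 (fun_weight Joint \<omega> 1 l)"
    "step_norm 1 (fun_weight Joint \<omega> 1 l) (shifted_gauss 0 s) \<le> 4 * (A * exp (\<omega> 1 / l) * exp (\<omega> (2 * s) / l))"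
proof -
  let ?W = "conj_weight \<omega> l"
  define E where "E = exp (\<omega> 1 / l) * exp (\<omega> (2 * s) / l)"
  have e: "exp (\<omega> 1 / l) \<ge> 1" "exp (\<omega> (2 * s) / l) \<ge> 1"
    using weight_function_nonneg[OF \<omega>] l s by auto
  have E: "E \<ge> exp (\<omega> 1 / l)" "E \<ge> exp (\<omega> (2 * s) / l)"
    unfolding E_def using mult_left_mono[OF e(2), of "exp (\<omega> 1 / l)"]
      mult_right_mono[OF e(1), of "exp (\<omega> (2 * s) / l)"] by simp_all
  then have E: "E \<ge> exp (\<omega> 1 / l)" "E \<ge> exp (\<omega> (2 * s) / l)" "E \<ge> 1" using e by linarith+
  have up: "(2 * s) ^ p \<le> ?W p * E" for p
  proof (cases "2 * s \<ge> 1")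
    case True
    then show ?thesis
      using conj_weight_upper[OF \<omega> l True, of p] mult_left_mono[OF E(2), of "?W p"]
        conj_weight_pos[of \<omega> l p] by linarith
  next
    case False
    then have "(2 * s) ^ p \<le> 1 ^ p" using s by (intro power_mono) auto
    also have "\<dots> \<le> ?W p * exp (\<omega> 1 / l)" by (rule conj_weight_upper[OF \<omega> l]) simp
    also have "\<dots> \<le> ?W p * E" using E(1) by simp
    finally show ?thesis .
  qed
  have 1: "2 ^ (p + q) * (s ^ p * sqrt (real q) ^ q) \<le> (A * E) * ?W (p + q)" for p q
  proof -
    have "2 ^ (p + q) * (s ^ p * sqrt (real q) ^ q) = (2 * s) ^ p * (2 ^ q * sqrt (real q) ^ q)"
      by (simp add: power_mult_distrib power_add)
    also have "\<dots> \<le> (?W p * E) * (A * ?W q)"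
      using s E(3) by (intro mult_mono up A(2)) (auto simp: less_imp_le)
    also have "\<dots> = (A * E) * (?W p * ?W q)" by simp
    also have "\<dots> \<le> (A * E) * ?W (p + q)"
      using A(1) E(3) by (intro mult_left_mono conj_weight_mult_le[OF \<omega> l]) auto
    finally show ?thesis .
  qed
  have 2: "2 ^ n * sqrt (real n) ^ n \<le> (A * E) * ?W n" for n
  proof -
    have "A * 1 * ?W n \<le> A * E * ?W n"
      using A(1) E(3) by (intro mult_right_mono mult_left_mono) (auto simp: less_imp_le)
    then show ?thesis using A(2)[of n] by simp
  qed
  have le: "2 ^ (\<alpha> 0 + \<beta> 0) * (s ^ \<alpha> 0 * sqrt (real (\<beta> 0)) ^ \<beta> 0) \<le> (A * E) * fun_weight Joint \<omega> 1 l \<alpha> \<beta>"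
      "2 ^ (\<alpha> 0 + \<beta> 0) * sqrt (real (\<alpha> 0 + \<beta> 0)) ^ (\<alpha> 0 + \<beta> 0) \<le> (A * E) * fun_weight Joint \<omega> 1 l \<alpha> \<beta>"
    for \<alpha> \<beta>
    using 1 2 by (simp_all add: W_eq_conj_weight mi_order_add mi_order_1 del: of_nat_add)
  have AE: "A * E \<ge> 0" using A(1) E(3) by simp
  note res = shifted_gauss_in_step[OF pos_fun_weight AE s le]
  show "shifted_gauss 0 s \<in> step_space 1 (fun_weight Joint \<omega> 1 l)" by (rule res(1))
  show "step_norm 1 (fun_weight Joint \<omega> 1 l) (shifted_gauss 0 s) \<le> 4 * (A * exp (\<omega> 1 / l) * exp (\<omega> (2 * s) / l))"
    using res(2) by (simp only: E_def mult.assoc)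
qed

definition axis_point :: "real \<Rightarrow> nat \<Rightarrow> real" where
  "axis_point s = (\<lambda>i. if i = 0 then s else 0)"

lemma shifted_gauss_axis_point: "shifted_gauss 0 s (axis_point s) = 1"
  by (simp add: shifted_gauss_def axis_point_def Rd_def)

lemma eval_le_step_norm:
  assumes "pos_weight w" "f \<in> step_space 1 w" "s \<ge> 0"
  shows "s ^ n * cmod (f (axis_point s)) \<le> step_norm 1 w f * w (\<lambda>i. if i = 0 then n else 0) (\<lambda>i. 0)"
proof -
  have "axis_point s \<in> Rd 1" by (simp add: Rd_def axis_point_def)
  then show ?thesis
    using step_norm_bound[OF assms(1,2), of "\<lambda>i. if i = 0 then n else 0" "\<lambda>i. 0" "axis_point s"] assms(3)
    unfolding mderiv_1 monomial_1 by (simp add: multi_indices_def axis_point_def)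
qed

text \<open>A function in a step decays at infinity: the bounds \<open>s ^ n * \<bar>f s\<bar> \<le> N * h ^ n * M n\<close> for all \<open>n\<close>
  together say that \<open>\<bar>f s\<bar> \<le> N * exp (- assoc_fun M (s / h))\<close>.\<close>

lemma eval_seq_bound:
  assumes M: "LC M" and h: "h > 0" and f: "f \<in> step_space 1 (seq_weight Joint M 1 h)" and s: "s \<ge> 0"
  shows "cmod (f (axis_point s)) * exp (assoc_fun M (s / h)) \<le> step_norm 1 (seq_weight Joint M 1 h) f"
proof (cases "f (axis_point s) = 0")
  case True
  then show ?thesis by (simp add: step_norm_nonneg)
next
  case False
  define c where "c = cmod (f (axis_point s))"
  define N where "N = step_norm 1 (seq_weight Joint M 1 h) f"
  have c: "c > 0" using False by (simp add: c_def)
  have le: "s ^ n * c \<le> N * (h ^ n * M n)" for n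
    using eval_le_step_norm[OF pos_seq_weight[OF M h] f s, of n]
    by (simp add: c_def N_def mi_order_add mi_order_1)
  have N: "N > 0" using le[of 0] c LC_0[OF M] by simp
  have "(s / h) ^ n \<le> M n * exp (ln (N / c))" for n
    using le[of n] c N h by (simp add: power_divide field_simps)
  then have "assoc_fun M (s / h) \<le> ln (N / c)"
    using s h by (simp add: assoc_fun_le_iff[OF M])
  then have "exp (assoc_fun M (s / h)) \<le> N / c"
    using c N by (metis divide_pos_pos exp_le_cancel_iff exp_ln)
  then have "c * exp (assoc_fun M (s / h)) \<le> N" using c by (simp add: field_simps)
  then show ?thesis by (simp only: c_def N_def)
qed

text \<open>For weight functions the optimal exponent \<open>n\<close> is the one at which biconjugation recovers \<open>\<omega>\<close>; the
  rounding of exponents to integers is the reason for the denominator.\<close>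

lemma eval_fun_bound:
  assumes \<omega>: "weight_function \<omega>" and l: "l > 0" and f: "f \<in> step_space 1 (fun_weight Joint \<omega> 1 l)" and s: "s \<ge> 0"
  shows "cmod (f (axis_point s)) * (exp (\<omega> s / l) / max 1 s) \<le> step_norm 1 (fun_weight Joint \<omega> 1 l) f"
proof -
  define c where "c = cmod (f (axis_point s))"
  define N where "N = step_norm 1 (fun_weight Joint \<omega> 1 l) f"
  have c: "c \<ge> 0" by (simp add: c_def)
  have N: "N \<ge> 0" by (simp add: N_def step_norm_nonneg)
  have le: "s ^ n * c \<le> N * conj_weight \<omega> l n" for n
    using eval_le_step_norm[OF pos_fun_weight f s, of n]
    by (simp add: c_def N_def W_eq_conj_weight mi_order_add mi_order_1)
  have "c * exp (\<omega> s / l) \<le> N * max 1 s"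
  proof (cases "s \<ge> 1")
    case True
    obtain n where n: "conj_weight \<omega> l n * exp (\<omega> s / l) \<le> s ^ Suc n"
      using conj_weight_touch[OF \<omega> l True] by blast
    have "s ^ n * (c * exp (\<omega> s / l)) \<le> N * (conj_weight \<omega> l n * exp (\<omega> s / l))"
      using mult_right_mono[OF le[of n], of "exp (\<omega> s / l)"] by (simp add: mult.assoc)
    also have "\<dots> \<le> N * s ^ Suc n" using n N by (rule mult_left_mono)
    also have "\<dots> = s ^ n * (N * s)" by simp
    finally show ?thesis using True by (simp add: mult_le_cancel_left)
  next
    case False
    have "conj_weight \<omega> l 0 \<le> exp (- \<omega> 1 / l)"
    proof (rule conj_weight_least[OF l])
      fix x :: real assume "x \<ge> 1"
      then have "\<omega> 1 / l \<le> \<omega> x / l"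
        using weight_function_mono[OF \<omega>, of 1 x] l by (intro divide_right_mono) auto
      then show "x ^ 0 \<le> exp (- \<omega> 1 / l) * exp (\<omega> x / l)"
        by (simp add: exp_add[symmetric])
    qed simp
    then have "c \<le> N * exp (- \<omega> 1 / l)"
      using le[of 0] mult_left_mono[OF _ N] by fastforce
    then have "c * exp (\<omega> s / l) \<le> (N * exp (- \<omega> 1 / l)) * exp (\<omega> 1 / l)"
      using weight_function_mono[OF \<omega> s, of 1] False l N by (intro mult_mono) (auto intro: divide_right_mono)
    also have "\<dots> = N" by (simp add: mult.assoc exp_add[symmetric])
    finally show ?thesis using False by simp
  qed
  then have "c * (exp (\<omega> s / l) / max 1 s) \<le> N" using s by (simp add: pos_divide_le_eq)
  then show ?thesis by (simp only: c_def N_def)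
qed


section \<open>From equal topologies to comparable weight functions\<close>

lemma open_unit_ball_transfer:
  assumes E: "\<And>f c. f \<in> E \<Longrightarrow> (\<lambda>x. c * f x) \<in> E" "(\<lambda>x. 0) \<in> E"
    and top: "seminorm_topology E P = seminorm_topology E Q"
    and P: "\<And>p. p \<in> P \<Longrightarrow> seminorm_on E p" and Q: "\<And>q. q \<in> Q \<Longrightarrow> seminorm_on E q" and p: "p \<in> P"
  shows "\<exists>F K. finite F \<and> F \<subseteq> Q \<and> K > 0 \<and> (\<forall>f\<in>E. p f \<le> K * (\<Sum>q\<in>F. q f))"
proof (rule open_seminorm_ball_imp_bounded[OF E Q P[OF p]])
  have "openin (seminorm_topology E P) {g \<in> E. p (\<lambda>x. g x - 0) < 1}"
    using p E(2) by (rule openin_seminorm_ball) simp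
  then show "openin (seminorm_topology E Q) {g \<in> E. p g < 1}" by (simp add: top)
qed

text \<open>The comparison of two families of steps needs only two properties: point evaluations bound the
  norms of one family from below, and the norms of Gaussians in the other are bounded from above.\<close>

definition eval_bound :: "(real \<Rightarrow> mi_weight) \<Rightarrow> (real \<Rightarrow> real \<Rightarrow> real) \<Rightarrow> bool" where
  "eval_bound v e \<longleftrightarrow> (\<forall>l>0. \<forall>s\<ge>0. e l s > 0 \<and>
     (\<forall>f\<in>step_space 1 (v l). cmod (f (axis_point s)) * e l s \<le> step_norm 1 (v l) f))"

definition gauss_bound :: "mi_weight \<Rightarrow> (real \<Rightarrow> real) \<Rightarrow> bool" where
  "gauss_bound w G \<longleftrightarrow> (\<exists>K>0. \<forall>s\<ge>0. shifted_gauss 0 s \<in> step_space 1 w \<and>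
     step_norm 1 w (shifted_gauss 0 s) \<le> K * G s)"

text \<open>Equality of the projective limits bounds each norm of the first family by finitely many norms of
  the second, hence by the one with the least parameter.\<close>

lemma beurling_eq_imp_growth_le:
  assumes v: "\<And>l. l > 0 \<Longrightarrow> pos_weight (v l)" and w: "\<And>l. l > 0 \<Longrightarrow> pos_weight (w l)"
    and eq: "beurling 1 v = beurling 1 w"
    and e: "eval_bound v e"
    and mono: "\<And>l l' \<alpha> \<beta>. 0 < l \<Longrightarrow> l \<le> l' \<Longrightarrow> w l \<alpha> \<beta> \<le> w l' \<alpha> \<beta>"
    and G: "\<And>l. l > 0 \<Longrightarrow> gauss_bound (w l) (G l)"
    and l0: "l0 > 0"
  shows "\<exists>l>0. \<exists>C>0. \<forall>s\<ge>0. e l0 s \<le> C * G l s"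
proof -
  define E where "E = (\<Inter>l\<in>{0<..}. step_space 1 (v l))"
  have Ew: "E = (\<Inter>l\<in>{0<..}. step_space 1 (w l))"
    using eq by (simp add: beurling_def Let_def E_def)
  have E: "fun_subspace E" unfolding E_def by (rule fun_subspace_Inter_steps[OF v])
  let ?p = "step_norm 1 (v l0)"
  have "\<exists>F K. finite F \<and> F \<subseteq> (\<lambda>l. step_norm 1 (w l)) ` {0<..} \<and> K > 0 \<and>
      (\<forall>f\<in>E. ?p f \<le> K * (\<Sum>q\<in>F. q f))"
  proof (rule open_unit_ball_transfer[where P = "(\<lambda>l. step_norm 1 (v l)) ` {0<..}"])
    show "seminorm_topology E ((\<lambda>l. step_norm 1 (v l)) ` {0<..}) =
        seminorm_topology E ((\<lambda>l. step_norm 1 (w l)) ` {0<..})"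
      using arg_cong[OF eq, of snd]
      by (simp only: beurling_def Let_def E_def[symmetric] Ew[symmetric] snd_conv)
    show "seminorm_on E p" if "p \<in> (\<lambda>l. step_norm 1 (v l)) ` {0<..}" for p
      unfolding E_def by (rule seminorm_on_Inter_steps[OF v that])
    show "seminorm_on E p" if "p \<in> (\<lambda>l. step_norm 1 (w l)) ` {0<..}" for p
      unfolding Ew by (rule seminorm_on_Inter_steps[OF w that])
  qed (use E l0 in \<open>auto simp: fun_subspace_def\<close>)
  then obtain F K where F: "finite F" "F \<subseteq> (\<lambda>l. step_norm 1 (w l)) ` {0<..}" "K > 0"
    and pF: "\<And>f. f \<in> E \<Longrightarrow> ?p f \<le> K * (\<Sum>q\<in>F. q f)"
    by blast
  obtain L where L: "finite L" "L \<subseteq> {0<..}" "F = (\<lambda>l. step_norm 1 (w l)) ` L"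
    using finite_subset_image[OF F(1,2)] by blast
  \<comment> \<open>The parameter \<open>1\<close> is inserted because \<open>L\<close> may be empty.\<close>
  define l where "l = Min (insert 1 L)"
  have l: "l > 0" "\<And>k. k \<in> L \<Longrightarrow> l \<le> k"
    using L(1,2) by (auto simp: l_def)
  obtain K' where K': "K' > 0" "\<And>s. s \<ge> 0 \<Longrightarrow> step_norm 1 (w l) (shifted_gauss 0 s) \<le> K' * G l s"
    using G[OF l(1)] unfolding gauss_bound_def by blast
  have "e l0 s \<le> (K * (real (card F) + 1) * K') * G l s" if s: "s \<ge> 0" for s
  proof -
    let ?f = "shifted_gauss 0 s"
    have f: "?f \<in> step_space 1 (w k)" if "k > 0" for k
      using G[OF that] s unfolding gauss_bound_def by blast
    then have fE: "?f \<in> E" by (simp add: Ew)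
    have q: "q ?f \<le> step_norm 1 (w l) ?f" if qF: "q \<in> F" for q
    proof -
      obtain k where k: "k \<in> L" "q = step_norm 1 (w k)" using qF L(3) by blast
      have "k > 0" using k(1) L(2) by auto
      have le: "w l \<alpha> \<beta> \<le> 1 * w k \<alpha> \<beta>" for \<alpha> \<beta>
        using mono[OF l(1) l(2)[OF k(1)]] by simp
      show ?thesis
        using step_space_le(2)[OF w[OF l(1)] w[OF \<open>k > 0\<close>] zero_less_one le f[OF l(1)]] k(2) by simp
    qed
    have "e l0 s \<le> ?p ?f"
      using e l0 s fE shifted_gauss_axis_point[of s] unfolding eval_bound_def E_def by fastforce
    also have "\<dots> \<le> K * (\<Sum>q\<in>F. q ?f)" by (rule pF[OF fE])
    also have "\<dots> \<le> K * (real (card F) * step_norm 1 (w l) ?f)"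
      using q F(3) by (intro mult_left_mono sum_bounded_above) auto
    also have "\<dots> \<le> K * ((real (card F) + 1) * step_norm 1 (w l) ?f)"
      using F(3) step_norm_nonneg[of 1 "w l" ?f] by (intro mult_left_mono mult_right_mono) auto
    also have "\<dots> \<le> K * ((real (card F) + 1) * (K' * G l s))"
      using F(3) K'(2)[OF s] by (intro mult_left_mono) auto
    finally show ?thesis by (simp add: mult.assoc)
  qed
  then show ?thesis
    using l(1) F(3) K'(1) by (intro exI[of _ l] conjI exI[of _ "K * (real (card F) + 1) * K'"]) auto
qed

text \<open>A gliding hump.  If the claim fails, there are points \<open>s n\<close> at which \<open>e n\<close> exceeds \<open>n * G\<close>.  The
  supremum of \<open>\<bar>f (s n)\<bar> * e n (s n)\<close> over \<open>n\<close> is a seminorm that is continuous on every step of the first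
  family, because \<open>e n \<le> e l\<close> for all but finitely many \<open>n\<close>.  So it is continuous for the common
  topology, hence bounded on the step \<open>l0\<close> of the second family; the Gaussians centred at \<open>s n\<close>
  contradict this.\<close>

lemma roumieu_eq_imp_growth_le:
  assumes v: "\<And>l. l > 0 \<Longrightarrow> pos_weight (v l)" and w: "\<And>l. l > 0 \<Longrightarrow> pos_weight (w l)"
    and eq: "roumieu 1 v = roumieu 1 w"
    and e: "eval_bound v e"
    and mono: "\<And>l l' s. 0 < l \<Longrightarrow> l \<le> l' \<Longrightarrow> s \<ge> 0 \<Longrightarrow> e l' s \<le> e l s"
    and G: "gauss_bound (w l0) G" and l0: "l0 > 0"
  shows "\<exists>l>0. \<exists>C>0. \<forall>s\<ge>0. e l s \<le> C * G s"
proof (rule ccontr)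
  assume neg: "\<not> (\<exists>l>0. \<exists>C>0. \<forall>s\<ge>0. e l s \<le> C * G s)"
  have "\<exists>s\<ge>0. e (real (Suc n)) s > real (Suc n) * G s" for n
  proof (rule ccontr)
    assume "\<not> ?thesis"
    then have "\<forall>s\<ge>0. e (real (Suc n)) s \<le> real (Suc n) * G s" by (meson not_less)
    then show False using neg of_nat_0_less_iff[of "Suc n"] by (metis zero_less_Suc)
  qed
  then obtain s where s: "\<And>n. s n \<ge> 0" "\<And>n. e (real (Suc n)) (s n) > real (Suc n) * G (s n)"
    by metis
  define E where "E = (\<Union>l\<in>{0<..}. step_space 1 (v l))"
  have Ew: "E = (\<Union>l\<in>{0<..}. step_space 1 (w l))"
    using eq by (simp add: roumieu_def Let_def E_def)
  define T where "T = (\<lambda>f n. cmod (f (axis_point (s n))) * e (real (Suc n)) (s n))"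
  define p where "p = (\<lambda>f. SUP n. T f n)"
  have epos: "e l (s n) > 0" if "l > 0" for l n
    using e that s(1) unfolding eval_bound_def by blast
  have T0: "T f n \<ge> 0" for f n
    using epos[of "real (Suc n)" n] by (simp add: T_def)
  have step_bd: "\<exists>K>0. \<forall>f\<in>step_space 1 (v l). \<forall>n. T f n \<le> K * step_norm 1 (v l) f" if l: "l > 0" for l
  proof -
    \<comment> \<open>Beyond \<open>N\<close> monotonicity in the parameter applies; the remaining terms are finitely many.\<close>
    define N where "N = nat \<lceil>l\<rceil>"
    define S where "S = (\<Sum>n<N. e (real (Suc n)) (s n) / e l (s n))"
    have S0: "S \<ge> 0"
      unfolding S_def using epos l by (intro sum_nonneg) (auto simp: less_imp_le)
    have "T f n \<le> (1 + S) * step_norm 1 (v l) f" if f: "f \<in> step_space 1 (v l)" for f n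
    proof -
      let ?c = "cmod (f (axis_point (s n)))"
      have ev: "?c * e l (s n) \<le> step_norm 1 (v l) f"
        using e l f s(1) unfolding eval_bound_def by blast
      have "e (real (Suc n)) (s n) \<le> (1 + S) * e l (s n)"
      proof (cases "n < N")
        case True
        have "e (real (Suc n)) (s n) / e l (s n) \<le> S"
          unfolding S_def using True epos l by (intro member_le_sum) (auto simp: less_imp_le)
        then have "e (real (Suc n)) (s n) / e l (s n) \<le> 1 + S" by simp
        then show ?thesis using epos[OF l, of n] by (simp add: pos_divide_le_eq)
      next
        case False
        then have "l \<le> real (Suc n)" unfolding N_def by linarith
        then have "e (real (Suc n)) (s n) \<le> e l (s n)" using l s(1) by (intro mono)
        also have "\<dots> \<le> (1 + S) * e l (s n)" using S0 epos[OF l, of n] by simp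
        finally show ?thesis .
      qed
      then have "T f n \<le> ?c * ((1 + S) * e l (s n))"
        unfolding T_def by (rule mult_left_mono) simp
      also have "\<dots> = (1 + S) * (?c * e l (s n))" by simp
      also have "\<dots> \<le> (1 + S) * step_norm 1 (v l) f"
        using ev S0 by (intro mult_left_mono) auto
      finally show ?thesis .
    qed
    then show ?thesis using S0 by (intro exI[of _ "1 + S"]) auto
  qed
  have bdd: "bdd_above (range (T f))" if f: "f \<in> E" for f
  proof -
    obtain l where l: "l > 0" "f \<in> step_space 1 (v l)" using f by (auto simp: E_def)
    obtain K where "\<And>n. T f n \<le> K * step_norm 1 (v l) f" using step_bd[OF l(1)] l(2) by blast
    then show ?thesis by (intro bdd_aboveI2[where M = "K * step_norm 1 (v l) f"])
  qed
  have Tp: "T f n \<le> p f" if "f \<in> E" for f n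
    unfolding p_def by (rule cSUP_upper[OF _ bdd[OF that]]) simp
  have Escale: "(\<lambda>x. c * f x) \<in> E" if "f \<in> E" for f c
    using that step_scale(1)[OF v, where d = 1] unfolding E_def by blast
  have p: "seminorm_on E p"
  proof (rule seminorm_onI[OF Escale])
    fix f assume f: "f \<in> E"
    show "p f \<ge> 0" using Tp[OF f, of 0] T0[of f 0] by linarith
    fix c
    show "p (\<lambda>x. c * f x) \<le> cmod c * p f"
    proof (subst p_def, rule cSUP_least)
      fix n
      have "T (\<lambda>x. c * f x) n = cmod c * T f n" by (simp add: T_def norm_mult mult.assoc)
      also have "\<dots> \<le> cmod c * p f" by (intro mult_left_mono Tp[OF f]) simp
      finally show "T (\<lambda>x. c * f x) n \<le> cmod c * p f" .
    qed simp
    fix g assume g: "g \<in> E"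
    show "p (\<lambda>x. f x + g x) \<le> p f + p g"
    proof (subst p_def, rule cSUP_least)
      fix n
      have "T (\<lambda>x. f x + g x) n \<le> T f n + T g n"
        unfolding T_def distrib_right[symmetric] using epos[of "real (Suc n)" n]
        by (intro mult_right_mono norm_triangle_ineq) auto
      also have "\<dots> \<le> p f + p g" by (intro add_mono Tp f g)
      finally show "T (\<lambda>x. f x + g x) n \<le> p f + p g" .
    qed simp
  qed
  let ?Pv = "{p. seminorm_on E p \<and> (\<forall>l>0. continuous_map
      (seminorm_topology (step_space 1 (v l)) {step_norm 1 (v l)}) euclideanreal p)}"
  let ?Pw = "{p. seminorm_on E p \<and> (\<forall>l>0. continuous_map
      (seminorm_topology (step_space 1 (w l)) {step_norm 1 (w l)}) euclideanreal p)}"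
  have cont_iff: "continuous_map (seminorm_topology (step_space 1 u) {step_norm 1 u}) euclideanreal q \<longleftrightarrow>
      (\<exists>K>0. \<forall>f\<in>step_space 1 u. q f \<le> K * step_norm 1 u f)"
    if "pos_weight u" "seminorm_on E q" "step_space 1 u \<subseteq> E" for u q
    by (rule continuous_seminorm_iff[OF fun_subspace_step_space[OF that(1)]
          seminorm_on_subset[OF that(2,3)] seminorm_on_step_norm[OF that(1)]])
  have pP: "p \<in> ?Pv"
  proof (intro CollectI conjI p allI impI)
    fix l :: real assume l: "l > 0"
    obtain K where K: "K > 0" "\<And>f n. f \<in> step_space 1 (v l) \<Longrightarrow> T f n \<le> K * step_norm 1 (v l) f"
      using step_bd[OF l] by blast
    have "p f \<le> K * step_norm 1 (v l) f" if "f \<in> step_space 1 (v l)" for f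
      unfolding p_def by (rule cSUP_least) (use K(2)[OF that] in auto)
    moreover have "step_space 1 (v l) \<subseteq> E" using l by (auto simp: E_def)
    ultimately show "continuous_map (seminorm_topology (step_space 1 (v l)) {step_norm 1 (v l)}) euclideanreal p"
      using cont_iff[OF v[OF l] p] K(1) by blast
  qed
  have "\<exists>F K. finite F \<and> F \<subseteq> ?Pw \<and> K > 0 \<and> (\<forall>f\<in>E. p f \<le> K * (\<Sum>q\<in>F. q f))"
  proof (rule open_unit_ball_transfer[OF Escale _ _ _ _ pP])
    show "(\<lambda>x. 0) \<in> E"
      using fun_subspace_step_space[OF v[OF l0]] l0 by (auto simp: E_def fun_subspace_def)
    show "seminorm_topology E ?Pv = seminorm_topology E ?Pw"
      using arg_cong[OF eq, of snd]
      by (simp only: roumieu_def Let_def E_def[symmetric] Ew[symmetric] snd_conv)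
  qed auto
  then obtain F K where F: "finite F" "F \<subseteq> ?Pw" "K > 0" "\<And>f. f \<in> E \<Longrightarrow> p f \<le> K * (\<Sum>q\<in>F. q f)"
    by blast
  let ?N = "step_norm 1 (w l0)"
  have sub: "step_space 1 (w l0) \<subseteq> E" using l0 by (auto simp: Ew)
  have "\<exists>k>0. \<forall>f\<in>step_space 1 (w l0). q f \<le> k * ?N f" if "q \<in> F" for q
  proof -
    have q: "seminorm_on E q"
      "continuous_map (seminorm_topology (step_space 1 (w l0)) {step_norm 1 (w l0)}) euclideanreal q"
      using that F(2) l0 by auto
    show ?thesis using cont_iff[OF w[OF l0] q(1) sub] q(2) by blast
  qed
  then obtain k where k: "\<And>q. q \<in> F \<Longrightarrow> k q > 0"
    "\<And>q f. q \<in> F \<Longrightarrow> f \<in> step_space 1 (w l0) \<Longrightarrow> q f \<le> k q * ?N f"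
    by metis
  define C where "C = K * (\<Sum>q\<in>F. k q)"
  have C0: "C \<ge> 0" using F(3) k(1) by (auto simp: C_def less_imp_le intro!: mult_nonneg_nonneg sum_nonneg)
  obtain K' where K': "K' > 0" "\<And>s. s \<ge> 0 \<Longrightarrow> shifted_gauss 0 s \<in> step_space 1 (w l0)"
    "\<And>s. s \<ge> 0 \<Longrightarrow> ?N (shifted_gauss 0 s) \<le> K' * G s"
    using G unfolding gauss_bound_def by blast
  have bound: "e (real (Suc n)) (s n) \<le> (C * K') * G (s n)" for n
  proof -
    let ?f = "shifted_gauss 0 (s n)"
    have f: "?f \<in> step_space 1 (w l0)" by (rule K'(2)[OF s(1)])
    have "e (real (Suc n)) (s n) = T ?f n" by (simp add: T_def shifted_gauss_axis_point)
    also have "\<dots> \<le> p ?f" using f sub by (intro Tp) auto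
    also have "\<dots> \<le> K * (\<Sum>q\<in>F. q ?f)" using f sub by (intro F(4)) auto
    also have "\<dots> \<le> K * (\<Sum>q\<in>F. k q * ?N ?f)"
      using F(3) k(2)[OF _ f] by (intro mult_left_mono sum_mono) auto
    also have "\<dots> = C * ?N ?f" by (simp add: C_def sum_distrib_right)
    also have "\<dots> \<le> C * (K' * G (s n))" using C0 K'(3)[OF s(1)] by (intro mult_left_mono)
    finally show ?thesis by (simp add: mult.assoc)
  qed
  obtain n :: nat where n: "C * K' < real n" using reals_Archimedean2 by blast
  have "G (s n) > 0"
  proof -
    have "0 < (C * K') * G (s n)" using epos[of "real (Suc n)" n] bound[of n] by simp
    moreover have "C * K' \<ge> 0" using C0 K'(1) by simp
    ultimately show ?thesis by (metis mult_nonneg_nonpos not_less)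
  qed
  then have "(C * K') * G (s n) \<le> real (Suc n) * G (s n)"
    using n by (intro mult_right_mono) auto
  then show False using bound[of n] s(2)[of n] by linarith
qed

lemma eval_bound_seq:
  "LC M \<Longrightarrow> eval_bound (seq_weight Joint M 1) (\<lambda>h s. exp (assoc_fun M (s / h)))"
  unfolding eval_bound_def using eval_seq_bound by auto

lemma eval_bound_fun:
  "weight_function \<omega> \<Longrightarrow> eval_bound (fun_weight Joint \<omega> 1) (\<lambda>l s. exp (\<omega> s / l) / max 1 s)"
  unfolding eval_bound_def using eval_fun_bound by (auto simp: less_max_iff_disj)

lemma gauss_bound_seq:
  assumes "LC M" "B > 0" "C > 0" "H > 0"
    and "\<And>p q. sqrt (real p) ^ p * M q \<le> B * C ^ p * H ^ (p + q) * M (p + q)" "h \<ge> 2 * H * C"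
  shows "gauss_bound (seq_weight Joint M 1 h) (\<lambda>s. exp (assoc_fun M (2 * H / h * s)))"
  unfolding gauss_bound_def
  using shifted_gauss_seq_norm[OF assms] assms(2) by (intro exI[of _ "4 * B"]) (auto simp: mult.assoc)

lemma gauss_bound_fun:
  assumes "weight_function \<omega>" "l > 0" "\<And>x. x \<ge> 1 \<Longrightarrow> \<omega> x \<le> \<epsilon> * x\<^sup>2 + K" "4 * (exp 1)\<^sup>2 * \<epsilon> \<le> l"
  shows "gauss_bound (fun_weight Joint \<omega> 1 l) (\<lambda>s. exp (\<omega> (2 * s) / l))"
proof -
  obtain A where A: "A \<ge> 1" "\<And>b. 2 ^ b * sqrt (real b) ^ b \<le> A * conj_weight \<omega> l b"
    using sqrt_power_le_conj_weight[OF assms] by blast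
  show ?thesis
    unfolding gauss_bound_def
    using shifted_gauss_fun_norm[OF assms(1,2) A] A(1)
    by (intro exI[of _ "4 * A * exp (\<omega> 1 / l)"]) (auto simp: mult.assoc)
qed

text \<open>Two copies of \<open>assoc_fun M\<close> cost \<open>2 * \<omega> / l1 \<le> \<omega> / (2 * l2)\<close>, which is still paid for by one copy of
  \<open>assoc_fun M\<close> after half of \<open>\<omega> / l2\<close> has been spent on the logarithm of \<open>max 1 s\<close>.\<close>

lemma growth_equivalence_imp_cond_i:
  assumes M: "LC M" and \<omega>: "weight_function \<omega>"
    and pos: "C1 > 0" "C2 > 0" "h > 0" "r > 0" "l1 > 0" "l2 > 0" and l: "4 * l2 \<le> l1"
    and up: "\<And>s. s \<ge> 0 \<Longrightarrow> exp (assoc_fun M (s / h)) \<le> C1 * exp (\<omega> (2 * s) / l1)"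
    and low: "\<And>s. s \<ge> 0 \<Longrightarrow> exp (\<omega> s / l2) / max 1 s \<le> C2 * exp (assoc_fun M (r * s))"
  shows "cond_i M"
proof -
  obtain K where K: "K \<ge> 0" "\<And>x. x \<ge> 1 \<Longrightarrow> ln x \<le> 1 / (2 * l2) * \<omega> x + K"
    using ln_le_weight_function[OF \<omega>, of "1 / (2 * l2)"] pos by auto
  have low': "\<omega> s / (2 * l2) \<le> ln C2 + K + assoc_fun M (r * s)" if s: "s \<ge> 0" for s
  proof -
    have lnmax: "ln (max 1 s) \<le> \<omega> s / (2 * l2) + K"
      using K s weight_function_nonneg[OF \<omega> s] pos(6) by (cases "s \<ge> 1") (auto simp: max_def)
    have "exp (\<omega> s / l2) \<le> (C2 * exp (assoc_fun M (r * s))) * max 1 s"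
      using low[OF s] by (simp add: pos_divide_le_eq)
    also have "\<dots> = exp (ln C2 + assoc_fun M (r * s) + ln (max 1 s))"
      using pos(2) by (simp add: exp_add)
    finally have "\<omega> s / l2 \<le> ln C2 + assoc_fun M (r * s) + ln (max 1 s)" by simp
    moreover have "\<omega> s / l2 = \<omega> s / (2 * l2) + \<omega> s / (2 * l2)" by simp
    ultimately show ?thesis using lnmax by linarith
  qed
  have "2 * assoc_fun M t \<le> assoc_fun M ((2 * r * h) * t) + (2 * ln C1 + ln C2 + K)" if t: "t \<ge> 0" for t
  proof -
    let ?s = "h * t"
    have s: "?s \<ge> 0" using t pos by simp
    have "exp (assoc_fun M t) \<le> exp (ln C1 + \<omega> (2 * ?s) / l1)"
      using up[OF s] pos by (simp add: exp_add)
    then have 1: "assoc_fun M t \<le> ln C1 + \<omega> (2 * ?s) / l1" by simp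
    have "2 * (\<omega> (2 * ?s) / l1) \<le> \<omega> (2 * ?s) / (2 * l2)"
    proof -
      have "\<omega> (2 * ?s) / l1 \<le> \<omega> (2 * ?s) / (4 * l2)"
        using l pos weight_function_nonneg[OF \<omega>, of "2 * ?s"] s by (intro divide_left_mono) auto
      then show ?thesis by simp
    qed
    also have "\<dots> \<le> ln C2 + K + assoc_fun M (r * (2 * ?s))"
      using s by (intro low') simp
    finally show ?thesis using 1 by (simp add: mult_ac)
  qed
  then show ?thesis
    using pos by (intro assoc_fun_doubling_imp_cond_i[OF M, of "2 * r * h"]) auto
qed

lemma assoc_fun_dilation_antimono:
  assumes "LC M" "0 < l" "l \<le> l'" "s \<ge> 0"
  shows "exp (assoc_fun M (s / l')) \<le> exp (assoc_fun M (s / l))"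
  using assms by (auto intro!: assoc_fun_mono divide_left_mono)

text \<open>In the Roumieu case the inclusion of the sequence space into the other space is used first.  It
  determines \<open>l2\<close>, and the reverse inclusion may be used for any large \<open>l1\<close>.\<close>

lemma realizes_roumieu_imp_cond_i:
  assumes M: "LC M" and a: "cond_a_roumieu M" and r: "realizes_roumieu M \<omega>"
  shows "cond_i M"
proof -
  have \<omega>: "weight_function \<omega>"
    and eq: "roumieu 1 (fun_weight Joint \<omega> 1) = roumieu 1 (seq_weight Joint M 1)"
    using r by (auto simp: realizes_roumieu_def S_fun_roumieu_def S_seq_roumieu_def)
  note fw = pos_fun_weight[of Joint \<omega> 1] and sw = pos_seq_weight[OF M, of _ Joint 1]
  obtain B C H where BCH: "B > 0" "C > 0" "H > 0"
    and aB: "\<And>p q. sqrt (real p) ^ p * M q \<le> B * C ^ p * H ^ (p + q) * M (p + q)"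
    using a unfolding cond_a_roumieu_def by blast
  define h0 where "h0 = 2 * H * C"
  have h0: "h0 > 0" "h0 \<ge> 2 * H * C" using BCH by (auto simp: h0_def)
  have emono: "exp (\<omega> s / l') / max 1 s \<le> exp (\<omega> s / l) / max 1 s" if "0 < l" "l \<le> l'" "s \<ge> 0" for l l' s
    using that weight_function_nonneg[OF \<omega>, of s] by (intro divide_right_mono) (auto intro: divide_left_mono)
  have "\<exists>l>0. \<exists>C>0. \<forall>s\<ge>0. exp (\<omega> s / l) / max 1 s \<le> C * exp (assoc_fun M (2 * H / h0 * s))"
    by (rule roumieu_eq_imp_growth_le[OF fw sw eq eval_bound_fun[OF \<omega>] emono
          gauss_bound_seq[OF M BCH aB h0(2)] h0(1)])
  then obtain l2 C2 where 2: "l2 > 0" "C2 > 0"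
    "\<And>s. s \<ge> 0 \<Longrightarrow> exp (\<omega> s / l2) / max 1 s \<le> C2 * exp (assoc_fun M (2 * H / h0 * s))"
    by blast
  obtain \<epsilon> K where eK: "\<epsilon> > 0" "\<And>x. x \<ge> 1 \<Longrightarrow> \<omega> x \<le> \<epsilon> * x\<^sup>2 + K"
    using weight_function_le_square[OF \<omega>] by blast
  define l1 where "l1 = max (4 * l2) (4 * (exp 1)\<^sup>2 * \<epsilon>)"
  have l1: "l1 > 0" "4 * l2 \<le> l1" "4 * (exp 1)\<^sup>2 * \<epsilon> \<le> l1" using 2(1) by (auto simp: l1_def)
  have "\<exists>h>0. \<exists>C>0. \<forall>s\<ge>0. exp (assoc_fun M (s / h)) \<le> C * exp (\<omega> (2 * s) / l1)"
    by (rule roumieu_eq_imp_growth_le[OF sw fw eq[symmetric] eval_bound_seq[OF M]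
          assoc_fun_dilation_antimono[OF M] gauss_bound_fun[OF \<omega> l1(1) eK(2) l1(3)] l1(1)])
  then obtain h C1 where 1: "h > 0" "C1 > 0"
    "\<And>s. s \<ge> 0 \<Longrightarrow> exp (assoc_fun M (s / h)) \<le> C1 * exp (\<omega> (2 * s) / l1)"
    by blast
  have "2 * H / h0 > 0" using BCH h0 by simp
  then show ?thesis
    by (rule growth_equivalence_imp_cond_i[OF M \<omega> 1(2) 2(2) 1(1) _ l1(1) 2(1) l1(2) 1(3) 2(3)])
qed

text \<open>In the Beurling case the order is reversed: the norm with \<open>h = 1\<close> of the sequence space determines
  \<open>l1\<close>, and every norm of the other space is controlled, in particular that for \<open>l1 / 4\<close>.\<close>

lemma realizes_beurling_imp_cond_i:
  assumes M: "LC M" and a: "cond_a_beurling M" and r: "realizes_beurling M \<omega>"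
  shows "cond_i M"
proof -
  have \<omega>: "weight_function \<omega>" and small: "\<omega> \<in> o[at_top](\<lambda>t. t\<^sup>2)"
    and eq: "beurling 1 (fun_weight Joint \<omega> 1) = beurling 1 (seq_weight Joint M 1)"
    using r by (auto simp: realizes_beurling_def S_fun_beurling_def S_seq_beurling_def)
  note fw = pos_fun_weight[of Joint \<omega> 1] and sw = pos_seq_weight[OF M, of _ Joint 1]
  obtain H where H: "H > 0"
    and aB: "\<And>C. C > 0 \<Longrightarrow> \<exists>B>0. \<forall>p q. sqrt (real p) ^ p * M q \<le> B * C ^ p * H ^ (p + q) * M (p + q)"
    using a unfolding cond_a_beurling_def by blast
  have gs: "gauss_bound (seq_weight Joint M 1 h) (\<lambda>s. exp (assoc_fun M (2 * H / h * s)))" if h: "h > 0" for h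
  proof -
    have C: "h / (2 * H) > 0" "2 * H * (h / (2 * H)) \<le> h" using h H by auto
    obtain B where "B > 0"
      "\<And>p q. sqrt (real p) ^ p * M q \<le> B * (h / (2 * H)) ^ p * H ^ (p + q) * M (p + q)"
      using aB[OF C(1)] by blast
    then show ?thesis using C(2) by (intro gauss_bound_seq[OF M _ C(1) H])
  qed
  have gf: "gauss_bound (fun_weight Joint \<omega> 1 l) (\<lambda>s. exp (\<omega> (2 * s) / l))" if l: "l > 0" for l
  proof -
    define \<epsilon> where "\<epsilon> = l / (4 * (exp 1)\<^sup>2)"
    have e: "\<epsilon> > 0" "4 * (exp 1)\<^sup>2 * \<epsilon> \<le> l" using l by (auto simp: \<epsilon>_def)
    obtain K where "\<And>x. x \<ge> 1 \<Longrightarrow> \<omega> x \<le> \<epsilon> * x\<^sup>2 + K"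
      using smallo_square_le[OF \<omega> small e(1)] by blast
    then show ?thesis using e(2) by (rule gauss_bound_fun[OF \<omega> l])
  qed
  have fmono: "fun_weight Joint \<omega> 1 l \<alpha> \<beta> \<le> fun_weight Joint \<omega> 1 l' \<alpha> \<beta>" if "0 < l" "l \<le> l'" for l l' \<alpha> \<beta>
    using conj_weight_mono[OF \<omega> that] by (simp add: W_eq_conj_weight)
  have smono: "seq_weight Joint M 1 l \<alpha> \<beta> \<le> seq_weight Joint M 1 l' \<alpha> \<beta>" if "0 < l" "l \<le> l'" for l l' \<alpha> \<beta>
    using that LC_pos[OF M] by (auto intro!: mult_right_mono power_mono simp: less_imp_le)
  have "\<exists>l>0. \<exists>C>0. \<forall>s\<ge>0. exp (assoc_fun M (s / 1)) \<le> C * exp (\<omega> (2 * s) / l)"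
    by (rule beurling_eq_imp_growth_le[OF sw fw eq[symmetric] eval_bound_seq[OF M] fmono gf zero_less_one])
  then obtain l1 C1 where 1: "l1 > 0" "C1 > 0"
    "\<And>s. s \<ge> 0 \<Longrightarrow> exp (assoc_fun M (s / 1)) \<le> C1 * exp (\<omega> (2 * s) / l1)"
    by blast
  have l2: "l1 / 4 > 0" "4 * (l1 / 4) \<le> l1" using 1(1) by auto
  have "\<exists>h>0. \<exists>C>0. \<forall>s\<ge>0. exp (\<omega> s / (l1 / 4)) / max 1 s \<le> C * exp (assoc_fun M (2 * H / h * s))"
    by (rule beurling_eq_imp_growth_le[OF fw sw eq eval_bound_fun[OF \<omega>] smono gs l2(1)])
  then obtain h C2 where 2: "h > 0" "C2 > 0"
    "\<And>s. s \<ge> 0 \<Longrightarrow> exp (\<omega> s / (l1 / 4)) / max 1 s \<le> C2 * exp (assoc_fun M (2 * H / h * s))"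
    by blast
  have "2 * H / h > 0" using H 2(1) by simp
  then show ?thesis
    by (rule growth_equivalence_imp_cond_i[OF M \<omega> 1(2) 2(2) zero_less_one _ 1(1) l2 1(3) 2(3)])
qed

section \<open>The characterization\<close>

theorem theorem5p2:
  fixes M :: "nat \<Rightarrow> real"
  assumes "LC M"
    and b: "\<exists>D\<ge>1. \<forall>p. M (p + 1) \<le> D ^ (p + 1) * M p"
    and c: "\<exists>L\<ge>1. \<forall>t\<ge>0. assoc_fun M (2 * t) \<le> L * (assoc_fun M t + 1)"
  shows
    "(cond_a_roumieu M \<longrightarrow>
        (cond_i M \<longleftrightarrow> (\<exists>\<omega>. realizes_roumieu M \<omega>)) \<and>
        (cond_i M \<longrightarrow>
           realizes_roumieu M (assoc_fun M) \<and>
           (\<forall>d\<ge>1. S_seq_roumieu Separated M d = S_seq_roumieu Joint M d) \<and>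
           (\<forall>\<omega>. realizes_roumieu M \<omega> \<longrightarrow>
              (\<forall>d\<ge>1. S_fun_roumieu Separated \<omega> d = S_fun_roumieu Joint \<omega> d)))) \<and>
     (cond_a_beurling M \<longrightarrow>
        (cond_i M \<longleftrightarrow> (\<exists>\<omega>. realizes_beurling M \<omega>)) \<and>
        (cond_i M \<longrightarrow>
           realizes_beurling M (assoc_fun M) \<and>
           (\<forall>d\<ge>1. S_seq_beurling Separated M d = S_seq_beurling Joint M d) \<and>
           (\<forall>\<omega>. realizes_beurling M \<omega> \<longrightarrow>
              (\<forall>d\<ge>1. S_fun_beurling Separated \<omega> d = S_fun_beurling Joint \<omega> d))))"
proof -
  have R: "realizes_roumieu M (assoc_fun M)" if "cond_a_roumieu M" "cond_i M"
    using weight_function_assoc_fun[OF assms(1) that(1) c] weight_doubling_assoc_fun[OF assms(1) that(2)]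
      assoc_fun_realizes_spaces(1)[OF assms(1) _ that(2)]
    by (simp add: realizes_roumieu_def)
  have B: "realizes_beurling M (assoc_fun M)" if a: "cond_a_beurling M" and i: "cond_i M"
    using weight_function_assoc_fun[OF assms(1) cond_a_beurling_imp_roumieu[OF a] c]
      weight_doubling_assoc_fun[OF assms(1) i] assoc_fun_smallo_square[OF assms(1) a]
      assoc_fun_realizes_spaces(2)[OF assms(1) _ i]
    by (simp add: realizes_beurling_def)
  have wf: "weight_function \<omega>" if "realizes_roumieu M \<omega> \<or> realizes_beurling M \<omega>" for \<omega>
    using that by (auto simp: realizes_roumieu_def realizes_beurling_def)
  show ?thesis
    using R B realizes_roumieu_imp_cond_i[OF assms(1)] realizes_beurling_imp_cond_i[OF assms(1)]
      seq_weight_separated_eq_joint[OF assms(1)] fun_weight_separated_eq_joint[OF wf]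
    by blast
qed

end
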